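(* If $s\in\mathcal H$, then $s$ is the shear coordinate of a quasisymmetric circle homeomorphism; that is, there is a quasisymmetric homeomorphism $h:\mathbb T\to\mathbb T$ fixing $-1,\mathrm i,1$ with $s_h=s$. In other words, $\mathcal H\subset\mathrm{QS}(\mathbb T)/\mathrm{M\ddot ob}(\mathbb T)$.
   Context: Farey tessellation: $\mathbb D$ is the unit disk with its hyperbolic metric, $\mathbb T=\partial\mathbb D$, and $(a,b)$ denotes the unoriented hyperbolic geodesic with endpoints $a\ne b\in\mathbb T$. The Farey tessellation $\mathfrak F$ is the ideal triangulation of $\mathbb D$ obtained from the ideal triangle with vertices $1,\mathrm i,-1$ by repeated hyperbolic reflections across edges; $V$ is its vertex set, $E$ its edge set. For $e\in E$, $Q_e$ is the union of the two triangles of $\mathfrak F$ having $e$ as an edge, with vertices $(a,b,c,d)$ counterclockwise, $e=(a,c)$. For $v\in V$, $\mathrm{fan}(v)$ is the set of edges incident to $v$, indexed $(e_n)_{n\in\mathbb Z}$ so that under a Möbius map $\mathbb D\to\mathbb H$ sending $v$ to $\infty$ the $e_n$ become equally spaced vertical lines with $n$ increasing from left to right. Shears: for an orientation-preserving homeomorphism $h$ of $\mathbb T$ fixing $-1,\mathrm i,1$, $s_h(e)=\log\mathrm{cr}(h(a),h(b),h(c),h(d))$ where $Q_e=(a,b,c,d)$, $e=(a,c)$, $\mathrm{cr}(a,b,c,d)=\frac{(b-a)(d-c)}{(c-b)(d-a)}$. Such an $h$ is determined by $s_h$. $\mathrm{QS}(\mathbb T)/\mathrm{M\ddot ob}(\mathbb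 T)$ is identified with the quasisymmetric homeomorphisms of $\mathbb T$ fixing $-1,\mathrm i,1$. $\mathcal P$ is the set of $s:E\to\mathbb R$ such that for every $v\in V$, $\mathrm{fan}(v)=(e_n)$, both limits $\lim_n\sum_{k=-n}^{-1}s(e_k)$ and $\lim_n\sum_{k=0}^n s(e_k)$ exist in $\mathbb R$. For $s\in\mathcal P$ and $e\in\mathrm{fan}(v)$, $p_{s,v}(e\pm)$ is the sum of $s(e')$ over $e'\in\mathrm{fan}(v)$ of strictly larger ($+$) or strictly smaller ($-$) index than $e$. For $e=(a,b)\in E$, $\Psi(s)(e)=\frac14(p_{s,a}(e-)-p_{s,a}(e+)+p_{s,b}(e-)-p_{s,b}(e+))$. Finally $\mathcal H=\{s\in\mathcal P:\sum_{e\in E}\Psi(s)(e)^2<\infty\}$. *)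

theory Defs
  imports "HOL-Analysis.Analysis"
begin

abbreviation unit_circle :: "complex set" ("\<T>") where
  "\<T> \<equiv> sphere 0 1"

text \<open>
  Ideal triangles and geodesics of the disk are represented by their sets of ideal vertices in
  the unit circle.

  For distinct \<open>a\<close>, \<open>b\<close> on the circle, \<open>hyp_refl a b\<close> is the hyperbolic reflection of the closed
  disk across the geodesic \<open>(a, b)\<close>. If \<open>a + b \<noteq> 0\<close>, this is the inversion
  \<open>z \<mapsto> c + (\<bar>c\<bar>\<^sup>2 - 1) / (cnj z - cnj c)\<close> in the circle with centre \<open>c = 2 a b / (a + b)\<close>, which
  meets the unit circle orthogonally in \<open>a\<close> and \<open>b\<close>; if \<open>a + b = 0\<close>, it is the Euclidean
  reflection \<open>z \<mapsto> - a b cnj z\<close> in a diameter. The formula covers both cases, see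
  \<open>hyp_refl_diameter\<close> and \<open>hyp_refl_inversion\<close>.
\<close>

definition hyp_refl :: "complex \<Rightarrow> complex \<Rightarrow> complex \<Rightarrow> complex" where
  "hyp_refl a b z = (2 * a * b * cnj z - (a + b)) / ((a + b) * cnj z - 2)"

lemma hyp_refl_diameter: "hyp_refl a (- a) z = a\<^sup>2 * cnj z"
  by (simp add: hyp_refl_def power2_eq_square)

lemma hyp_refl_inversion:
  assumes "a \<in> \<T>" "b \<in> \<T>" "a + b \<noteq> 0" and c: "c = 2 * a * b / (a + b)" and "z \<noteq> c"
  shows "hyp_refl a b z = c + of_real ((norm c)\<^sup>2 - 1) / (cnj z - cnj c)"
proof -
  have nz: "a \<noteq> 0" "b \<noteq> 0" using assms(1,2) by auto
  have "cnj a = inverse a" "cnj b = inverse b"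
    using assms(1,2) complex_norm_square[of a] complex_norm_square[of b]
    by (auto intro!: inverse_unique[symmetric])
  then have "cnj c = 2 * inverse a * inverse b / (inverse a + inverse b)"
    by (simp add: c)
  also have "\<dots> = 2 / (a + b)"
    using nz assms(3) by (simp add: divide_simps add.commute)
  finally have cc: "cnj c = 2 / (a + b)" .
  have ne: "cnj z - cnj c \<noteq> 0"
    using \<open>z \<noteq> c\<close> by simp
  have "of_real ((norm c)\<^sup>2 - 1) = c * cnj c - 1"
    using complex_norm_square[of c] by simp
  then have "c + of_real ((norm c)\<^sup>2 - 1) / (cnj z - cnj c) = (c * cnj z - 1) / (cnj z - cnj c)"
    using ne by (simp add: field_simps)
  also have "\<dots> = ((a + b) * (c * cnj z - 1)) / ((a + b) * (cnj z - cnj c))"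
    using assms(3) by simp
  also have "(a + b) * (c * cnj z - 1) = 2 * a * b * cnj z - (a + b)"
    using assms(3) by (simp add: c field_simps)
  also have "(a + b) * (cnj z - cnj c) = (a + b) * cnj z - 2"
    using assms(3) by (simp add: cc field_simps)
  finally show ?thesis by (simp add: hyp_refl_def)
qed

inductive_set farey_triangles :: "complex set set" where
  base: "{1, \<i>, -1} \<in> farey_triangles"
| reflect: "\<lbrakk>t \<in> farey_triangles; a \<in> t; b \<in> t; a \<noteq> b\<rbrakk> \<Longrightarrow> hyp_refl a b ` t \<in> farey_triangles"

definition farey_vertices :: "complex set" where
  "farey_vertices = \<Union> farey_triangles"

definition farey_edges :: "complex set set" where
  "farey_edges = {{a, b} | a b t. t \<in> farey_triangles \<and> a \<in> t \<and> b \<in> t \<and> a \<noteq> b}"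

definition ccw_quad :: "complex \<Rightarrow> complex \<Rightarrow> complex \<Rightarrow> complex \<Rightarrow> bool" where
  "ccw_quad a b c d \<longleftrightarrow>
     (\<exists>\<alpha> \<beta> \<gamma> \<delta>. \<alpha> < \<beta> \<and> \<beta> < \<gamma> \<and> \<gamma> < \<delta> \<and> \<delta> < \<alpha> + 2 * pi \<and>
        a = cis \<alpha> \<and> b = cis \<beta> \<and> c = cis \<gamma> \<and> d = cis \<delta>)"

text \<open>
  \<open>farey_quad a b c d\<close> states that \<open>Q\<^sub>e\<close> for the edge \<open>e = (a, c)\<close> has the vertices \<open>a, b, c, d\<close>
  in counterclockwise order.
\<close>

definition farey_quad :: "complex \<Rightarrow> complex \<Rightarrow> complex \<Rightarrow> complex \<Rightarrow> bool" where
  "farey_quad a b c d \<longleftrightarrow>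
     {a, b, c} \<in> farey_triangles \<and> {a, c, d} \<in> farey_triangles \<and> ccw_quad a b c d"

definition cross_ratio :: "complex \<Rightarrow> complex \<Rightarrow> complex \<Rightarrow> complex \<Rightarrow> complex" where
  "cross_ratio a b c d = ((b - a) * (d - c)) / ((c - b) * (d - a))"

lemma cross_ratio_swap: "cross_ratio c d a b = cross_ratio a b c d"
proof -
  have "(a - d) * (b - c) = (c - b) * (d - a)" by (simp add: algebra_simps)
  then show ?thesis by (simp add: cross_ratio_def mult.commute)
qed

text \<open>
  An edge \<open>e\<close> has the two labellings \<open>(a, b, c, d)\<close> and \<open>(c, d, a, b)\<close> of \<open>Q\<^sub>e\<close>, and these give
  the same cross ratio by \<open>cross_ratio_swap\<close>. The cross ratio of four points in counterclockwise
  order on the circle is a positive real number.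
\<close>

definition shear :: "(complex \<Rightarrow> complex) \<Rightarrow> complex set \<Rightarrow> real" where
  "shear h e = (THE x. \<exists>a b c d. farey_quad a b c d \<and> e = {a, c} \<and>
                         x = ln (Re (cross_ratio (h a) (h b) (h c) (h d))))"

text \<open>Orientation preservation is expressed by an increasing lift to the real line.\<close>

definition circle_homeo :: "(complex \<Rightarrow> complex) \<Rightarrow> bool" where
  "circle_homeo h \<longleftrightarrow>
     (\<exists>g. homeomorphism \<T> \<T> h g) \<and>
     (\<exists>\<phi> :: real \<Rightarrow> real. continuous_on UNIV \<phi> \<and> strict_mono \<phi> \<and>
        (\<forall>x. h (cis x) = cis (\<phi> x)))"

definition quasisymmetric :: "(complex \<Rightarrow> complex) \<Rightarrow> bool" where
  "quasisymmetric h \<longleftrightarrow> circle_homeo h \<and>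
     (\<exists>M\<ge>1. \<forall>x t. 0 < t \<and> t < pi \<longrightarrow>
        1 / M \<le> norm (h (cis (x + t)) - h (cis x)) / norm (h (cis x) - h (cis (x - t))) \<and>
        norm (h (cis (x + t)) - h (cis x)) / norm (h (cis x) - h (cis (x - t))) \<le> M)"

definition fan :: "complex \<Rightarrow> complex set set" where
  "fan v = {e \<in> farey_edges. v \<in> e}"

text \<open>
  A Moebius map \<open>z \<mapsto> (\<alpha> z + \<beta>) / (\<gamma> z + \<delta>)\<close> of the disk onto the upper half plane that sends \<open>v\<close>
  to infinity takes the geodesic \<open>(v, w)\<close> to the vertical line over the image of \<open>w\<close>. Two such
  maps differ by an increasing real affine map, so the choice of the map does not matter, and an
  indexing is unique up to a shift.
\<close>

definition fan_indexing :: "complex \<Rightarrow> (int \<Rightarrow> complex set) \<Rightarrow> bool" where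
  "fan_indexing v e \<longleftrightarrow> bij_betw e UNIV (fan v) \<and>
     (\<exists>\<alpha> \<beta> \<gamma> \<delta> :: complex. \<alpha> * \<delta> - \<beta> * \<gamma> \<noteq> 0 \<and>
        (\<lambda>z. (\<alpha> * z + \<beta>) / (\<gamma> * z + \<delta>)) ` ball 0 1 = {z. Im z > 0} \<and>
        \<gamma> * v + \<delta> = 0 \<and>
        (\<exists>x r :: real. r > 0 \<and>
           (\<forall>n. \<exists>w. w \<noteq> v \<and> e n = {v, w} \<and>
              (\<alpha> * w + \<beta>) / (\<gamma> * w + \<delta>) = of_real (x + of_int n * r))))"

definition shears_P :: "(complex set \<Rightarrow> real) set" where
  "shears_P = {s. \<forall>v\<in>farey_vertices. \<forall>e. fan_indexing v e \<longrightarrow>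
     convergent (\<lambda>n. \<Sum>k = - int n..-1. s (e k)) \<and>
     convergent (\<lambda>n. \<Sum>k = 0..int n. s (e k))}"

definition fan_from :: "complex \<Rightarrow> complex set \<Rightarrow> int \<Rightarrow> complex set" where
  "fan_from v e = (THE f. fan_indexing v f \<and> f 0 = e)"

definition p_plus :: "(complex set \<Rightarrow> real) \<Rightarrow> complex \<Rightarrow> complex set \<Rightarrow> real" where
  "p_plus s v e = lim (\<lambda>n. \<Sum>k = 1..int n. s (fan_from v e k))"

definition p_minus :: "(complex set \<Rightarrow> real) \<Rightarrow> complex \<Rightarrow> complex set \<Rightarrow> real" where
  "p_minus s v e = lim (\<lambda>n. \<Sum>k = - int n..-1. s (fan_from v e k))"

definition Psi :: "(complex set \<Rightarrow> real) \<Rightarrow> complex set \<Rightarrow> real" where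
  "Psi s e = (\<Sum>v\<in>e. p_minus s v e - p_plus s v e) / 4"

definition shears_H :: "(complex set \<Rightarrow> real) set" where
  "shears_H = {s \<in> shears_P. (\<lambda>e. (Psi s e)\<^sup>2) summable_on farey_edges}"

end

theory Submission
  imports Defs
begin

text \<open>
  A nonzero complex number \<open>w\<close>, read as a direction, represents the point \<open>pt w = w / cnj w\<close> of the
  circle. The Farey vertices are then the Gaussian integers up to real factors, and the edges
  are the pairs \<open>{pt u, pt v}\<close> of Gaussian integers with determinant 1.

  Since \<open>\<Psi>(s)\<close> is square summable, it is bounded. The shear of an edge is an alternating sum of
  \<open>\<Psi>(s)\<close> over the sides of the surrounding quadrilateral, and these sums telescope along a fan, so
  the partial sums of \<open>s\<close> over fans are uniformly bounded. Developing \<open>s\<close> along the Stern-Brocot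
  tree gives an order preserving map of the Farey vertices with shear \<open>s\<close>; in the affine
  coordinate of any fan it maps the integers to points with comparable gaps. Hence every pair
  of points whose distance in that coordinate is at least 1/3 is distorted by a bounded factor.

  Given a short symmetric arc, Dirichlet's theorem provides a Farey vertex in whose coordinate the
  midpoint, the endpoints and the antipode of the midpoint are separated by at least 1/3. The
  harmonic cross ratio of these four points is therefore distorted boundedly, which makes the
  monotone extension to the circle continuous and quasisymmetric.
\<close>

section \<open>The Farey tessellation in homogeneous coordinates\<close>

text \<open>Directions carry half the angle of the points that they represent. On them cross ratios
  become quotients of determinants and reflections become linear, and since \<open>u\<close> and
  \<open>- u\<close> give the same point, the lifted map commutes with a shift by pi. The obstacle
  is scale: shears control images of Farey vertices fan by fan, while quasisymmetry concerns every
  arc. The coordinate of the fan at \<open>u\<close> puts \<open>z\<close> and \<open>w\<close> at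
  distance \<open>\<bar>cdet z w\<bar> / (\<bar>cdet u z\<bar> * \<bar>cdet u w\<bar>)\<close>, so
  the choice of \<open>u\<close> sets the scale. For directions at angles \<open>p - t\<close>,
  \<open>p\<close>, \<open>p + t\<close>, a suitable \<open>u\<close> has a component of order at
  most \<open>sqrt (sin t)\<close> across the middle one and at most the reciprocal order along it,
  which is the form of Dirichlet's bound. The threshold 1/3 is what its constants yield, and an
  interval of that length contains a full cell of the grid of sixths, where neighbouring fans give
  lower bounds. The extension is at first only monotone, so the estimate is made away from rational
  directions; it then forces continuity, and continuity carries it to all points.\<close>

definition cdet :: "complex \<Rightarrow> complex \<Rightarrow> real" where
  "cdet z w = Re z * Im w - Im z * Re w"

lemma cdet_simps [simp]:
  "cdet z z = 0" "cdet 0 z = 0" "cdet z 0 = 0"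
  "cdet (- z) w = - cdet z w" "cdet z (- w) = - cdet z w"
  "cdet 1 \<i> = 1" "cdet \<i> 1 = -1"
  by (auto simp: cdet_def)

lemma cdet_add_left: "cdet (z + z') w = cdet z w + cdet z' w"
  and cdet_add_right: "cdet w (z + z') = cdet w z + cdet w z'"
  and cdet_diff_left: "cdet (z - z') w = cdet z w - cdet z' w"
  and cdet_diff_right: "cdet w (z - z') = cdet w z - cdet w z'"
  by (auto simp: cdet_def algebra_simps)

lemma cdet_scale [simp]:
  "cdet (of_real r * z) w = r * cdet z w" "cdet z (of_real r * w) = r * cdet z w"
  "cdet (of_int n * z) w = of_int n * cdet z w" "cdet z (of_int n * w) = of_int n * cdet z w"
  by (auto simp: cdet_def algebra_simps)

lemma cdet_commute: "cdet w z = - cdet z w"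
  by (simp add: cdet_def)

lemmas cdet_linear = cdet_add_left cdet_add_right cdet_diff_left cdet_diff_right

lemma cdet_cis: "cdet (cis a) (cis b) = sin (b - a)"
  by (simp add: cdet_def sin_diff)

lemma cdet_cnj: "cnj z * w - z * cnj w = 2 * \<i> * of_real (cdet z w)"
  by (simp add: cdet_def complex_eq_iff)

text \<open>Cramer's rule.\<close>

lemma cdet_decompose:
  assumes "cdet u v = 1"
  shows "w = of_real (cdet w v) * u + of_real (cdet u w) * v"
proof -
  have "Re w = cdet w v * Re u + cdet u w * Re v" "Im w = cdet w v * Im u + cdet u w * Im v"
    using assms unfolding cdet_def by algebra+
  then show ?thesis by (simp add: complex_eq_iff)
qed

lemma cdet_eq_0_parallel:
  assumes "cdet z w = 0" "z \<noteq> 0"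
  obtains r where "w = of_real r * z"
proof -
  define r where "r = (Re w * Re z + Im w * Im z) / ((Re z)\<^sup>2 + (Im z)\<^sup>2)"
  have n: "(Re z)\<^sup>2 + (Im z)\<^sup>2 \<noteq> 0" using assms(2) by (auto simp: complex_eq_iff)
  have e: "Re z * Im w = Im z * Re w" using assms(1) by (simp add: cdet_def)
  have "Re w * ((Re z)\<^sup>2 + (Im z)\<^sup>2) = (Re w * Re z + Im w * Im z) * Re z"
    "Im w * ((Re z)\<^sup>2 + (Im z)\<^sup>2) = (Re w * Re z + Im w * Im z) * Im z"
    using e by algebra+
  then have "w = of_real r * z"
    using n by (simp add: complex_eq_iff r_def field_simps)
  then show ?thesis by (rule that)
qed

section \<open>Circle points and reflections in terms of directions\<close>

definition pt :: "complex \<Rightarrow> complex" where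
  "pt w = w / cnj w"

lemma pt_minus [simp]: "pt (- w) = pt w"
  by (simp add: pt_def)

lemma pt_scale: "r \<noteq> 0 \<Longrightarrow> pt (of_real r * w) = pt w"
  by (simp add: pt_def)

lemma pt_diff_commute: "pt (a - b) = pt (b - a)"
  by (metis minus_diff_eq pt_minus)

lemma pt_basic [simp]: "pt 1 = 1" "pt \<i> = -1" "pt (1 + \<i>) = \<i>" "pt (\<i> + 1) = \<i>"
  by (auto simp: pt_def complex_eq_iff Re_divide Im_divide)

lemma norm_pt: "w \<noteq> 0 \<Longrightarrow> norm (pt w) = 1"
  by (simp add: pt_def norm_divide)

lemma pt_cis: "pt (cis t) = cis (2 * t)"
  by (simp add: pt_def cis_cnj cis_divide)

text \<open>In a cross ratio each conjugate factor occurs once above and once below, so only the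
  determinants survive. This lets all later estimates be made with determinants of
  directions.\<close>

lemma pt_diff:
  assumes "z \<noteq> 0" "w \<noteq> 0"
  shows "pt w - pt z = 2 * \<i> * of_real (cdet z w) / (cnj z * cnj w)"
  using assms unfolding cdet_cnj[symmetric] pt_def by (simp add: field_simps)

lemma pt_eq_iff:
  assumes "z \<noteq> 0" "w \<noteq> 0"
  shows "pt z = pt w \<longleftrightarrow> cdet z w = 0"
proof -
  have "pt z = pt w \<longleftrightarrow> pt w - pt z = 0" by auto
  then show ?thesis using assms by (subst (asm) pt_diff) auto
qed

text \<open>Clearing the denominators \<open>cnj u\<close>, \<open>cnj v\<close> and
  \<open>w\<close> exposes a common factor \<open>k\<close> and leaves a direction over its
  conjugate. A reflection thus becomes the linear involution with eigenvectors \<open>u\<close> and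
  \<open>v\<close>, and its effect on triangles is integer arithmetic.\<close>

lemma hyp_refl_pt:
  assumes "cdet u v \<noteq> 0" and w: "w = of_real \<alpha> * u + of_real \<beta> * v" "w \<noteq> 0"
  shows "hyp_refl (pt u) (pt v) (pt w) = pt (of_real \<alpha> * u - of_real \<beta> * v)"
proof -
  define k where "k = cnj u * v - u * cnj v"
  have k: "k \<noteq> 0" using assms(1) unfolding k_def cdet_cnj by simp
  have nz: "u \<noteq> 0" "v \<noteq> 0" using assms(1) by auto
  define n where "n = u * cnj v + v * cnj u"
  have uvw: "cnj u \<noteq> 0" "cnj v \<noteq> 0" "w \<noteq> 0" "cnj w \<noteq> 0"
    using nz w(2) by (auto simp only: complex_cnj_zero_iff)
  have "hyp_refl (pt u) (pt v) (pt w)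
      = ((2 * pt u * pt v * cnj (pt w) - (pt u + pt v)) * (cnj u * cnj v * w)) /
        (((pt u + pt v) * cnj (pt w) - 2) * (cnj u * cnj v * w))"
    using uvw unfolding hyp_refl_def by simp
  also have "(2 * pt u * pt v * cnj (pt w) - (pt u + pt v)) * (cnj u * cnj v * w)
      = 2 * u * v * cnj w - n * w"
    using uvw by (simp add: pt_def n_def field_simps)
  also have "\<dots> = (of_real \<alpha> * u - of_real \<beta> * v) * k"
    by (simp add: w(1) n_def k_def algebra_simps)
  also have "((pt u + pt v) * cnj (pt w) - 2) * (cnj u * cnj v * w)
      = n * cnj w - 2 * cnj u * cnj v * w"
    using uvw by (simp add: pt_def n_def field_simps)
  also have "\<dots> = cnj (of_real \<alpha> * u - of_real \<beta> * v) * k"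
    by (simp add: w(1) n_def k_def algebra_simps)
  finally show ?thesis using k by (simp add: pt_def)
qed

section \<open>Bases of the Gaussian integers\<close>

definition gauss :: "complex set" where
  "gauss = {z. Re z \<in> \<int> \<and> Im z \<in> \<int>}"

lemma gauss_closed [simp, intro]:
  "0 \<in> gauss" "1 \<in> gauss" "\<i> \<in> gauss" "of_int n \<in> gauss" "of_nat m \<in> gauss"
  "a \<in> gauss \<Longrightarrow> - a \<in> gauss"
  "\<lbrakk>a \<in> gauss; b \<in> gauss\<rbrakk> \<Longrightarrow> a + b \<in> gauss" "\<lbrakk>a \<in> gauss; b \<in> gauss\<rbrakk> \<Longrightarrow> a - b \<in> gauss"
  "\<lbrakk>a \<in> gauss; b \<in> gauss\<rbrakk> \<Longrightarrow> a * b \<in> gauss"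
  by (simp_all add: gauss_def Ints_add Ints_diff Ints_mult)

lemma cdet_Ints: "a \<in> gauss \<Longrightarrow> b \<in> gauss \<Longrightarrow> cdet a b \<in> \<int>"
  by (simp add: gauss_def cdet_def Ints_diff Ints_mult)

text \<open>Positively oriented bases of the lattice of Gaussian integers, that is, the matrices of
  SL(2, Z).\<close>

definition unimodular :: "complex \<Rightarrow> complex \<Rightarrow> bool" where
  "unimodular a b \<longleftrightarrow> a \<in> gauss \<and> b \<in> gauss \<and> cdet a b = 1"

lemma unimodularD:
  assumes "unimodular a b"
  shows "a \<in> gauss" "b \<in> gauss" "cdet a b = 1" "cdet b a = -1" "a \<noteq> 0" "b \<noteq> 0"
proof -
  show 1: "a \<in> gauss" "b \<in> gauss" "cdet a b = 1" using assms by (auto simp: unimodular_def)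
  show "cdet b a = -1" using 1(3) by (simp add: cdet_commute[of b a])
  show "a \<noteq> 0" "b \<noteq> 0" using 1(3) by fastforce+
qed

lemma gauss_cancel [simp]:
  "- a \<in> gauss \<longleftrightarrow> a \<in> gauss"
  "a \<in> gauss \<Longrightarrow> a + b \<in> gauss \<longleftrightarrow> b \<in> gauss" "a \<in> gauss \<Longrightarrow> b + a \<in> gauss \<longleftrightarrow> b \<in> gauss"
  "a \<in> gauss \<Longrightarrow> b - a \<in> gauss \<longleftrightarrow> b \<in> gauss"
  by (simp_all add: gauss_def)

lemma cdet_shear:
  "cdet a (b + a) = cdet a b" "cdet a (a + b) = cdet a b" "cdet a (b - a) = cdet a b"
  "cdet (a + b) b = cdet a b" "cdet (b + a) b = cdet a b"
  "cdet b (- a) = cdet a b" "cdet (- b) a = cdet a b"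
  by (simp_all add: cdet_def algebra_simps)

lemma unimodular_simps [simp]:
  "unimodular a (b + a) \<longleftrightarrow> unimodular a b" "unimodular a (a + b) \<longleftrightarrow> unimodular a b"
  "unimodular a (b - a) \<longleftrightarrow> unimodular a b"
  "unimodular (a + b) b \<longleftrightarrow> unimodular a b"  "unimodular (b + a) b \<longleftrightarrow> unimodular a b"
  "unimodular b (- a) \<longleftrightarrow> unimodular a b"
  "unimodular (- b) a \<longleftrightarrow> unimodular a b"
  unfolding unimodular_def cdet_shear by auto

lemma unimodular_fan [simp]:
  "unimodular a b \<Longrightarrow> unimodular a (b + of_int n * a)"
  "unimodular a b \<Longrightarrow> unimodular a (b - of_int n * a)"
  by (simp_all add: unimodular_def cdet_linear)

lemma pt_neq: "unimodular a b \<Longrightarrow> pt a \<noteq> pt b"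
  by (simp add: pt_eq_iff unimodularD)

lemma unimodular_1_i [simp]: "unimodular 1 \<i>"
  by (simp add: unimodular_def)

lemma unimodular_i_1 [simp]: "unimodular \<i> (-1)"
  by (simp add: unimodular_def)

text \<open>Natural coordinates with respect to the bases \<open>1, \<i>\<close> and
  \<open>\<i>, -1\<close>; the second is the first rotated by a quarter turn. These are the cones in
  which the Stern-Brocot recursion runs.\<close>

definition quad1 :: "nat \<Rightarrow> nat \<Rightarrow> complex" where "quad1 x y = of_nat x + of_nat y * \<i>"
definition quad2 :: "nat \<Rightarrow> nat \<Rightarrow> complex" where "quad2 x y = of_nat x * \<i> - of_nat y"

lemma gauss_nat:
  assumes "a \<in> gauss"
  obtains x y where "Re a = of_int x" "Im a = of_int y"
  using assms by (auto simp: gauss_def elim!: Ints_cases)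

text \<open>
  Up to the rotation \<open>(a, b) \<mapsto> (b, - a)\<close> of a basis, both of its members lie in the same
  closed quadrant.
\<close>

lemma unimodular_quadrants [consumes 1, case_names rot quad1 quad2]:
  assumes "unimodular a b"
    and rot: "\<And>a b. unimodular a b \<Longrightarrow> P a b \<Longrightarrow> P b (- a)"
    and q1: "\<And>p q r t. p * t = q * r + 1 \<Longrightarrow> P (quad1 p q) (quad1 r t)"
    and q2: "\<And>p q r t. p * t = q * r + 1 \<Longrightarrow> P (quad2 p q) (quad2 r t)"
  shows "P a b"
proof -
  have rot1: "P a b" if "unimodular a b" "P (- b) a" for a b
    using rot[of "- b" a] that by simp
  have rot2: "P a b" if "unimodular a b" "P (- a) (- b)" for a b
    using rot1[of a b] rot1[of "- b" a] that by simp
  have rot3: "P a b" if "unimodular a b" "P b (- a)" for a b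
    using rot2[of a b] rot1[of "- a" "- b"] that by simp
  \<comment> \<open>Sign changes are absorbed by \<open>rot1\<close> and \<open>rot2\<close>, so the
    core case has both members in the upper half plane.\<close>
  have up: "P a b" if ab: "unimodular a b"
    "Im a > 0 \<or> Im a = 0 \<and> Re a > 0" "Im b > 0 \<or> Im b = 0 \<and> Re b > 0" for a b
  proof -
    obtain p q where a: "Re a = of_int p" "Im a = of_int q"
      using unimodularD[OF ab(1)] gauss_nat by blast
    obtain r t where b: "Re b = of_int r" "Im b = of_int t"
      using unimodularD[OF ab(1)] gauss_nat by blast
    have "real_of_int (p * t - q * r) = 1"
      using unimodularD(3)[OF ab(1)] a b by (simp add: cdet_def)
    then have d: "p * t - q * r = 1" by linarith
    have pos: "q > 0 \<or> q = 0 \<and> p > 0" "t > 0 \<or> t = 0 \<and> r > 0"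
      using ab(2,3) a b by auto
    have Q1: "P a b" if "p \<ge> 0" "r \<ge> 0"
    proof -
      have "int (nat p * nat t) = int (nat q * nat r + 1)" using d pos that by auto
      then have "nat p * nat t = nat q * nat r + 1" by linarith
      moreover have "a = quad1 (nat p) (nat q)" "b = quad1 (nat r) (nat t)"
        using that pos a b by (auto simp: quad1_def complex_eq_iff)
      ultimately show ?thesis using q1 by blast
    qed
    have Q2: "P a b" if a: "Re a = of_int p" "Im a = of_int q" and b: "Re b = of_int r" "Im b = of_int t"
      and d: "p * t - q * r = 1" and pos: "p \<le> 0" "r \<le> 0" "q \<ge> 0" "t \<ge> 0" for a b p q r t
    proof -
      have "int (nat q * nat (- r)) = int (nat (-p) * nat t + 1)" using d pos by (simp add: algebra_simps)
      then have "nat q * nat (- r) = nat (-p) * nat t + 1" by linarith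
      moreover have "a = quad2 (nat q) (nat (-p))" "b = quad2 (nat t) (nat (- r))"
        using that pos a b by (auto simp: quad2_def complex_eq_iff)
      ultimately show ?thesis using q2[of "nat q" "nat (- r)" "nat (- p)" "nat t"]
        by (simp add: mult.commute)
    qed
    consider "p \<ge> 0" "r \<ge> 0" | "p < 0" "r \<le> 0" | "p < 0" "r > 0" | "p \<ge> 0" "r < 0" by linarith
    then show ?thesis
    proof cases
      case 1 then show ?thesis by (rule Q1)
    next
      case 2 then show ?thesis using Q2[OF a b d] pos by auto
    next
      case 3
      then have "p * t \<le> 0" "q * r \<ge> 0" using pos by (auto simp: mult_nonpos_nonneg)
      then show ?thesis using d by linarith
    next
      case 4
      then have t: "t > 0" using pos by auto
      have q: "q \<ge> 0" using pos by auto
      \<comment> \<open>The nonnegative integers \<open>p * t\<close> and \<open>- (q * r)\<close>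
        add up to 1, so one of them vanishes and \<open>a\<close> lies on an axis. Then either
        \<open>- a\<close> or \<open>a\<close> itself shares the closed second quadrant with
        \<open>b\<close>.\<close>
      have pt: "p * t \<ge> 0" "q * r \<le> 0" using 4 t q by (auto simp: mult_nonneg_nonpos)
      show ?thesis
      proof (cases "q = 0")
        case True
        have "P b (- a)"
          by (rule Q2[of b r t "- a" "- p" 0]) (use a b d True 4 t in \<open>auto simp: mult.commute\<close>)
        then show ?thesis using rot3 ab(1) by blast
      next
        case False
        then have "q * r \<le> -1" using q 4 by (smt (verit) mult_less_0_iff)
        then have "p * t = 0" using d pt by linarith
        then have "p = 0" using t by simp
        then show ?thesis using Q2[OF a b d] 4 q t by auto
      qed
    qed
  qed
  have up': "P a b" if ab: "unimodular a b" "Im a > 0 \<or> Im a = 0 \<and> Re a > 0" for a b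
  proof (cases "Im b > 0 \<or> Im b = 0 \<and> Re b > 0")
    case True then show ?thesis using up ab by blast
  next
    case False
    then have "Im (- b) > 0 \<or> Im (- b) = 0 \<and> Re (- b) > 0"
      using unimodularD(6)[OF ab(1)] by (auto simp: complex_eq_iff)
    then have "P (- b) a" using up[of "- b" a] ab by simp
    then show ?thesis using rot1 ab by blast
  qed
  show ?thesis
  proof (cases "Im a > 0 \<or> Im a = 0 \<and> Re a > 0")
    case True then show ?thesis using up' assms(1) by blast
  next
    case False
    then have "Im (- a) > 0 \<or> Im (- a) = 0 \<and> Re (- a) > 0"
      using unimodularD(5)[OF assms(1)] by (auto simp: complex_eq_iff)
    moreover have "unimodular (- a) (- b)" using assms(1) by simp
    ultimately have "P (- a) (- b)" using up' by blast
    then show ?thesis using rot2 assms(1) by blast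
  qed
qed

section \<open>Triangles, edges and fans as integer bases\<close>

definition tri :: "complex \<Rightarrow> complex \<Rightarrow> complex set" where
  "tri u v = {pt u, pt v, pt (u + v)}"

lemma hyp_refl_fix:
  assumes "cdet u v \<noteq> 0"
  shows "hyp_refl (pt u) (pt v) (pt u) = pt u" "hyp_refl (pt u) (pt v) (pt v) = pt v"
proof -
  have "u \<noteq> 0" "v \<noteq> 0" using assms by (auto simp: cdet_def)
  then show "hyp_refl (pt u) (pt v) (pt u) = pt u" "hyp_refl (pt u) (pt v) (pt v) = pt v"
    using hyp_refl_pt[of u v u 1 0] hyp_refl_pt[of u v v 0 1] assms by simp_all
qed

text \<open>In the basis formed by two vertices of a triangle, the third is up to sign the sum or
  the difference of the basis vectors. A reflection exchanges sum and difference, which produces the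
  three neighbours.\<close>

lemma hyp_refl_tri:
  assumes "unimodular u v"
  shows "hyp_refl (pt u) (pt (u + v)) ` tri u v = tri u (u + v)"
    and "hyp_refl (pt (u + v)) (pt v) ` tri u v = tri (u + v) v"
    and "hyp_refl (pt u) (pt v) ` tri u v = tri v (- u)"
proof -
  note uv = unimodularD[OF assms]
  have un: "unimodular u (u + v)" "unimodular (u + v) v" using assms by auto
  have d: "cdet u v \<noteq> 0" "cdet u (u + v) \<noteq> 0" "cdet (u + v) v \<noteq> 0"
    using uv by (auto simp: cdet_linear)
  show "hyp_refl (pt u) (pt (u + v)) ` tri u v = tri u (u + v)"
    using hyp_refl_fix[OF d(2)] hyp_refl_pt[of u "u + v" v "-1" 1] uv d(2) pt_minus[of "u + (u + v)"]
    by (simp add: tri_def insert_commute)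
  show "hyp_refl (pt (u + v)) (pt v) ` tri u v = tri (u + v) v"
    using hyp_refl_fix[OF d(3)] hyp_refl_pt[of "u + v" v u 1 "-1"] uv d(3)
    by (simp add: tri_def insert_commute)
  show "hyp_refl (pt u) (pt v) ` tri u v = tri v (- u)"
    using hyp_refl_fix[OF d(1)] hyp_refl_pt[of u v "u + v" 1 1] uv unimodularD[OF un(2)]
    by (simp add: tri_def insert_commute pt_diff_commute)
qed

lemma tri_reflect:
  assumes "unimodular u v" "tri u v \<in> farey_triangles"
  shows "tri u (u + v) \<in> farey_triangles" "tri (u + v) v \<in> farey_triangles"
    "tri v (- u) \<in> farey_triangles"
proof -
  have "unimodular u (u + v)" "unimodular (u + v) v" using assms(1) by auto
  note ne = this[THEN pt_neq] pt_neq[OF assms(1)]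
  have "pt u \<in> tri u v" "pt v \<in> tri u v" "pt (u + v) \<in> tri u v" by (simp_all add: tri_def)
  then show "tri u (u + v) \<in> farey_triangles" "tri (u + v) v \<in> farey_triangles"
    "tri v (- u) \<in> farey_triangles"
    unfolding hyp_refl_tri[OF assms(1), symmetric]
    using farey_triangles.reflect[OF assms(2)] ne by simp_all
qed

text \<open>One step of Euclid's algorithm: in a nonnegative matrix of determinant 1 other than the
  identity, one column dominates the other. A strictly larger diagonal gives
  \<open>(q + 1) * (r + 1) \<le> p * t\<close>, hence the identity, and a strictly larger
  antidiagonal gives \<open>p * t \<le> q * r\<close>.\<close>

lemma nat_unimodular_cases:
  fixes p q r t :: nat
  assumes "p * t = q * r + 1"
  obtains "p = 1" "q = 0" "r = 0" "t = 1" | "q \<le> p" "t \<le> r" "q + t > 0" | "p \<le> q" "r \<le> t" "p + r > 0"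
proof -
  have pt: "p > 0" "t > 0" using assms by (auto intro!: Nat.gr0I)
  consider "q \<le> p" "t \<le> r" | "p \<le> q" "r \<le> t" | "q < p" "r < t" | "p < q" "t < r" by linarith
  then show ?thesis
  proof cases
    case 3
    then have "(q + 1) * (r + 1) \<le> p * t" by (intro mult_mono) auto
    then have "q = 0" "r = 0" using assms by (auto simp: algebra_simps)
    then show ?thesis using that(1) assms by auto
  next
    case 4
    then have "p * t \<le> q * r" by (intro mult_mono) auto
    then show ?thesis using assms by linarith
  qed (use that pt in auto)
qed

text \<open>Column domination means that both directions lie in the cone of \<open>u\<close> and
  \<open>u + v\<close> or in that of \<open>u + v\<close> and \<open>v\<close>, as in
  \<open>p * u + q * v = (p - q) * u + q * (u + v)\<close>. Passing to that cone is one reflection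
  and shrinks the coefficients.\<close>

lemma tri_cone:
  assumes "unimodular u v" "tri u v \<in> farey_triangles" "p * t = q * r + 1"
  shows "tri (of_nat p * u + of_nat q * v) (of_nat r * u + of_nat t * v) \<in> farey_triangles"
  using assms
proof (induction "p + q + r + t" arbitrary: p q r t u v rule: less_induct)
  case less
  from less.prems(3) show ?case
  proof (cases rule: nat_unimodular_cases)
    case 1 then show ?thesis using less.prems by simp
  next
    case 2
    have d: "(p - q) * t = q * (r - t) + 1" using less.prems(3) 2
      by (simp add: diff_mult_distrib diff_mult_distrib2 Suc_diff_le)
    have "(p - q) + q + (r - t) + t < p + q + r + t" using 2 by linarith
    from less.hyps[OF this _ tri_reflect(1)[OF less.prems(1,2)] d]
    show ?thesis using 2 less.prems(1) by (simp add: algebra_simps of_nat_diff)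
  next
    case 3
    have d: "p * (t - r) = (q - p) * r + 1" using less.prems(3) 3
      by (simp add: diff_mult_distrib diff_mult_distrib2 Suc_diff_le)
    have "p + (q - p) + r + (t - r) < p + q + r + t" using 3 by linarith
    from less.hyps[OF this _ tri_reflect(2)[OF less.prems(1,2)] d]
    show ?thesis using 3 less.prems(1) by (simp add: algebra_simps of_nat_diff)
  qed
qed

lemma tri_base: "tri 1 \<i> = {1, \<i>, -1}" by (auto simp: tri_def)

lemma tri_in_farey: "unimodular a b \<Longrightarrow> tri a b \<in> farey_triangles"
proof (induction rule: unimodular_quadrants)
  case (rot a b) then show ?case by (rule tri_reflect(3))
next
  case (quad1 p q r t)
  have "tri 1 \<i> \<in> farey_triangles" by (simp add: tri_base farey_triangles.base)
  from tri_cone[OF unimodular_1_i this quad1] show ?case by (simp add: quad1_def)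
next
  case (quad2 p q r t)
  have "tri \<i> (-1) \<in> farey_triangles"
    by (rule tri_reflect(3)) (simp_all add: tri_base farey_triangles.base)
  from tri_cone[OF unimodular_i_1 this quad2] show ?case by (simp add: quad2_def)
qed

lemma farey_triangles_eq: "farey_triangles = {tri u v | u v. unimodular u v}"
proof (intro equalityI subsetI)
  fix t assume "t \<in> farey_triangles"
  then show "t \<in> {tri u v | u v. unimodular u v}"
  proof induction
    case base then show ?case using tri_base unimodular_1_i by blast
  next
    case (reflect t a b)
    then obtain u v where uv: "t = tri u v" "unimodular u v" by blast
    have sym: "hyp_refl a b = hyp_refl b a" for a b
      by (simp add: hyp_refl_def fun_eq_iff algebra_simps)
    have un: "unimodular u (u + v)" "unimodular (u + v) v" using uv(2) by auto
    have "a = pt u \<and> b = pt v \<or> b = pt u \<and> a = pt v \<or> a = pt u \<and> b = pt (u + v) \<or>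
        b = pt u \<and> a = pt (u + v) \<or> a = pt (u + v) \<and> b = pt v \<or> b = pt (u + v) \<and> a = pt v"
      using reflect.hyps uv(1) by (simp add: tri_def) blast
    then have "hyp_refl a b ` tri u v \<in> {tri u (u + v), tri (u + v) v, tri v (- u)}"
      using hyp_refl_tri[OF uv(2)] sym[of a b] by (elim disjE conjE) simp_all
    moreover have "unimodular v (- u)" using uv(2) by simp
    ultimately show ?case using un unfolding uv(1) by blast
  qed
qed (auto simp: tri_in_farey)

lemma farey_edges_eq: "farey_edges = {{pt u, pt v} | u v. unimodular u v}"
proof (intro equalityI subsetI)
  fix e assume "e \<in> farey_edges"
  then obtain u v a b where "unimodular u v" "a \<in> tri u v" "b \<in> tri u v" "a \<noteq> b" "e = {a, b}"
    unfolding farey_edges_def farey_triangles_eq by blast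
  moreover have "unimodular u (u + v)" "unimodular (u + v) v" using \<open>unimodular u v\<close> by auto
  moreover from calculation have
    "{a, b} = {pt u, pt v} \<or> {a, b} = {pt u, pt (u + v)} \<or> {a, b} = {pt (u + v), pt v}"
    by (simp add: tri_def) blast
  ultimately show "e \<in> {{pt u, pt v} | u v. unimodular u v}" by blast
next
  fix e assume "e \<in> {{pt u, pt v} | u v. unimodular u v}"
  then obtain u v where "unimodular u v" "e = {pt u, pt v}" by blast
  then show "e \<in> farey_edges"
    using tri_in_farey[of u v] pt_neq[of u v] unfolding farey_edges_def tri_def by blast
qed

lemma pt_in_vertices: "unimodular u v \<Longrightarrow> pt u \<in> farey_vertices"
  using tri_in_farey[of u v] by (auto simp: farey_vertices_def tri_def)

text \<open>Members of bases are primitive: two parallel ones are integer multiples of each other,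
  and the product of the two factors is 1.\<close>

lemma pt_eq_unimodular:
  assumes "unimodular u v" "unimodular a b" "pt u = pt a"
  shows "a = u \<or> a = - u"
proof -
  note uv = unimodularD[OF assms(1)] and ab = unimodularD[OF assms(2)]
  have 0: "cdet u a = 0" "cdet a u = 0"
    using assms(3) pt_eq_iff[of u a] pt_eq_iff[of a u] uv ab by auto
  have 1: "a = of_real (cdet a v) * u" "u = of_real (cdet u b) * a"
    using cdet_decompose[OF uv(3), of a] cdet_decompose[OF ab(3), of u] 0 by auto
  obtain m n :: int where mn: "cdet a v = m" "cdet u b = n"
    using cdet_Ints uv ab by (metis Ints_cases)
  have "u = of_real (cdet u b) * (of_real (cdet a v) * u)" using 1 by metis
  then have "of_int (n * m) = (1::complex)" using uv mn by auto
  then have "n * m = 1" using of_int_eq_1_iff by blast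
  then have "m = 1 \<or> m = -1" by (auto simp: zmult_eq_1_iff)
  then show ?thesis using 1(1) mn by auto
qed

lemma unimodular_fan_ex:
  assumes "unimodular u v" "unimodular u w"
  obtains k :: int where "w = v - of_int k * u"
proof -
  note uv = unimodularD[OF assms(1)] and uw = unimodularD[OF assms(2)]
  obtain m :: int where m: "cdet w v = m" using cdet_Ints uv uw by (metis Ints_cases)
  show ?thesis using that[of "- m"] cdet_decompose[OF uv(3), of w] uw m by simp
qed

lemma farey_edge_fan:
  assumes "unimodular u v" "{pt u, z} \<in> farey_edges"
  obtains k :: int where "z = pt (v - of_int k * u)"
proof -
  have *: "\<exists>k::int. z = pt (v - of_int k * u)" if ab: "unimodular a b" "pt u = pt a" "z = pt b" for a b
  proof -
    have "a = u \<or> a = - u" using pt_eq_unimodular[OF assms(1) ab(1,2)] .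
    then obtain w where w: "unimodular u w" "pt b = pt w"
    proof
      assume "a = - u"
      then have "unimodular u (- b)" using ab(1) unimodular_simps(7)[of b "- u"] unimodular_simps(6)[of u "- b"] by simp
      then show thesis using that[of "- b"] by simp
    next
      assume "a = u"
      then show thesis using that[of b] ab by simp
    qed
    from unimodular_fan_ex[OF assms(1) w(1)] obtain k :: int where "w = v - of_int k * u" .
    then show ?thesis using w(2) ab(3) by auto
  qed
  obtain a b where ab: "unimodular a b" "{pt u, z} = {pt a, pt b}"
    using assms(2) unfolding farey_edges_eq mem_Collect_eq by metis
  then have "pt u = pt a \<and> z = pt b \<or> pt u = pt b \<and> z = pt (- a)"
    by (simp add: doubleton_eq_iff)
  moreover have "unimodular b (- a)" using ab by simp
  ultimately have "\<exists>k::int. z = pt (v - of_int k * u)" using *[of a b] *[of b "- a"] ab(1) by auto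
  then show ?thesis using that by auto
qed

lemma fan_eq:
  assumes "unimodular u v"
  shows "fan (pt u) = range (\<lambda>k::int. {pt u, pt (v - of_int k * u)})"
proof (intro equalityI subsetI)
  fix e assume e: "e \<in> fan (pt u)"
  then have "e \<in> farey_edges" "pt u \<in> e" by (auto simp: fan_def)
  then obtain a b where "e = {pt a, pt b}" unfolding farey_edges_eq mem_Collect_eq by metis
  then have "e = {pt u, pt a} \<or> e = {pt u, pt b}" using \<open>pt u \<in> e\<close> by (auto simp: insert_commute)
  then obtain z where z: "e = {pt u, z}" by metis
  with \<open>e \<in> farey_edges\<close> have "{pt u, z} \<in> farey_edges" by simp
  from farey_edge_fan[OF assms this] obtain k :: int where "z = pt (v - of_int k * u)" .
  then show "e \<in> range (\<lambda>k::int. {pt u, pt (v - of_int k * u)})" unfolding z by (rule range_eqI[OF arg_cong])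
next
  fix e assume "e \<in> range (\<lambda>k::int. {pt u, pt (v - of_int k * u)})"
  then obtain k :: int where "e = {pt u, pt (v - of_int k * u)}" by (rule rangeE)
  then show "e \<in> fan (pt u)" unfolding fan_def farey_edges_eq using unimodular_fan(2)[OF assms, of k] by blast
qed

section \<open>Indexings of fans\<close>

lemma upper_half_plane_affine:
  fixes c d :: complex
  assumes "c \<noteq> 0"
    and into: "\<And>y. Im y > 0 \<Longrightarrow> Im (c * y + d) > 0"
    and onto: "\<And>y. Im y > 0 \<Longrightarrow> \<exists>x. Im x > 0 \<and> y = c * x + d"
  shows "Im c = 0" "Re c > 0" "Im d = 0"
proof -
  have 1: "x * Im c + y * Re c + Im d > 0" if "y > 0" for x y
    using into[of "Complex x y"] that by (simp add: algebra_simps)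
  show Imc: "Im c = 0"
  proof (rule ccontr)
    assume "Im c \<noteq> 0"
    then show False using 1[of 1 "- (Re c + Im d) / Im c"] by simp
  qed
  have Rec: "Re c \<noteq> 0" using assms(1) Imc by (auto simp: complex_eq_iff)
  show "Re c > 0"
  proof (rule ccontr)
    assume "\<not> Re c > 0"
    then have neg: "Re c < 0" using Rec by simp
    define y where "y = (\<bar>Im d\<bar> + 1) / (- Re c)"
    have "y > 0" unfolding y_def using neg by (intro divide_pos_pos) auto
    moreover have "y * Re c = - (\<bar>Im d\<bar> + 1)" using neg by (simp add: y_def field_simps)
    ultimately show False using 1[of y 0] by simp
  qed
  then have pos: "Re c > 0" .
  have "Im d < e" if "e > 0" for e
  proof -
    obtain x where "Im x > 0" "\<i> * of_real e = c * x + d" using onto[of "\<i> * of_real e"] \<open>e > 0\<close> by auto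
    then have "e = Im (c * x + d)" by (metis Im_i_times Re_complex_of_real)
    then have "e = Re c * Im x + Im d" using Imc by simp
    then show ?thesis using pos \<open>Im x > 0\<close> by simp
  qed
  then have "Im d \<le> 0" by (meson not_le less_irrefl)
  moreover have "Im d \<ge> 0"
  proof (rule ccontr)
    assume "\<not> Im d \<ge> 0"
    then show False using 1[of "- Im d / (2 * Re c)" 0] pos by (simp add: field_simps)
  qed
  ultimately show "Im d = 0" by simp
qed

lemma int_progressions_eq:
  fixes r r' x :: real
  assumes "r > 0" "r' > 0" and "range (\<lambda>n::int. x + of_int n * r) = range (\<lambda>n::int. x + of_int n * r')"
  shows "r = r'"
proof -
  have "x + of_int 1 * r \<in> range (\<lambda>n::int. x + of_int n * r')" using assms(3) by blast
  then obtain k :: int where k: "r = k * r'" by (metis (no_types, lifting) add_left_cancel mult_1 of_int_1 rangeE)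
  have "x + of_int 1 * r' \<in> range (\<lambda>n::int. x + of_int n * r)" using assms(3) by blast
  then obtain m :: int where m: "r' = m * r" by (metis (no_types, lifting) add_left_cancel mult_1 of_int_1 rangeE)
  have "of_int (k * m) * r = 1 * r" using k m by (metis mult.assoc mult_1 of_int_mult)
  then have "real_of_int (k * m) = 1" using assms(1) by (metis mult_cancel_right less_irrefl)
  then have "k * m = 1" by linarith
  moreover have "k > 0" using k assms by (metis of_int_0_less_iff zero_less_mult_pos2)
  ultimately have "k = 1" by (auto simp: zmult_eq_1_iff)
  then show ?thesis using k by simp
qed

text \<open>This makes the description in \<open>fan_from\<close> meaningful. With the pole at
  \<open>v\<close> split off, the two coordinates differ by an increasing real affine map; both
  progressions then enumerate the same set upwards from the same point, so their steps
  agree.\<close>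

lemma fan_indexing_unique:
  assumes v: "norm v = 1" and f: "fan_indexing v f" and g: "fan_indexing v g" and fg: "f 0 = g 0"
  shows "f = g"
proof -
  have normal_form: "\<exists>A B x r. B \<noteq> 0 \<and> (\<lambda>z. A + B / (z - v)) ` ball 0 1 = {z. Im z > 0} \<and> r > 0 \<and>
      (\<forall>n::int. \<exists>w. w \<noteq> v \<and> f n = {v, w} \<and> A + B / (w - v) = of_real (x + of_int n * r))"
    if ind: "fan_indexing v f" for f
  proof -
    obtain \<alpha> \<beta> \<gamma> \<delta> :: complex and x r where m: "\<alpha> * \<delta> - \<beta> * \<gamma> \<noteq> 0"
      "(\<lambda>z. (\<alpha> * z + \<beta>) / (\<gamma> * z + \<delta>)) ` ball 0 1 = {z. Im z > 0}" "\<gamma> * v + \<delta> = 0" "r > 0"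
      "\<And>n. \<exists>w. w \<noteq> v \<and> f n = {v, w} \<and> (\<alpha> * w + \<beta>) / (\<gamma> * w + \<delta>) = of_real (x + of_int n * r)"
      using ind unfolding fan_indexing_def by blast
    have \<delta>: "\<delta> = - \<gamma> * v" using m(3) by (simp add: eq_neg_iff_add_eq_0 add.commute)
    have \<gamma>: "\<gamma> \<noteq> 0" using m(1) \<delta> by auto
    have "\<alpha> * \<delta> - \<beta> * \<gamma> = - \<gamma> * (\<alpha> * v + \<beta>)" by (simp add: \<delta> algebra_simps)
    then have B: "(\<alpha> * v + \<beta>) / \<gamma> \<noteq> 0" using m(1) \<gamma> by auto
    have eq: "(\<alpha> * z + \<beta>) / (\<gamma> * z + \<delta>) = \<alpha> / \<gamma> + (\<alpha> * v + \<beta>) / \<gamma> / (z - v)" if "z \<noteq> v" for z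
    proof -
      have "\<gamma> * z + \<delta> = \<gamma> * (z - v)" using \<delta> by (simp add: algebra_simps)
      moreover have "z - v \<noteq> 0" using that by simp
      moreover have "(\<alpha> * z + \<beta>) = \<alpha> * (z - v) + (\<alpha> * v + \<beta>)" by (simp add: algebra_simps)
      ultimately show ?thesis using \<gamma> by (simp add: add_divide_distrib)
    qed
    have "(\<lambda>z. \<alpha> / \<gamma> + (\<alpha> * v + \<beta>) / \<gamma> / (z - v)) ` ball 0 1 = {z. Im z > 0}"
      unfolding m(2)[symmetric] using v by (intro image_cong refl eq[symmetric]) auto
    moreover have "\<exists>w. w \<noteq> v \<and> f n = {v, w} \<and>
        \<alpha> / \<gamma> + (\<alpha> * v + \<beta>) / \<gamma> / (w - v) = of_real (x + of_int n * r)" for n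
    proof -
      obtain w where "w \<noteq> v" "f n = {v, w}" "(\<alpha> * w + \<beta>) / (\<gamma> * w + \<delta>) = of_real (x + of_int n * r)"
        using m(5)[of n] by blast
      then show ?thesis using eq[of w] by (intro exI[of _ w]) simp
    qed
    ultimately show ?thesis using B m(4) by blast
  qed
  obtain A B x r where 1: "B \<noteq> 0" "(\<lambda>z. A + B / (z - v)) ` ball 0 1 = {z. Im z > 0}" "r > 0"
    "\<forall>n::int. \<exists>w. w \<noteq> v \<and> f n = {v, w} \<and> A + B / (w - v) = of_real (x + of_int n * r)"
    using normal_form[OF f] by blast
  obtain A' B' x' r' where 2: "B' \<noteq> 0" "(\<lambda>z. A' + B' / (z - v)) ` ball 0 1 = {z. Im z > 0}" "r' > 0"
    "\<forall>n::int. \<exists>w. w \<noteq> v \<and> g n = {v, w} \<and> A' + B' / (w - v) = of_real (x' + of_int n * r')"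
    using normal_form[OF g] by blast
  obtain W where W: "W n \<noteq> v" "f n = {v, W n}" "A + B / (W n - v) = of_real (x + of_int n * r)" for n
    using 1(4) by metis
  obtain W' where W': "W' n \<noteq> v" "g n = {v, W' n}" "A' + B' / (W' n - v) = of_real (x' + of_int n * r')" for n
    using 2(4) by metis
  define c where "c = B' / B"
  define d where "d = A' - c * A"
  have c0: "c \<noteq> 0" using 1 2 by (simp add: c_def)
  have rel: "A' + B' / (z - v) = c * (A + B / (z - v)) + d" for z
    using 1 by (simp add: c_def d_def algebra_simps)
  have into: "Im (c * y + d) > 0" if "Im y > 0" for y
  proof -
    have "y \<in> (\<lambda>z. A + B / (z - v)) ` ball 0 1" using 1(2) that by simp
    then obtain z where "z \<in> ball 0 1" "y = A + B / (z - v)" by blast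
    then have "c * y + d \<in> (\<lambda>z. A' + B' / (z - v)) ` ball 0 1" using rel by (metis image_eqI)
    then show ?thesis using 2(2) by simp
  qed
  have onto: "\<exists>x. Im x > 0 \<and> y = c * x + d" if "Im y > 0" for y
  proof -
    have "y \<in> (\<lambda>z. A' + B' / (z - v)) ` ball 0 1" using 2(2) that by simp
    then obtain z where z: "z \<in> ball 0 1" "y = A' + B' / (z - v)" by blast
    have "Im (A + B / (z - v)) > 0" using 1(2) z(1) by blast
    then show ?thesis using rel z by blast
  qed
  note cd = upper_half_plane_affine[OF c0 into onto]
  define C where "C = Re c"
  define D where "D = Re d"
  have CD: "c = of_real C" "d = of_real D" "C > 0" using cd by (auto simp: C_def D_def complex_eq_iff)
  have W'2: "A + B / (W' n - v) = of_real ((x' - D) / C + of_int n * (r' / C))" for n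
  proof -
    have "c * (A + B / (W' n - v)) + d = of_real (x' + of_int n * r')" using W'(3) rel by metis
    then have "A + B / (W' n - v) = of_real (x' + of_int n * r' - D) / of_real C"
      using c0 CD by (simp add: eq_divide_eq mult.commute) (simp add: algebra_simps)
    also have "\<dots> = of_real ((x' + of_int n * r' - D) / C)" by simp
    also have "(x' + of_int n * r' - D) / C = (x' - D) / C + of_int n * (r' / C)"
      by (simp add: add_divide_distrib diff_divide_distrib)
    finally show ?thesis .
  qed
  have rng: "range W = range W'"
  proof -
    have *: "range W = {w. w \<noteq> v \<and> {v, w} \<in> fan v}" if "bij_betw f UNIV (fan v)"
      "\<And>n. W n \<noteq> v" "\<And>n. f n = {v, W n}" for f and W :: "int \<Rightarrow> complex"
    proof -
      have "fan v = range f" using that(1) by (auto simp: bij_betw_def)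
      then show ?thesis using that(2,3) by (auto simp: doubleton_eq_iff)
    qed
    have "bij_betw f UNIV (fan v)" "bij_betw g UNIV (fan v)" using f g by (auto simp: fan_indexing_def)
    then show ?thesis using *[of f W] *[of g W'] W W' by simp
  qed
  have "W 0 = W' 0" using fg W(1,2)[of 0] W'(1,2)[of 0] by (simp add: doubleton_eq_iff)
  then have "of_real x = (of_real ((x' - D) / C) :: complex)" using W(3)[of 0] W'2[of 0] by simp
  then have xx: "(x' - D) / C = x" by (metis of_real_eq_iff)
  have "range (\<lambda>n. A + B / (W n - v)) = range (\<lambda>n. A + B / (W' n - v))"
    using arg_cong[OF rng, of "image (\<lambda>w. A + B / (w - v))"] by (simp only: image_image)
  then have "Re ` range (\<lambda>n. A + B / (W n - v)) = Re ` range (\<lambda>n. A + B / (W' n - v))" by simp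
  then have "range (\<lambda>n::int. x + of_int n * r) = range (\<lambda>n::int. x + of_int n * (r' / C))"
    unfolding W(3) W'2 xx image_image Re_complex_of_real .
  then have "r = r' / C" using int_progressions_eq[of r "r' / C" x] 1(3) 2(3) CD by simp
  then have "A + B / (W n - v) = A + B / (W' n - v)" for n
    using W(3)[of n] W'2[of n] xx by simp
  then have "W n = W' n" for n using 1(1) W(1)[of n] W'(1)[of n] by (simp add: field_simps)
  then show ?thesis using W(2) W'(2) by auto
qed

text \<open>The minus sign turns the index into the coordinate: for a unimodular pair, the Moebius
  map of \<open>moebius_pt\<close> takes the value \<open>k\<close> at the direction
  \<open>v - k * u\<close>, so the index grows from left to right.\<close>

definition fan_edge :: "complex \<Rightarrow> complex \<Rightarrow> int \<Rightarrow> complex set" where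
  "fan_edge u v k = {pt u, pt (v - of_int k * u)}"

lemma moebius_pt:
  assumes "w \<noteq> 0"
  shows "(cnj v * pt w + - v) / (cnj u * pt w + - u) = of_real (cdet v w / cdet u w)"
proof -
  have "cnj v * pt w + - v = 2 * \<i> * of_real (cdet v w) / cnj w"
    unfolding cdet_cnj[symmetric] pt_def using assms by (simp add: field_simps)
  moreover have "cnj u * pt w + - u = 2 * \<i> * of_real (cdet u w) / cnj w"
    unfolding cdet_cnj[symmetric] pt_def using assms by (simp add: field_simps)
  ultimately show ?thesis using assms by simp
qed

lemma moebius_half_plane:
  assumes "cdet u v = 1"
  shows "(\<lambda>z. (cnj v * z + - v) / (cnj u * z + - u)) ` ball 0 1 = {z. Im z > 0}"
proof -
  have cv: "Re u * Im v - Im u * Re v = 1" using assms by (simp add: cdet_def)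
  \<comment> \<open>The imaginary part of the quotient has the determinant of the pair as a factor,
    which is 1, so its sign is that of \<open>1 - (norm z)\<^sup>2\<close>.\<close>
  have Im: "Im ((cnj v * z + - v) / (cnj u * z + - u)) = (1 - (norm z)\<^sup>2) / (norm (cnj u * z + - u))\<^sup>2" for z
  proof -
    have "Im (cnj v * z + - v) * Re (cnj u * z + - u) - Re (cnj v * z + - v) * Im (cnj u * z + - u)
        = (1 - ((Re z)\<^sup>2 + (Im z)\<^sup>2)) * (Re u * Im v - Im u * Re v)"
      by (simp add: power2_eq_square algebra_simps)
    then show ?thesis unfolding Im_divide cmod_power2 cv by simp
  qed
  have u: "u \<noteq> 0" using assms by auto
  have nz: "cnj u * z + - u \<noteq> 0" if "norm z < 1" for z
  proof
    assume "cnj u * z + - u = 0"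
    then have "cnj u * z = u" by simp
    then have "norm u * norm z = norm u" by (metis norm_mult complex_mod_cnj)
    then show False using that u by simp
  qed
  show ?thesis
  proof (intro equalityI subsetI)
    fix y assume "y \<in> (\<lambda>z. (cnj v * z + - v) / (cnj u * z + - u)) ` ball 0 1"
    then obtain z where z: "norm z < 1" "y = (cnj v * z + - v) / (cnj u * z + - u)" by auto
    have "(norm z)\<^sup>2 < 1" using z(1) by (simp add: abs_square_less_1)
    then show "y \<in> {z. Im z > 0}" using Im[of z] nz[OF z(1)] z by simp
  next
    fix y :: complex assume "y \<in> {z. Im z > 0}"
    then have y: "Im y > 0" by simp
    define D where "D = y * cnj u - cnj v"
    \<comment> \<open>The inverse Moebius map applied to \<open>y\<close>.\<close>
    define z where "z = (y * u - v) / D"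
    have D: "D \<noteq> 0"
    proof
      assume "D = 0"
      then have e: "y * cnj u = cnj v" by (simp add: D_def)
      have "Im (y * cnj u * u) = Im y * (norm u)\<^sup>2"
        unfolding cmod_power2 by (simp add: power2_eq_square algebra_simps)
      then have "Im y * (norm u)\<^sup>2 = - 1" unfolding e using cv by (simp add: algebra_simps)
      moreover have "Im y * (norm u)\<^sup>2 \<ge> 0" using y by simp
      ultimately show False by simp
    qed
    define k where "k = cnj u * v - u * cnj v"
    have k: "k \<noteq> 0" unfolding k_def cdet_cnj using assms by simp
    have zD: "z * D = y * u - v" using D by (simp add: z_def)
    have "(cnj u * z + - u) * D = cnj u * (z * D) - u * D" by (simp add: algebra_simps)
    also have "\<dots> = - k" unfolding zD by (simp add: D_def k_def algebra_simps)
    finally have d: "cnj u * z + - u = - k / D" using D by (metis nonzero_mult_div_cancel_right)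
    have "(cnj v * z + - v) * D = cnj v * (z * D) - v * D" by (simp add: algebra_simps)
    also have "\<dots> = - y * k" unfolding zD by (simp add: D_def k_def algebra_simps)
    finally have n: "cnj v * z + - v = - y * k / D" using D by (metis nonzero_mult_div_cancel_right)
    have "(- y * k / D) / (- k / D) = y" using k D by (simp add: divide_eq_eq)
    then have yz: "(cnj v * z + - v) / (cnj u * z + - u) = y" unfolding n d .
    have "(1 - (norm z)\<^sup>2) / (norm (cnj u * z + - u))\<^sup>2 > 0"
      unfolding Im[of z, symmetric] yz by (rule y)
    then have "1 - (norm z)\<^sup>2 > 0" by (simp add: zero_less_divide_iff)
    then have "norm z < 1" by (simp add: abs_square_less_1)
    then show "y \<in> (\<lambda>z. (cnj v * z + - v) / (cnj u * z + - u)) ` ball 0 1"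
      using yz[symmetric] by (intro image_eqI[of _ _ z]) simp_all
  qed
qed

lemma fan_indexingI:
  fixes \<alpha> \<beta> \<gamma> \<delta> :: complex
  assumes "bij_betw e UNIV (fan v)" "\<alpha> * \<delta> - \<beta> * \<gamma> \<noteq> 0"
    "(\<lambda>z. (\<alpha> * z + \<beta>) / (\<gamma> * z + \<delta>)) ` ball 0 1 = {z. Im z > 0}" "\<gamma> * v + \<delta> = 0"
    "\<exists>x r :: real. r > 0 \<and> (\<forall>n. \<exists>w. w \<noteq> v \<and> e n = {v, w} \<and>
       (\<alpha> * w + \<beta>) / (\<gamma> * w + \<delta>) = of_real (x + of_int n * r))"
  shows "fan_indexing v e"
  unfolding fan_indexing_def
  by (rule conjI, fact, rule exI[where x = \<alpha>], rule exI[where x = \<beta>], rule exI[where x = \<gamma>],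
      rule exI[where x = \<delta>], intro conjI; fact)

lemma fan_indexing_fan_edge:
  assumes "unimodular u v"
  shows "fan_indexing (pt u) (fan_edge u v)"
proof -
  note uv = unimodularD[OF assms]
  have un: "unimodular u (v - of_int k * u)" for k using assms by simp
  note nz = unimodularD(6)[OF un]
  have ne: "pt (v - of_int k * u) \<noteq> pt u" for k using pt_neq[OF un, of k] by simp
  have inj: "inj (fan_edge u v)"
  proof (rule injI)
    fix k m assume "fan_edge u v k = fan_edge u v m"
    then have "pt (v - of_int k * u) = pt (v - of_int m * u)"
      unfolding fan_edge_def doubleton_eq_iff using ne by metis
    then have "cdet (v - of_int k * u) (v - of_int m * u) = 0" using pt_eq_iff[OF nz nz] by simp
    then show "k = m" using uv by (simp add: cdet_linear)
  qed
  have rng: "range (fan_edge u v) = fan (pt u)"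
    unfolding fan_eq[OF assms] by (simp add: fan_edge_def)
  have coord: "(cnj v * pt (v - of_int n * u) + - v) / (cnj u * pt (v - of_int n * u) + - u)
      = of_real (0 + of_int n * 1)" for n
    unfolding moebius_pt[OF nz] using uv by (simp add: cdet_linear)
  have "cnj v * - u - - v * cnj u = cnj u * v - u * cnj v" by simp
  then have det: "cnj v * - u - - v * cnj u \<noteq> 0" unfolding cdet_cnj using uv by simp
  have inf: "cnj u * pt u + - u = 0" using uv by (simp add: pt_def)
  have ex: "\<exists>w. w \<noteq> pt u \<and> fan_edge u v n = {pt u, w} \<and>
      (cnj v * w + - v) / (cnj u * w + - u) = of_real (0 + of_int n * 1)" for n
    unfolding fan_edge_def using coord[of n] ne[of n] by blast
  have "bij_betw (fan_edge u v) UNIV (fan (pt u))" using inj rng by (simp add: bij_betw_def)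
  moreover have "\<exists>x r::real. r > 0 \<and> (\<forall>n. \<exists>w. w \<noteq> pt u \<and> fan_edge u v n = {pt u, w} \<and>
      (cnj v * w + - v) / (cnj u * w + - u) = of_real (x + of_int n * r))"
  proof (rule exI[where x = 0], rule exI[where x = 1], intro conjI allI)
    show "\<exists>w. w \<noteq> pt u \<and> fan_edge u v n = {pt u, w} \<and>
      (cnj v * w + - v) / (cnj u * w + - u) = of_real (0 + of_int n * 1)" for n by (rule ex)
  qed simp
  ultimately show ?thesis
    using fan_indexingI[OF _ det moebius_half_plane[OF uv(3)] inf] by blast
qed

lemma fan_from_eq:
  assumes "unimodular u v"
  shows "fan_from (pt u) {pt u, pt v} = fan_edge u v"
  unfolding fan_from_def
proof (rule the_equality)
  show *: "fan_indexing (pt u) (fan_edge u v) \<and> fan_edge u v 0 = {pt u, pt v}"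
    using fan_indexing_fan_edge[OF assms] by (simp add: fan_edge_def)
  show "f = fan_edge u v" if "fan_indexing (pt u) f \<and> f 0 = {pt u, pt v}" for f
    using fan_indexing_unique[of "pt u" f "fan_edge u v"] * that norm_pt unimodularD(5)[OF assms] by simp
qed

section \<open>Shears along a fan\<close>

text \<open>Taking the preceding edge as the new base moves one term across it: the upper tail gains
  the old base term \<open>a 0\<close>, and the lower tail loses the new base term
  \<open>a (-1)\<close>.\<close>

lemma shift_bilateral_sums:
  fixes a :: "int \<Rightarrow> real"
  assumes "convergent (\<lambda>n. \<Sum>k = - int n..-1. a k)" "convergent (\<lambda>n. \<Sum>k = 0..int n. a k)"
  shows "lim (\<lambda>n. \<Sum>k = 1..int n. a (k - 1)) = lim (\<lambda>n. \<Sum>k = 1..int n. a k) + a 0"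
    and "lim (\<lambda>n. \<Sum>k = - int n..-1. a (k - 1)) = lim (\<lambda>n. \<Sum>k = - int n..-1. a k) - a (-1)"
proof -
  obtain A B where A: "(\<lambda>n. \<Sum>k = 0..int n. a k) \<longlonglongrightarrow> A"
    and B: "(\<lambda>n. \<Sum>k = - int n..-1. a k) \<longlonglongrightarrow> B"
    using assms unfolding convergent_def by blast
  have "(\<Sum>k = 1..int n. a k) = (\<Sum>k = 0..int n. a k) - a 0" for n
  proof -
    have "{0..int n} = insert 0 {1..int n}" by auto
    then show ?thesis by simp
  qed
  then have "(\<lambda>n. \<Sum>k = 1..int n. a k) \<longlonglongrightarrow> A - a 0"
    using tendsto_diff[OF A tendsto_const, of "a 0"] by simp
  then have 1: "lim (\<lambda>n. \<Sum>k = 1..int n. a k) = A - a 0" by (rule limI)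
  have "(\<Sum>k = 1..int (Suc n). a (k - 1)) = (\<Sum>k = 0..int n. a k)" for n
    by (rule sum.reindex_bij_witness[of _ "\<lambda>k. k + 1" "\<lambda>k. k - 1"]) auto
  then have "(\<lambda>n. \<Sum>k = 1..int (Suc n). a (k - 1)) \<longlonglongrightarrow> A" using A by simp
  then have "(\<lambda>n. \<Sum>k = 1..int n. a (k - 1)) \<longlonglongrightarrow> A" by (rule LIMSEQ_imp_Suc)
  then have 2: "lim (\<lambda>n. \<Sum>k = 1..int n. a (k - 1)) = A" by (rule limI)
  show "lim (\<lambda>n. \<Sum>k = 1..int n. a (k - 1)) = lim (\<lambda>n. \<Sum>k = 1..int n. a k) + a 0"
    using 1 2 by simp
  have "(\<Sum>k = - int n..-1. a (k - 1)) = (\<Sum>k = - int (Suc n)..-1. a k) - a (-1)" for n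
  proof -
    have "(\<Sum>k = - int n..-1. a (k - 1)) = (\<Sum>k = - int (Suc n)..-2. a k)"
      by (rule sum.reindex_bij_witness[of _ "\<lambda>k. k + 1" "\<lambda>k. k - 1"]) auto
    moreover have "{- int (Suc n)..-1} = insert (-1) {- int (Suc n)..-2}" by auto
    ultimately show ?thesis by simp
  qed
  then have "(\<lambda>n. \<Sum>k = - int n..-1. a (k - 1)) \<longlonglongrightarrow> B - a (-1)"
    using tendsto_diff[OF LIMSEQ_Suc[OF B] tendsto_const, of "a (-1)"] by simp
  then have 3: "lim (\<lambda>n. \<Sum>k = - int n..-1. a (k - 1)) = B - a (-1)" by (rule limI)
  show "lim (\<lambda>n. \<Sum>k = - int n..-1. a (k - 1)) = lim (\<lambda>n. \<Sum>k = - int n..-1. a k) - a (-1)"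
    using 3 limI[OF B] by simp
qed

lemma fan_edge_simps:
  "fan_edge u v 0 = {pt u, pt v}" "fan_edge u v (-1) = {pt u, pt (v + u)}"
  "fan_edge u (v + u) k = fan_edge u v (k - 1)"
  by (simp_all add: fan_edge_def algebra_simps)

definition fan_imbalance :: "(complex set \<Rightarrow> real) \<Rightarrow> complex \<Rightarrow> complex \<Rightarrow> real" where
  "fan_imbalance s u v = p_minus s (pt u) {pt u, pt v} - p_plus s (pt u) {pt u, pt v}"

text \<open>The edge to \<open>v + u\<close> has index -1 in the fan based at the edge to
  \<open>v\<close>. The infinite tails cancel, and only these two edges remain.\<close>

lemma fan_imbalance_step:
  assumes "s \<in> shears_P" "unimodular u v"
  shows "fan_imbalance s u v - fan_imbalance s u (v + u) = s {pt u, pt v} + s {pt u, pt (v + u)}"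
proof -
  have un: "unimodular u (v + u)" using assms(2) by simp
  have c: "convergent (\<lambda>n. \<Sum>k = - int n..-1. s (fan_edge u v k))"
    "convergent (\<lambda>n. \<Sum>k = 0..int n. s (fan_edge u v k))"
    using assms pt_in_vertices[OF assms(2)] fan_indexing_fan_edge[OF assms(2)]
    unfolding shears_P_def by blast+
  show ?thesis
    using shift_bilateral_sums[OF c]
    unfolding fan_imbalance_def p_minus_def p_plus_def fan_from_eq[OF assms(2)] fan_from_eq[OF un]
      fan_edge_simps by simp
qed

lemma Psi_eq_imbalance:
  assumes "unimodular u v"
  shows "Psi s {pt u, pt v} = (fan_imbalance s u v + fan_imbalance s v (- u)) / 4"
  using pt_neq[OF assms] by (simp add: Psi_def fan_imbalance_def insert_commute)

text \<open>The four edges on the right are the sides of the quadrilateral around the edge on the left.\<close>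

lemma shear_eq_Psi:
  assumes s: "s \<in> shears_P" and "unimodular u v"
  shows "s {pt u, pt v} = Psi s {pt u, pt (v - u)} - Psi s {pt u, pt (v + u)}
    + Psi s {pt (v + u), pt v} - Psi s {pt v, pt (v - u)}"
proof -
  have un: "unimodular u (v - u)" "unimodular u (v + u)" "unimodular (v + u) v" "unimodular v (v - u)"
    using assms(2) unimodular_simps(1)[of v "- u"] by (simp_all add: add.commute)
  note st = fan_imbalance_step[OF s]
  \<comment> \<open>Two fan steps at each of \<open>u\<close> and \<open>v\<close>, one at each of
    the other corners: in the signed sum below every side cancels and the diagonal is counted four
    times.\<close>
  have u: "fan_imbalance s u (v - u) - fan_imbalance s u (v + u)
      = s {pt u, pt (v - u)} + 2 * s {pt u, pt v} + s {pt u, pt (v + u)}"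
    using st[OF un(1)] st[OF assms(2)] by simp
  have un': "unimodular v (- (v + u))" "unimodular v (- u)" "unimodular (v + u) (- u)" "unimodular (v - u) (- v)"
    using un by (simp_all del: minus_add_distrib add: unimodular_simps(6))
  have v: "fan_imbalance s v (- (v + u)) - fan_imbalance s v (v - u)
      = s {pt v, pt (v + u)} + 2 * s {pt v, pt u} + s {pt v, pt (v - u)}"
    using st[OF un'(1)] st[OF un'(2)] pt_minus[of "v + u"] by (simp add: algebra_simps)
  have w: "fan_imbalance s (v + u) (- u) - fan_imbalance s (v + u) v = s {pt (v + u), pt u} + s {pt (v + u), pt v}"
    using st[OF un'(3)] by simp
  have x: "fan_imbalance s (v - u) (- v) - fan_imbalance s (v - u) (- u) = s {pt (v - u), pt v} + s {pt (v - u), pt u}"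
    using st[OF un'(4)] by simp
  have quarter: "4 * ((a + b) / 4 - (c + d) / 4 + (e + f) / 4 - (g + h) / 4) = (a + b) - (c + d) + (e + f) - (g + h)"
    for a b c d e f g h :: real by (simp add: field_simps)
  have "4 * (Psi s {pt u, pt (v - u)} - Psi s {pt u, pt (v + u)} + Psi s {pt (v + u), pt v} - Psi s {pt v, pt (v - u)})
     = (fan_imbalance s u (v - u) + fan_imbalance s (v - u) (- u)) - (fan_imbalance s u (v + u) + fan_imbalance s (v + u) (- u))
      + (fan_imbalance s (v + u) v + fan_imbalance s v (- (v + u))) - (fan_imbalance s v (v - u) + fan_imbalance s (v - u) (- v))"
    unfolding un[THEN Psi_eq_imbalance] by (rule quarter)
  also have "\<dots> = 4 * s {pt u, pt v}"
    using u v w x by (simp add: insert_commute)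
  finally show ?thesis by simp
qed

lemma Psi_bounded:
  assumes "s \<in> shears_H"
  obtains B where "\<And>u v. unimodular u v \<Longrightarrow> \<bar>Psi s {pt u, pt v}\<bar> \<le> B"
proof
  fix u v assume "unimodular u v"
  then have e: "{pt u, pt v} \<in> farey_edges" by (auto simp: farey_edges_eq)
  have "sum (\<lambda>e. (Psi s e)\<^sup>2) {{pt u, pt v}} \<le> infsum (\<lambda>e. (Psi s e)\<^sup>2) farey_edges"
    using assms e by (intro finite_sum_le_infsum) (auto simp: shears_H_def)
  then have "(Psi s {pt u, pt v})\<^sup>2 \<le> infsum (\<lambda>e. (Psi s e)\<^sup>2) farey_edges" by simp
  then show "\<bar>Psi s {pt u, pt v}\<bar> \<le> sqrt (infsum (\<lambda>e. (Psi s e)\<^sup>2) farey_edges)"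
    using real_le_rsqrt[of "\<bar>Psi s {pt u, pt v}\<bar>"] by simp
qed

text \<open>Along a fan the shears telescope, so their partial sums are uniformly bounded.\<close>

lemma fan_potential:
  assumes "s \<in> shears_H"
  obtains B where "\<And>u v. unimodular u v \<Longrightarrow> \<exists>\<tau> :: int \<Rightarrow> real. (\<forall>k. \<bar>\<tau> k\<bar> \<le> B) \<and>
    (\<forall>k. s {pt u, pt (v + of_int k * u)} = \<tau> k - \<tau> (k + 1))"
proof -
  obtain B where B: "\<And>u v. unimodular u v \<Longrightarrow> \<bar>Psi s {pt u, pt v}\<bar> \<le> B"
    using Psi_bounded[OF assms] by blast
  have s: "s \<in> shears_P" using assms by (simp add: shears_H_def)
  have "\<exists>\<tau> :: int \<Rightarrow> real. (\<forall>k. \<bar>\<tau> k\<bar> \<le> 3 * B) \<and>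
    (\<forall>k. s {pt u, pt (v + of_int k * u)} = \<tau> k - \<tau> (k + 1))" if uv: "unimodular u v" for u v
  proof -
    define w where "w k = v + of_int k * u" for k :: int
    have w: "unimodular u (w k)" for k using uv by (simp add: w_def)
    have step: "w (k + 1) = w k + u" "w (k - 1) = w k - u" for k by (simp_all add: w_def algebra_simps)
    have ww: "unimodular (w k) (w (k - 1))" for k
      using w[of k] unimodular_simps(1)[of "w k" "- u"] unfolding step by simp
    \<comment> \<open>A signed sum of \<open>Psi s\<close> over the sides of the triangle of
      \<open>u\<close>, \<open>w (k - 1)\<close> and \<open>w k\<close>. In
      \<open>\<tau> k - \<tau> (k + 1)\<close> the shared edge to \<open>w k\<close> cancels, and
      the four sides of the quadrilateral remain.\<close>
    define \<tau> where "\<tau> k = Psi s {pt u, pt (w (k - 1))} + Psi s {pt u, pt (w k)} - Psi s {pt (w k), pt (w (k - 1))}" for k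
    have "\<bar>\<tau> k\<bar> \<le> 3 * B" for k
      using B[OF w[of "k - 1"]] B[OF w[of k]] B[OF ww[of k]] unfolding \<tau>_def by linarith
    moreover have "s {pt u, pt (w k)} = \<tau> k - \<tau> (k + 1)" for k
      using shear_eq_Psi[OF s w[of k]] unfolding \<tau>_def by (simp add: step)
    ultimately show ?thesis unfolding w_def by blast
  qed
  then show ?thesis using that by blast
qed

section \<open>The images of the Farey vertices\<close>

text \<open>\<open>lmap\<close> and \<open>rmap\<close> change from the coordinates of a child cone
  to those of its parent: \<open>lmap r\<close> sends 1 to \<open>r\<close> and \<open>\<i>\<close>
  to \<open>1 + \<i>\<close>, while \<open>rmap r\<close> sends 1 to \<open>1 + \<i>\<close> and
  \<open>\<i>\<close> to \<open>r * \<i>\<close>. Since only directions matter, \<open>r\<close> is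
  the one free parameter.\<close>

definition lmap :: "real \<Rightarrow> complex \<Rightarrow> complex" where
  "lmap r z = Complex (r * Re z + Im z) (Im z)"

definition rmap :: "real \<Rightarrow> complex \<Rightarrow> complex" where
  "rmap r z = Complex (Re z) (Re z + r * Im z)"

text \<open>
  \<open>dev f x y u v\<close> is the direction, in the coordinates given by the images of \<open>u\<close> and \<open>v\<close>, of the
  image of \<open>x u + y v\<close>. Each subdivision step rescales one of the images, which is what makes
  the cross ratio at the newly crossed edge equal to \<open>exp f\<close>.
\<close>

function dev :: "(complex \<Rightarrow> complex \<Rightarrow> real) \<Rightarrow> nat \<Rightarrow> nat \<Rightarrow> complex \<Rightarrow> complex \<Rightarrow> complex" where
  "dev f x y u v =
     (if x = 0 then \<i> else if y = 0 then 1
      else if y \<le> x then sgn (lmap (exp (- f u (u + v))) (dev f (x - y) y u (u + v)))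
      else sgn (rmap (exp (f (u + v) v)) (dev f x (y - x) (u + v) v)))"
  by pat_completeness auto
termination by (relation "Wellfounded.measure (\<lambda>(f, x, y, u, v). x + y)") auto

declare dev.simps [simp del]

lemma dev_0 [simp]: "dev f 0 y u v = \<i>" "x > 0 \<Longrightarrow> dev f x 0 u v = 1"
  by (simp_all add: dev.simps)

text \<open>The recursion extends to the boundary \<open>y = 0\<close> because \<open>lmap r\<close>
  keeps the direction 1.\<close>

lemma dev_left:
  assumes "x + y > 0"
  shows "dev f (x + y) y u v = sgn (lmap (exp (- f u (u + v))) (dev f x y u (u + v)))"
proof (cases "y = 0")
  case True
  then have "dev f (x + y) y u v = 1" "dev f x y u (u + v) = 1" using assms by simp_all
  moreover have "sgn (lmap r 1) = 1" if "r > 0" for r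
    using that by (simp add: lmap_def sgn_eq complex_eq_iff cmod_def)
  ultimately show ?thesis by simp
qed (simp add: dev.simps[of f "x + y" y])

lemma dev_right:
  assumes "x + y > 0"
  shows "dev f x (x + y) u v = sgn (rmap (exp (f (u + v) v)) (dev f x y (u + v) v))"
proof -
  consider "x = 0" | "x > 0" "y = 0" | "x > 0" "y > 0" by linarith
  then show ?thesis
  proof cases
    case 1
    moreover have "sgn (rmap r \<i>) = \<i>" if "r > 0" for r
      using that by (simp add: rmap_def sgn_eq complex_eq_iff cmod_def)
    ultimately show ?thesis by simp
  next
    case 2
    \<comment> \<open>On the diagonal the definition takes the left child; both children send it to
      the direction \<open>1 + \<i>\<close>.\<close>
    then show ?thesis using dev_left[of 0 x f u v] by (simp add: rmap_def lmap_def)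
  next
    case 3
    then show ?thesis by (simp add: dev.simps[of f x "x + y"])
  qed
qed

lemma Re_Im_sgn:
  "Re (sgn z) = Re z / norm z" "Im (sgn z) = Im z / norm z"
  by (simp_all add: sgn_eq)

lemma dev_cone:
  assumes "x + y > 0"
  shows "Re (dev f x y u v) \<ge> 0 \<and> Im (dev f x y u v) \<ge> 0 \<and> norm (dev f x y u v) = 1 \<and>
    (x > 0 \<longrightarrow> Re (dev f x y u v) > 0) \<and> (y > 0 \<longrightarrow> Im (dev f x y u v) > 0)"
  using assms
proof (induction "x + y" arbitrary: x y u v rule: less_induct)
  case less
  consider "x = 0" | "x > 0" "y = 0" | "x > 0" "y > 0" "y \<le> x" | "x > 0" "y > 0" "x < y" by linarith
  then show ?case
  proof cases
    case 3
    then obtain z where z: "x = z + y" by (metis add.commute le_Suc_ex)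
    define d where "d = dev f z y u (u + v)"
    have IH: "Re d \<ge> 0" "Im d > 0" using less(1)[of z y u "u + v"] z 3 by (auto simp: d_def)
    define l where "l = lmap (exp (- f u (u + v))) d"
    have l: "Re l > 0" "Im l > 0" using IH by (auto simp: l_def lmap_def add_nonneg_pos)
    then have "l \<noteq> 0" by auto
    moreover have "dev f x y u v = sgn l" using dev_left[of z y] z 3 by (simp add: l_def d_def)
    ultimately show ?thesis using l by (simp add: Re_Im_sgn norm_sgn)
  next
    case 4
    then obtain z where z: "y = x + z" by (metis less_imp_add_positive)
    define d where "d = dev f x z (u + v) v"
    have IH: "Re d > 0" "Im d \<ge> 0" using less(1)[of x z "u + v" v] z 4 by (auto simp: d_def)
    define l where "l = rmap (exp (f (u + v) v)) d"
    have l: "Re l > 0" "Im l > 0" using IH by (auto simp: l_def rmap_def add_pos_nonneg)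
    then have "l \<noteq> 0" by auto
    moreover have "dev f x y u v = sgn l" using dev_right[of x z] z 4 by (simp add: l_def d_def)
    ultimately show ?thesis using l by (simp add: Re_Im_sgn norm_sgn)
  qed (use less in auto)
qed

lemma dev_nonzero: "x + y > 0 \<Longrightarrow> dev f x y u v \<noteq> 0"
  using dev_cone[of x y f u v] by auto

lemma lmap_nonzero: "r > 0 \<Longrightarrow> z \<noteq> 0 \<Longrightarrow> lmap r z \<noteq> 0"
  by (auto simp: lmap_def complex_eq_iff)

lemma rmap_nonzero: "r > 0 \<Longrightarrow> z \<noteq> 0 \<Longrightarrow> rmap r z \<noteq> 0"
  by (auto simp: rmap_def complex_eq_iff)

lemma cdet_lmap: "cdet (lmap r z) (lmap r w) = r * cdet z w"
  by (simp add: cdet_def lmap_def algebra_simps)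

lemma cdet_rmap: "cdet (rmap r z) (rmap r w) = r * cdet z w"
  by (simp add: cdet_def rmap_def algebra_simps)

lemma cdet_sgn: "cdet (sgn z) (sgn w) = cdet z w / (norm z * norm w)"
  by (simp add: cdet_def Re_Im_sgn diff_divide_distrib)

lemma cdet_sgn_pos: "cdet z w > 0 \<Longrightarrow> cdet (sgn z) (sgn w) > 0"
proof -
  assume "cdet z w > 0"
  moreover then have "z \<noteq> 0" "w \<noteq> 0" by fastforce+
  ultimately show ?thesis by (simp add: cdet_sgn)
qed

text \<open>\<open>lmap\<close> takes the closed quadrant to directions on or below the diagonal.
  With the mirror image for \<open>rmap\<close>, this separates the developments of the two
  children.\<close>

lemma dev_below_diagonal:
  assumes "y \<le> x" "x > 0"
  shows "Im (dev f x y u v) \<le> Re (dev f x y u v)" "y < x \<Longrightarrow> Im (dev f x y u v) < Re (dev f x y u v)"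
proof -
  obtain z where z: "x = z + y" using assms by (metis add.commute le_Suc_ex)
  define d where "d = dev f z y u (u + v)"
  have IH: "Re d \<ge> 0" "z > 0 \<Longrightarrow> Re d > 0" "d \<noteq> 0" using dev_cone[of z y f u "u + v"] z assms by (auto simp: d_def)
  define l where "l = lmap (exp (- f u (u + v))) d"
  have l: "Im l \<le> Re l" "z > 0 \<Longrightarrow> Im l < Re l" "norm l > 0"
    using IH lmap_nonzero[of "exp (- f u (u + v))" d] by (auto simp: l_def lmap_def)
  have e: "dev f x y u v = sgn l" using dev_left[of z y] z assms by (simp add: l_def d_def)
  show "Im (dev f x y u v) \<le> Re (dev f x y u v)" "y < x \<Longrightarrow> Im (dev f x y u v) < Re (dev f x y u v)"
    unfolding e using l z by (auto simp: Re_Im_sgn divide_right_mono divide_strict_right_mono)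
qed

lemma dev_above_diagonal:
  assumes "x \<le> y" "y > 0"
  shows "Re (dev f x y u v) \<le> Im (dev f x y u v)" "x < y \<Longrightarrow> Re (dev f x y u v) < Im (dev f x y u v)"
proof -
  obtain z where z: "y = x + z" using assms by (metis le_Suc_ex)
  define d where "d = dev f x z (u + v) v"
  have IH: "Im d \<ge> 0" "z > 0 \<Longrightarrow> Im d > 0" "d \<noteq> 0" using dev_cone[of x z f "u + v" v] z assms by (auto simp: d_def)
  define l where "l = rmap (exp (f (u + v) v)) d"
  have l: "Re l \<le> Im l" "z > 0 \<Longrightarrow> Re l < Im l" "norm l > 0"
    using IH rmap_nonzero[of "exp (f (u + v) v)" d] by (auto simp: l_def rmap_def)
  have e: "dev f x y u v = sgn l" using dev_right[of x z] z assms by (simp add: l_def d_def)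
  show "Re (dev f x y u v) \<le> Im (dev f x y u v)" "x < y \<Longrightarrow> Re (dev f x y u v) < Im (dev f x y u v)"
    unfolding e using l z by (auto simp: Re_Im_sgn divide_right_mono divide_strict_right_mono)
qed

text \<open>Two directions in the same child are moved by one linear map of positive determinant,
  which reduces the claim to that child; directions in different children are separated by the
  diagonal.\<close>

lemma dev_mono:
  assumes "y * x' < x * y'"
  shows "cdet (dev f x y u v) (dev f x' y' u v) > 0"
  using assms
proof (induction "x + y + x' + y'" arbitrary: x y x' y' u v rule: less_induct)
  case less
  have pos: "x > 0" "y' > 0" using less.prems by (auto intro!: Nat.gr0I)
  consider "y \<le> x" "y' \<le> x'" | "x \<le> y" "x' \<le> y'" | "y \<le> x" "x' \<le> y'" "y < x \<or> x' < y'" | "x \<le> y" "y' \<le> x'"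
    by linarith
  then show ?case
  proof cases
    case 1
    then obtain z z' where z: "x = z + y" "x' = z' + y'" by (metis add.commute le_Suc_ex)
    have "y * z' < z * y'" using less.prems by (simp add: z algebra_simps)
    then have "cdet (dev f z y u (u + v)) (dev f z' y' u (u + v)) > 0"
      by (cases "y = 0") (use less.hyps[of z y z' y'] z pos in auto)
    then show ?thesis using dev_left[of z y f u v] dev_left[of z' y' f u v] z pos
      by (simp add: cdet_sgn_pos cdet_lmap)
  next
    case 2
    then obtain z z' where z: "y = x + z" "y' = x' + z'" by (metis le_Suc_ex)
    have "z * x' < x * z'" using less.prems by (simp add: z algebra_simps)
    then have "cdet (dev f x z (u + v) v) (dev f x' z' (u + v) v) > 0"
      using less.hyps[of x z x' z'] z pos by auto
    then show ?thesis using dev_right[of x z f u v] dev_right[of x' z' f u v] z pos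
      by (simp add: cdet_sgn_pos cdet_rmap)
  next
    case 3
    define d d' where "d = dev f x y u v" and "d' = dev f x' y' u v"
    have d: "Im d \<le> Re d" "y < x \<Longrightarrow> Im d < Re d" "Im d \<ge> 0" "Re d > 0"
      using dev_below_diagonal[of y x f u v] dev_cone[of x y f u v] 3 pos by (auto simp: d_def)
    have d': "Re d' \<le> Im d'" "x' < y' \<Longrightarrow> Re d' < Im d'" "Re d' \<ge> 0" "Im d' > 0"
      using dev_above_diagonal[of x' y' f u v] dev_cone[of x' y' f u v] 3 pos by (auto simp: d'_def)
    have "Im d * Re d' < Re d * Im d'"
    proof (cases "y < x")
      case True
      have "Im d * Re d' \<le> Im d * Im d'" using d d' by (intro mult_left_mono) auto
      also have "\<dots> < Re d * Im d'" using d d' True by (intro mult_strict_right_mono) auto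
      finally show ?thesis .
    next
      case False
      have "Im d * Re d' \<le> Re d * Re d'" using d d' by (intro mult_right_mono) auto
      also have "\<dots> < Re d * Im d'" using d d' False 3 by (intro mult_strict_left_mono) auto
      finally show ?thesis .
    qed
    then show ?thesis by (simp add: cdet_def d_def d'_def)
  next
    case 4
    then have "x * y' \<le> y * x'" by (intro mult_mono) auto
    then show ?thesis using less.prems by simp
  qed
qed

text \<open>The cross ratio on the projective line: every argument occurs once above and once below,
  so lengths cancel.\<close>

definition cdet_ratio :: "complex \<Rightarrow> complex \<Rightarrow> complex \<Rightarrow> complex \<Rightarrow> real" where
  "cdet_ratio a b c d = (cdet a b * cdet c d) / (cdet b c * cdet a d)"

lemma cdet_ratio_sgn:
  assumes "a \<noteq> 0" "b \<noteq> 0" "c \<noteq> 0" "d \<noteq> 0"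
  shows "cdet_ratio (sgn a) (sgn b) (sgn c) (sgn d) = cdet_ratio a b c d"
  using assms by (simp add: cdet_ratio_def cdet_sgn)

lemma cdet_ratio_linear:
  assumes "\<And>z w. cdet (L z) (L w) = k * cdet z w" "k \<noteq> 0"
  shows "cdet_ratio (L a) (L b) (L c) (L d) = cdet_ratio a b c d"
  using assms by (simp add: cdet_ratio_def)

lemma cdet_ratio_minus [simp]:
  "cdet_ratio a b c (- d) = cdet_ratio a b c d" "cdet_ratio a b (- c) d = cdet_ratio a b c d"
  by (simp_all add: cdet_ratio_def)

lemma cdet_ratio_rotate: "cdet_ratio b d a m = cdet_ratio a m b d"
  by (simp add: cdet_ratio_def cdet_commute[of a d] cdet_commute[of m b] mult.commute)

lemma dev_ratio_left:
  assumes "x1 + y1 > 0" "x2 + y2 > 0" "x3 + y3 > 0" "x4 + y4 > 0"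
  shows "cdet_ratio (dev f (x1 + y1) y1 u v) (dev f (x2 + y2) y2 u v)
      (dev f (x3 + y3) y3 u v) (dev f (x4 + y4) y4 u v) =
    cdet_ratio (dev f x1 y1 u (u + v)) (dev f x2 y2 u (u + v))
      (dev f x3 y3 u (u + v)) (dev f x4 y4 u (u + v))"
  unfolding assms[THEN dev_left]
  by (simp add: cdet_ratio_sgn[OF assms[THEN dev_nonzero, THEN lmap_nonzero[rotated]]]
      cdet_ratio_linear[of _ "exp (- f u (u + v))", OF cdet_lmap])

lemma dev_ratio_right:
  assumes "x1 + y1 > 0" "x2 + y2 > 0" "x3 + y3 > 0" "x4 + y4 > 0"
  shows "cdet_ratio (dev f x1 (x1 + y1) u v) (dev f x2 (x2 + y2) u v)
      (dev f x3 (x3 + y3) u v) (dev f x4 (x4 + y4) u v) =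
    cdet_ratio (dev f x1 y1 (u + v) v) (dev f x2 y2 (u + v) v)
      (dev f x3 y3 (u + v) v) (dev f x4 y4 (u + v) v)"
  unfolding assms[THEN dev_right]
  by (simp add: cdet_ratio_sgn[OF assms[THEN dev_nonzero, THEN rmap_nonzero[rotated]]]
      cdet_ratio_linear[of _ "exp (f (u + v) v)", OF cdet_rmap])

text \<open>Origin of the two factors in \<open>dev\<close>. Up to length, the apex of the
  neighbouring triangle is \<open>(1, 1 + e)\<close> on the right and \<open>(1 + 1 / e, 1)\<close>
  on the left, where \<open>e\<close> is the exponential of the edge value; the left factor lands in
  the denominator of the ratio, whence the inverse.\<close>

lemma dev_base_ratios:
  "cdet_ratio (dev f 1 1 u v) (dev f 1 2 u v) (dev f 0 1 u v) (dev f 1 0 u v) = exp (f (u + v) v)"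
  "cdet_ratio (dev f 1 0 u v) (dev f 2 1 u v) (dev f 1 1 u v) (dev f 0 1 u v) = exp (f u (u + v))"
proof -
  have d11: "dev f 1 1 u v = sgn (1 + \<i>)" for u v
    using dev_left[of 0 1 f u v] by (simp add: lmap_def complex_eq_iff Complex_eq)
  have d12: "dev f 1 2 u v = sgn (rmap (exp (f (u + v) v)) (sgn (1 + \<i>)))"
    using dev_right[of 1 1 f u v] by (simp add: d11[simplified] numeral_2_eq_2)
  have d21: "dev f 2 1 u v = sgn (lmap (exp (- f u (u + v))) (sgn (1 + \<i>)))"
    using dev_left[of 1 1 f u v] by (simp add: d11[simplified] numeral_2_eq_2)
  have n: "1 + \<i> \<noteq> 0" "\<i> + 1 \<noteq> 0" "sgn (1 + \<i>) \<noteq> 0" by (auto simp: complex_eq_iff sgn_eq_0_iff)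
  have s: "sgn (1::complex) = 1" "sgn \<i> = \<i>" by (auto simp: sgn_eq)
  define m where "m = norm (1 + \<i>)"
  have m: "m > 0" using n by (simp add: m_def)
  have "cdet_ratio (dev f 1 1 u v) (dev f 1 2 u v) (dev f 0 1 u v) (dev f 1 0 u v)
      = cdet_ratio (sgn (1 + \<i>)) (sgn (rmap (exp (f (u + v) v)) (sgn (1 + \<i>)))) (sgn \<i>) (sgn 1)"
    unfolding d11 d12 using s by simp
  also have "\<dots> = cdet_ratio (1 + \<i>) (rmap (exp (f (u + v) v)) (sgn (1 + \<i>))) \<i> 1"
    using n by (intro cdet_ratio_sgn) (auto simp: rmap_nonzero)
  also have "\<dots> = exp (f (u + v) v)"
    using m n by (simp add: cdet_ratio_def cdet_def rmap_def Re_Im_sgn m_def[symmetric] field_simps)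
  finally show "cdet_ratio (dev f 1 1 u v) (dev f 1 2 u v) (dev f 0 1 u v) (dev f 1 0 u v) = exp (f (u + v) v)" .
  have "cdet_ratio (dev f 1 0 u v) (dev f 2 1 u v) (dev f 1 1 u v) (dev f 0 1 u v)
      = cdet_ratio (sgn 1) (sgn (lmap (exp (- f u (u + v))) (sgn (1 + \<i>)))) (sgn (1 + \<i>)) (sgn \<i>)"
    unfolding d11 d21 using s by simp
  also have "\<dots> = cdet_ratio 1 (lmap (exp (- f u (u + v))) (sgn (1 + \<i>))) (1 + \<i>) \<i>"
    using n by (intro cdet_ratio_sgn) (auto simp: lmap_nonzero)
  also have "\<dots> = exp (f u (u + v))"
    using m n by (simp add: cdet_ratio_def cdet_def lmap_def Re_Im_sgn m_def[symmetric] exp_minus field_simps)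
  finally show "cdet_ratio (dev f 1 0 u v) (dev f 2 1 u v) (dev f 1 1 u v) (dev f 0 1 u v) = exp (f u (u + v))" .
qed

text \<open>In each recursion step one linear map acts on all four directions, so the cross ratios
  at the two new sides of a triangle are carried unchanged down to the base case by Euclid's
  algorithm.\<close>

lemma dev_child_ratios:
  assumes "m * t = n * r + 1"
  shows "cdet_ratio (dev f (m + r) (n + t) u v) (dev f (m + 2 * r) (n + 2 * t) u v) (dev f r t u v) (dev f m n u v)
      = exp (f (of_nat (m + r) * u + of_nat (n + t) * v) (of_nat r * u + of_nat t * v)) \<and>
    cdet_ratio (dev f m n u v) (dev f (2 * m + r) (2 * n + t) u v) (dev f (m + r) (n + t) u v) (dev f r t u v)
      = exp (f (of_nat m * u + of_nat n * v) (of_nat (m + r) * u + of_nat (n + t) * v))"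
  using assms
proof (induction "m + n + r + t" arbitrary: m n r t u v rule: less_induct)
  case less
  have pos: "m > 0" "t > 0" using less.prems by (auto intro!: Nat.gr0I)
  from less.prems show ?case
  proof (cases rule: nat_unimodular_cases)
    case 1
    then show ?thesis using dev_base_ratios[of f u v] by (simp add: numeral_2_eq_2)
  next
    case 2
    then obtain m' r' where e: "m = m' + n" "r = r' + t" by (metis add.commute le_Suc_ex)
    have d: "m' * t = n * r' + 1" using less.prems by (simp add: e algebra_simps)
    have sm: "m' + n + r' + t < m + n + r + t" using e pos by simp
    note IH = less.hyps[OF sm d, of u "u + v"]
    have p: "(m' + r') + (n + t) > 0" "(m' + 2 * r') + (n + 2 * t) > 0" "r' + t > 0" "m' + n > 0"
      "(2 * m' + r') + (2 * n + t) > 0" using pos e by auto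
    have eqs: "m + r = (m' + r') + (n + t)" "m + 2 * r = (m' + 2 * r') + (n + 2 * t)"
      "2 * m + r = (2 * m' + r') + (2 * n + t)" using e by auto
    show ?thesis unfolding eqs unfolding e unfolding dev_ratio_left[OF p(1-4)] dev_ratio_left[OF p(4,5,1,3)]
      using IH by (simp add: algebra_simps)
  next
    case 3
    then obtain n' t' where e: "n = m + n'" "t = r + t'" by (metis le_Suc_ex)
    have d: "m * t' = n' * r + 1" using less.prems by (simp add: e algebra_simps)
    have "t' > 0" using d by (auto intro!: Nat.gr0I)
    have sm: "m + n' + r + t' < m + n + r + t" using e pos by simp
    note IH = less.hyps[OF sm d, of "u + v" v]
    have p: "(m + r) + (n' + t') > 0" "(m + 2 * r) + (n' + 2 * t') > 0" "r + t' > 0" "m + n' > 0"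
      "(2 * m + r) + (2 * n' + t') > 0" using pos e by auto
    have eqs: "n + t = (m + r) + (n' + t')" "n + 2 * t = (m + 2 * r) + (n' + 2 * t')"
      "2 * n + t = (2 * m + r) + (2 * n' + t')" using e by auto
    show ?thesis unfolding eqs unfolding e unfolding dev_ratio_right[OF p(1-4)] dev_ratio_right[OF p(4,5,1,3)]
      using IH by (simp add: algebra_simps)
  qed
qed

text \<open>An edge inside the cone is a new side of an older triangle, whose third vertex is the
  difference of the ends. There are two cases because \<open>dev\<close> takes natural coordinates,
  so the smaller end has to be the one subtracted.\<close>

lemma dev_quad_ratio:
  assumes "p * t = q * r + 1" "\<not> (p = 1 \<and> q = 0 \<and> r = 0 \<and> t = 1)"
  obtains "r \<le> p" "t \<le> q"
      "cdet_ratio (dev f p q u v) (dev f (p + r) (q + t) u v) (dev f r t u v) (dev f (p - r) (q - t) u v)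
        = exp (f (of_nat p * u + of_nat q * v) (of_nat r * u + of_nat t * v))" "p - r + (q - t) > 0"
  | "p \<le> r" "q \<le> t"
      "cdet_ratio (dev f p q u v) (dev f (p + r) (q + t) u v) (dev f r t u v) (dev f (r - p) (t - q) u v)
        = exp (f (of_nat p * u + of_nat q * v) (of_nat r * u + of_nat t * v))" "r - p + (t - q) > 0"
proof -
  \<comment> \<open>Transposition turns domination between columns into domination between the two
    ends.\<close>
  have "p * t = r * q + 1" using assms(1) by (simp add: mult.commute)
  then show thesis
  proof (cases rule: nat_unimodular_cases)
    case 1 then show ?thesis using assms(2) by simp
  next
    case 2
    then obtain m n where e: "p = m + r" "q = n + t" by (metis add.commute le_Suc_ex)
    have d: "m * t = n * r + 1" using assms(1) by (simp add: e algebra_simps)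
    then have "m > 0" by (auto intro!: Nat.gr0I)
    then show ?thesis using that(1) dev_child_ratios[OF d, of f u v] e
      by (simp add: algebra_simps mult_2_right)
  next
    case 3
    then obtain r' t' where e: "r = p + r'" "t = q + t'" by (metis le_Suc_ex)
    have d: "p * t' = q * r' + 1" using assms(1) by (simp add: e algebra_simps)
    then have "t' > 0" by (auto intro!: Nat.gr0I)
    then show ?thesis using that(2) dev_child_ratios[OF d, of f u v] e
      by (simp add: algebra_simps mult_2_right)
  qed
qed

section \<open>From one quadrant to all directions\<close>

definition upper :: "complex \<Rightarrow> bool" where
  "upper u \<longleftrightarrow> Im u > 0 \<or> Im u = 0 \<and> Re u > 0"

lemma upper_minus: "u \<noteq> 0 \<Longrightarrow> upper (- u) \<longleftrightarrow> \<not> upper u"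
  by (auto simp: upper_def complex_eq_iff)

text \<open>The image of \<open>-1\<close> in the second quadrant is scaled so as to realise the shear of \<open>{1, -1}\<close>.\<close>

definition tmap :: "real \<Rightarrow> complex \<Rightarrow> complex" where
  "tmap r z = Complex (- r * Im z) (Re z)"

lemma cdet_tmap: "cdet (tmap r z) (tmap r w) = r * cdet z w"
  by (simp add: cdet_def tmap_def algebra_simps)

lemma tmap_nonzero: "r > 0 \<Longrightarrow> z \<noteq> 0 \<Longrightarrow> tmap r z \<noteq> 0"
  by (auto simp: tmap_def complex_eq_iff)

abbreviation edge_val :: "(complex set \<Rightarrow> real) \<Rightarrow> complex \<Rightarrow> complex \<Rightarrow> real" where
  "edge_val s a b \<equiv> s {pt a, pt b}"

definition upper_dir :: "(complex set \<Rightarrow> real) \<Rightarrow> complex \<Rightarrow> complex" where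
  "upper_dir s u =
     (if Re u \<ge> 0 then dev (edge_val s) (nat \<lfloor>Re u\<rfloor>) (nat \<lfloor>Im u\<rfloor>) 1 \<i>
      else sgn (tmap (exp (edge_val s 1 \<i>)) (dev (edge_val s) (nat \<lfloor>Im u\<rfloor>) (nat \<lfloor>- Re u\<rfloor>) \<i> (-1))))"

definition image_dir :: "(complex set \<Rightarrow> real) \<Rightarrow> complex \<Rightarrow> complex" where
  "image_dir s u = (if upper u then upper_dir s u else - upper_dir s (- u))"

lemma image_dir_minus: "u \<noteq> 0 \<Longrightarrow> image_dir s (- u) = - image_dir s u"
  by (simp add: image_dir_def upper_minus)

lemma image_dir_quad1: "x + y > 0 \<Longrightarrow> image_dir s (quad1 x y) = dev (edge_val s) x y 1 \<i>"
  by (auto simp: image_dir_def upper_dir_def quad1_def upper_def)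

text \<open>Directions on the axes bounding the second quadrant fall under other clauses of
  \<open>image_dir\<close>. The values agree because \<open>tmap\<close> sends 1 to
  \<open>\<i>\<close> and \<open>\<i>\<close> to a negative real number.\<close>

lemma image_dir_quad2:
  assumes "x + y > 0"
  shows "image_dir s (quad2 x y) = sgn (tmap (exp (edge_val s 1 \<i>)) (dev (edge_val s) x y \<i> (-1)))"
proof -
  have "tmap r 1 = \<i>" "tmap r \<i> = of_real (- r)" for r
    by (simp_all add: tmap_def complex_eq_iff)
  then have t1: "sgn (tmap r 1) = \<i>" and t2: "r > 0 \<Longrightarrow> sgn (tmap r \<i>) = -1" for r
    by (simp_all add: sgn_eq)
  consider "x > 0" "y > 0" | "x > 0" "y = 0" | "x = 0" "y > 0" using assms by linarith
  then show ?thesis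
  proof cases
    case 1
    then show ?thesis by (simp add: image_dir_def upper_dir_def quad2_def upper_def)
  next
    case 2
    then have "quad2 x y = quad1 0 x" by (simp add: quad1_def quad2_def)
    then show ?thesis using 2 image_dir_quad1[of 0 x s] t1 by simp
  next
    case 3
    then have "quad2 x y = - quad1 y 0" "quad1 y 0 \<noteq> 0" by (simp_all add: quad1_def quad2_def)
    then show ?thesis using 3 image_dir_quad1[of y 0 s] image_dir_minus[of "quad1 y 0" s] t2 by simp
  qed
qed

lemma upper_cases:
  assumes "u \<in> gauss" "upper u"
  obtains x y where "x + y > 0" "u = quad1 x y" | x y where "x > 0" "y > 0" "u = quad2 x y"
proof -
  obtain m n where mn: "Re u = of_int m" "Im u = of_int n" using gauss_nat[OF assms(1)] .
  have up: "n > 0 \<or> n = 0 \<and> m > 0" using assms(2) mn by (simp add: upper_def)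
  show thesis
  proof (cases "m \<ge> 0")
    case True
    have "u = quad1 (nat m) (nat n)" using True up mn by (simp add: quad1_def complex_eq_iff) linarith
    moreover have "nat m + nat n > 0" using up True by linarith
    ultimately show thesis by (rule that(1)[rotated])
  next
    case False
    have "u = quad2 (nat n) (nat (- m))" using False up mn by (simp add: quad2_def complex_eq_iff)
    moreover have "nat n > 0" "nat (- m) > 0" using up False by linarith+
    ultimately show thesis using that(2)[of "nat n" "nat (- m)"] by simp
  qed
qed

lemma cdet_quads:
  "cdet (quad1 x y) (quad1 x' y') = real x * real y' - real y * real x'"
  "cdet (quad2 x y) (quad2 x' y') = real x * real y' - real y * real x'"
  "cdet (quad1 x y) (quad2 x' y') = real x * real x' + real y * real y'"
  by (simp_all add: cdet_def quad1_def quad2_def algebra_simps)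

lemma image_dir_upper:
  assumes "u \<in> gauss" "upper u"
  shows "norm (image_dir s u) = 1 \<and> (Im (image_dir s u) > 0 \<or> image_dir s u = 1)"
  using upper_cases[OF assms]
proof cases
  case (1 x y)
  show ?thesis
    using 1 dev_cone[of x y "edge_val s" 1 \<i>] by (cases "y = 0") (simp_all add: image_dir_quad1)
next
  case (2 x y)
  define d where "d = dev (edge_val s) x y \<i> (-1)"
  define l where "l = tmap (exp (edge_val s 1 \<i>)) d"
  have "Re d > 0" using 2 dev_cone[of x y "edge_val s" \<i> "-1"] by (simp add: d_def)
  then have l: "Im l > 0" by (simp add: l_def tmap_def)
  then have "l \<noteq> 0" by auto
  moreover have "image_dir s u = sgn l" using 2 image_dir_quad2[of x y s] by (simp add: l_def d_def)
  ultimately show ?thesis using l by (simp add: norm_sgn Re_Im_sgn)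
qed

lemma norm_image_dir:
  assumes "u \<in> gauss" "u \<noteq> 0"
  shows "norm (image_dir s u) = 1"
proof (cases "upper u")
  case True then show ?thesis using image_dir_upper assms by blast
next
  case False
  then have "norm (image_dir s (- u)) = 1" using image_dir_upper[of "- u"] assms upper_minus[of u] by simp
  then show ?thesis using image_dir_minus[OF assms(2), of s] by simp
qed

lemma image_dir_mono_upper:
  assumes "u \<in> gauss" "upper u" "w \<in> gauss" "upper w" "cdet u w > 0"
  shows "cdet (image_dir s u) (image_dir s w) > 0"
  using upper_cases[OF assms(1,2)]
proof cases
  case u: (1 x y)
  show ?thesis using upper_cases[OF assms(3,4)]
  proof cases
    case (1 x' y')
    then have "real (y * x') < real (x * y')" using assms(5) u by (simp add: cdet_quads)
    then have "y * x' < x * y'" by linarith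
    then show ?thesis using dev_mono u 1 image_dir_quad1 by simp
  next
    case (2 x' y')
    define d where "d = dev (edge_val s) x' y' \<i> (-1)"
    define c where "c = dev (edge_val s) x y 1 \<i>"
    have d: "Re d > 0" "Im d > 0" using dev_cone[of x' y' "edge_val s" \<i> "-1"] 2 by (auto simp: d_def)
    have c: "Re c \<ge> 0" "Im c \<ge> 0" "Re c > 0 \<or> Im c > 0"
      using dev_cone[of x y "edge_val s" 1 \<i>] u by (auto simp: c_def)
    have "cdet c (tmap (exp (edge_val s 1 \<i>)) d) = Re c * Re d + Im c * (exp (edge_val s 1 \<i>) * Im d)"
      by (simp add: cdet_def tmap_def)
    also have "\<dots> > 0" using c d by (auto intro: add_pos_nonneg add_nonneg_pos)
    finally have "cdet (sgn c) (sgn (tmap (exp (edge_val s 1 \<i>)) d)) > 0" by (rule cdet_sgn_pos)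
    moreover have "norm c = 1" using dev_cone[of x y "edge_val s" 1 \<i>] u by (auto simp: c_def)
    then have "sgn c = c" by (simp add: sgn_div_norm)
    ultimately show ?thesis using u 2 image_dir_quad1[of x y s] image_dir_quad2[of x' y' s]
      by (simp add: c_def d_def)
  qed
next
  case u: (2 x y)
  show ?thesis using upper_cases[OF assms(3,4)]
  proof cases
    case (1 x' y')
    then have "cdet w u \<ge> 0" using u by (simp add: cdet_quads)
    then show ?thesis using assms(5) cdet_commute[of u w] by simp
  next
    case (2 x' y')
    then have "real (y * x') < real (x * y')" using assms(5) u by (simp add: cdet_quads)
    then have "y * x' < x * y'" by linarith
    then have "cdet (dev (edge_val s) x y \<i> (-1)) (dev (edge_val s) x' y' \<i> (-1)) > 0" by (rule dev_mono)
    then show ?thesis using u 2 image_dir_quad2[of x y s] image_dir_quad2[of x' y' s]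
      by (simp add: cdet_sgn_pos cdet_tmap)
  qed
qed

lemma quad_arith:
  "quad1 p q + quad1 r t = quad1 (p + r) (q + t)" "quad2 p q + quad2 r t = quad2 (p + r) (q + t)"
  "p \<le> r \<Longrightarrow> q \<le> t \<Longrightarrow> quad1 r t - quad1 p q = quad1 (r - p) (t - q)"
  "p \<le> r \<Longrightarrow> q \<le> t \<Longrightarrow> quad2 r t - quad2 p q = quad2 (r - p) (t - q)"
  by (simp_all add: quad1_def quad2_def algebra_simps of_nat_diff)

text \<open>Edges inside one quadrant inherit the ratio from \<open>dev\<close>, and rotating a
  basis exchanges the two labellings of its quadrilateral. Only the edge \<open>{1, -1}\<close> has
  its two triangles in different quadrants, and the factor in \<open>tmap\<close> is made for
  it.\<close>

lemma image_dir_ratio: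
  assumes "unimodular a b"
  shows "cdet_ratio (image_dir s a) (image_dir s (a + b)) (image_dir s b) (image_dir s (b - a))
    = exp (s {pt a, pt b})"
proof -
  define P where "P a b \<longleftrightarrow> cdet_ratio (image_dir s a) (image_dir s (a + b)) (image_dir s b) (image_dir s (b - a))
    = exp (edge_val s a b)" for a b
  have rot: "P b (- a)" if "unimodular a b" "P a b" for a b
  proof -
    have nz: "a \<noteq> 0" "a + b \<noteq> 0" using that(1) unimodularD(5) unimodular_simps(4)[of a b] by blast+
    have "image_dir s (- a) = - image_dir s a" "image_dir s (- a - b) = - image_dir s (a + b)"
      using image_dir_minus[OF nz(1)] image_dir_minus[OF nz(2)] by simp_all
    then show ?thesis using that(2) cdet_ratio_rotate
      by (simp add: P_def insert_commute)
  qed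
  have P1i: "P 1 \<i>"
  proof -
    define e where "e = exp (edge_val s 1 \<i>)"
    have e: "e > 0" by (simp add: e_def)
    have q: "1 = quad1 1 0" "\<i> = quad1 0 1" "1 + \<i> = quad1 1 1" "\<i> - 1 = quad2 1 1"
      by (simp_all add: quad1_def quad2_def)
    have d11: "dev (edge_val s) 1 1 u v = sgn (1 + \<i>)" for u v
      using dev_left[of 0 1 "edge_val s" u v] by (simp add: lmap_def complex_eq_iff Complex_eq)
    have n: "1 + \<i> \<noteq> 0" "\<i> + 1 \<noteq> 0" "sgn (1 + \<i>) \<noteq> 0"
      by (auto simp: complex_eq_iff sgn_eq_0_iff)
    note n = n tmap_nonzero[OF e n(3)]
    define m where "m = norm (1 + \<i>)"
    have m: "m > 0" using n by (simp add: m_def)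
    have i: "image_dir s 1 = sgn 1" "image_dir s \<i> = sgn \<i>" "image_dir s (1 + \<i>) = sgn (1 + \<i>)"
      using image_dir_quad1[of 1 0 s] image_dir_quad1[of 0 1 s] image_dir_quad1[of 1 1 s] d11
      unfolding q[symmetric] by (simp_all add: sgn_eq)
    have i2: "image_dir s (\<i> - 1) = sgn (tmap e (sgn (1 + \<i>)))"
      using image_dir_quad2[of 1 1 s] d11 unfolding q[symmetric] e_def by simp
    have "cdet_ratio (sgn 1) (sgn (1 + \<i>)) (sgn \<i>) (sgn (tmap e (sgn (1 + \<i>))))
        = cdet_ratio 1 (1 + \<i>) \<i> (tmap e (sgn (1 + \<i>)))"
      using n by (intro cdet_ratio_sgn) auto
    also have "\<dots> = e"
      using m n by (simp add: cdet_ratio_def cdet_def tmap_def Re_Im_sgn m_def[symmetric] field_simps)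
    finally show ?thesis unfolding P_def i i2 by (simp add: e_def)
  qed
  have "P a b" using assms
  proof (induction rule: unimodular_quadrants)
    case (rot a b) then show ?case by (rule \<open>\<And>a b. unimodular a b \<Longrightarrow> P a b \<Longrightarrow> P b (- a)\<close>)
  next
    case (quad1 p q r t)
    show ?case
    proof (cases "p = 1 \<and> q = 0 \<and> r = 0 \<and> t = 1")
      case True then show ?thesis using P1i by (simp add: quad1_def)
    next
      case False
      have pos: "p + q > 0" "r + t > 0" "p + r + (q + t) > 0" using quad1 by (auto intro!: Nat.gr0I)
      from quad1 False show ?thesis
      proof (cases rule: dev_quad_ratio[of p t q r "edge_val s" 1 \<i>])
        case 1
        \<comment> \<open>Here the first end is the larger one, so the difference of the ends is the
          negative of a vector in the quadrant; oddness of \<open>image_dir\<close> absorbs the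
          sign.\<close>
        have d: "quad1 r t - quad1 p q = - quad1 (p - r) (q - t)" "quad1 (p - r) (q - t) \<noteq> 0"
          using quad_arith(3)[OF 1(1,2)] 1 by (auto simp: algebra_simps quad1_def complex_eq_iff)
        show ?thesis using 1 pos unfolding P_def quad_arith(1) d(1) image_dir_minus[OF d(2)]
          by (simp add: image_dir_quad1) (simp add: quad1_def)
      next
        case 2
        show ?thesis using 2 pos unfolding P_def quad_arith(1) quad_arith(3)[OF 2(1,2)]
          by (simp add: image_dir_quad1) (simp add: quad1_def)
      qed
    qed
  next
    case (quad2 p q r t)
    show ?case
    proof (cases "p = 1 \<and> q = 0 \<and> r = 0 \<and> t = 1")
      case True then show ?thesis using rot[OF unimodular_1_i P1i] by (simp add: quad2_def)
    next
      case False
      define e where "e = exp (s {1, -1})"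
      have e: "e > 0" by (simp add: e_def)
      have T: "cdet_ratio (sgn (tmap e a)) (sgn (tmap e b)) (sgn (tmap e c)) (sgn (tmap e d)) = cdet_ratio a b c d"
        if "a \<noteq> 0" "b \<noteq> 0" "c \<noteq> 0" "d \<noteq> 0" for a b c d
        using that e by (simp add: cdet_ratio_sgn tmap_nonzero cdet_ratio_linear[of _ e, OF cdet_tmap])
      have pos: "p + q > 0" "r + t > 0" "p + r + (q + t) > 0" using quad2 by (auto intro!: Nat.gr0I)
      from quad2 False show ?thesis
      proof (cases rule: dev_quad_ratio[of p t q r "edge_val s" \<i> "-1"])
        case 1
        have d: "quad2 r t - quad2 p q = - quad2 (p - r) (q - t)" "quad2 (p - r) (q - t) \<noteq> 0"
          using quad_arith(4)[OF 1(1,2)] 1 by (auto simp: algebra_simps quad2_def complex_eq_iff)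
        show ?thesis using 1 pos T unfolding P_def quad_arith(2) d(1) image_dir_minus[OF d(2)]
          by (simp add: image_dir_quad2 dev_nonzero e_def[symmetric]) (simp add: quad2_def)
      next
        case 2
        show ?thesis using 2 pos T unfolding P_def quad_arith(2) quad_arith(4)[OF 2(1,2)]
          by (simp add: image_dir_quad2 dev_nonzero e_def[symmetric]) (simp add: quad2_def)
      qed
    qed
  qed
  then show ?thesis by (simp add: P_def)
qed

section \<open>Monotone extension\<close>

text \<open>The supremum of the values at arguments up to \<open>x\<close> works: density of the
  arguments puts two of them strictly between any two reals, which gives strictness. The values need
  not be dense, so \<open>\<psi>\<close> may still jump.\<close>

lemma monotone_lift:
  fixes R :: "(real \<times> real) set" and p :: real
  assumes mono: "\<forall>\<theta> \<theta>' T T'. (\<theta>, T) \<in> R \<longrightarrow> (\<theta>', T') \<in> R \<longrightarrow> \<theta> < \<theta>' \<longrightarrow> T < T'"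
    and single: "\<forall>\<theta> T T'. (\<theta>, T) \<in> R \<longrightarrow> (\<theta>, T') \<in> R \<longrightarrow> T = T'"
    and shift: "\<forall>\<theta> T. (\<theta>, T) \<in> R \<longleftrightarrow> (\<theta> + p, T + p) \<in> R"
    and dense: "\<forall>a b. a < b \<longrightarrow> (\<exists>\<theta> T. (\<theta>, T) \<in> R \<and> a < \<theta> \<and> \<theta> < b)"
  obtains \<psi> :: "real \<Rightarrow> real" where "strict_mono \<psi>" "\<And>x. \<psi> (x + p) = \<psi> x + p"
    "\<And>\<theta> T. (\<theta>, T) \<in> R \<Longrightarrow> \<psi> \<theta> = T"
proof -
  define L where "L x = {T. \<exists>\<theta>\<le>x. (\<theta>, T) \<in> R}" for x
  define \<psi> where "\<psi> x = Sup (L x)" for x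
  have ne: "L x \<noteq> {}" for x
    using dense[rule_format, of "x - 1" x] by (force simp: L_def)
  have le: "T \<le> T'" if "(\<theta>, T) \<in> R" "(\<theta>', T') \<in> R" "\<theta> \<le> \<theta>'" for \<theta> \<theta>' T T'
    using mono[rule_format, OF that(1,2)] single[rule_format, of \<theta> T T'] that by (cases "\<theta> = \<theta>'") auto
  have ub: "T \<le> T'" if "(\<theta>', T') \<in> R" "x \<le> \<theta>'" "T \<in> L x" for \<theta>' T' x T
    using that le by (fastforce simp: L_def)
  have bdd: "bdd_above (L x)" for x
  proof -
    obtain \<theta> T where "(\<theta>, T) \<in> R" "x < \<theta>" using dense[rule_format, of x "x + 1"] by auto
    then show ?thesis using ub[of \<theta> T x] by (intro bdd_aboveI[of _ T]) auto
  qed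
  have upper: "\<psi> x \<le> T" if "(\<theta>, T) \<in> R" "x \<le> \<theta>" for x \<theta> T
    unfolding \<psi>_def using ub[OF that] ne by (intro cSup_least) auto
  have lower: "T \<le> \<psi> x" if "(\<theta>, T) \<in> R" "\<theta> \<le> x" for x \<theta> T
    unfolding \<psi>_def using that bdd by (intro cSup_upper) (auto simp: L_def)
  have val: "\<psi> \<theta> = T" if "(\<theta>, T) \<in> R" for \<theta> T
    using upper[OF that] lower[OF that] by (meson order.refl order.antisym)
  have "\<psi> x < \<psi> y" if xy: "x < y" for x y
  proof -
    define a where "a = (x + y) / 2"
    have "x < a" "a < y" using xy by (simp_all add: a_def)
    obtain \<theta>1 T1 where 1: "(\<theta>1, T1) \<in> R" "x < \<theta>1" "\<theta>1 < a" using dense[rule_format, OF \<open>x < a\<close>] by blast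
    obtain \<theta>2 T2 where 2: "(\<theta>2, T2) \<in> R" "a < \<theta>2" "\<theta>2 < y" using dense[rule_format, OF \<open>a < y\<close>] by blast
    have "\<psi> x \<le> T1" using upper[OF 1(1)] 1 by simp
    also have "T1 < T2" using mono[rule_format, OF 1(1) 2(1)] 1 2 by simp
    also have "T2 \<le> \<psi> y" using lower[OF 2(1)] 2 by simp
    finally show ?thesis .
  qed
  then have "strict_mono \<psi>" by (simp add: strict_mono_def)
  moreover have "\<psi> (x + p) = \<psi> x + p" for x
  proof (rule antisym)
    have "T \<le> \<psi> x + p" if T: "T \<in> L (x + p)" for T
    proof -
      obtain \<theta> where "\<theta> \<le> x + p" "(\<theta>, T) \<in> R" using T by (auto simp: L_def)
      then have "(\<theta> - p, T - p) \<in> R" "\<theta> - p \<le> x" using shift[rule_format, of "\<theta> - p" "T - p"] by auto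
      then show ?thesis using lower by fastforce
    qed
    then show "\<psi> (x + p) \<le> \<psi> x + p" unfolding \<psi>_def[of "x + p"] using ne by (intro cSup_least) auto
    have "T \<le> \<psi> (x + p) - p" if T: "T \<in> L x" for T
    proof -
      obtain \<theta> where "\<theta> \<le> x" "(\<theta>, T) \<in> R" using T by (auto simp: L_def)
      then have "(\<theta> + p, T + p) \<in> R" "\<theta> + p \<le> x + p" using shift[rule_format, of \<theta> T] by auto
      then show ?thesis using lower by fastforce
    qed
    then have "\<psi> x \<le> \<psi> (x + p) - p" unfolding \<psi>_def[of x] using ne by (intro cSup_least) auto
    then show "\<psi> x + p \<le> \<psi> (x + p)" by simp
  qed
  ultimately show thesis using val that by blast
qed

lemma cdet_Arg: "cdet z w = norm z * norm w * sin (Arg w - Arg z)"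
proof -
  have "cdet (rcis (norm z) (Arg z)) (rcis (norm w) (Arg w)) = norm z * norm w * sin (Arg w - Arg z)"
    by (simp add: cdet_def rcis_def sin_diff algebra_simps)
  then show ?thesis by (simp add: rcis_cmod_Arg)
qed

lemma Arg_upper: "upper u \<Longrightarrow> 0 \<le> Arg u \<and> Arg u < pi"
  using Arg_lt_pi[of u] Arg_eq_0_iff[of u] complex_is_Real_iff[of u]
  by (cases "Im u = 0") (simp_all add: upper_def)

lemma Arg_less_iff:
  assumes "upper u" "upper w"
  shows "Arg u < Arg w \<longleftrightarrow> cdet u w > 0" "Arg u = Arg w \<longleftrightarrow> cdet u w = 0"
proof -
  define x where "x = Arg w - Arg u"
  have x: "- pi < x" "x < pi" using Arg_upper[OF assms(1)] Arg_upper[OF assms(2)] by (auto simp: x_def)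
  have "u \<noteq> 0" "w \<noteq> 0" using assms by (auto simp: upper_def)
  then have nz: "norm u * norm w > 0" by simp
  have s: "sin x > 0" if "x > 0" using sin_gt_zero[OF that x(2)] .
  have s': "sin x < 0" if "x < 0" using sin_gt_zero[of "- x"] that x by simp
  have "cdet u w > 0 \<longleftrightarrow> sin x > 0" "cdet u w = 0 \<longleftrightarrow> sin x = 0"
    unfolding cdet_Arg x_def[symmetric] using nz by (metis zero_less_mult_pos mult_pos_pos, metis less_irrefl mult_eq_0_iff)
  moreover have "sin x > 0 \<longleftrightarrow> x > 0" "sin x = 0 \<longleftrightarrow> x = 0"
    using s s' by (smt (verit) sin_zero)+
  ultimately show "Arg u < Arg w \<longleftrightarrow> cdet u w > 0" "Arg u = Arg w \<longleftrightarrow> cdet u w = 0"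
    by (auto simp: x_def)
qed

lemma unimodular_extend:
  fixes h k :: int
  assumes "coprime h k"
  obtains v where "unimodular (of_int k + of_int h * \<i>) v"
proof -
  obtain x y where "x * k + y * h = gcd k h" using bezout_int by blast
  then have "x * k + y * h = 1" using assms by (simp add: coprime_commute)
  then have "real_of_int (x * k + y * h) = 1" by simp
  then have "cdet (of_int k + of_int h * \<i>) (of_int (- y) + of_int x * \<i>) = 1"
    by (simp add: cdet_def algebra_simps)
  then have "unimodular (of_int k + of_int h * \<i>) (of_int (- y) + of_int x * \<i>)"
    unfolding unimodular_def by (intro conjI gauss_closed)
  then show thesis by (rule that)
qed

text \<open>Rounding a large multiple of a unit vector to the lattice and dividing by the greatest
  common divisor gives a primitive vector of nearly the same argument, which extends to a
  basis.\<close>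

lemma unimodular_args_dense:
  assumes "a < b"
  shows "\<exists>u v. \<exists>k::int. unimodular u v \<and> upper u \<and> a < Arg u + pi * k \<and> Arg u + pi * k < b"
proof -
  \<comment> \<open>Away from multiples of pi the direction lies off the real axis, where
    \<open>Arg\<close> is continuous.\<close>
  obtain c where c: "c \<in> {a<..<b}" "c \<notin> range (\<lambda>k::int. pi * k)"
    using real_interval_avoid_countable_set[OF assms, of "range (\<lambda>k::int. pi * k)"] by auto
  define k where "k = \<lfloor>c / pi\<rfloor>"
  define \<theta> where "\<theta> = c - pi * k"
  have "of_int k \<le> c / pi" "c / pi < of_int k + 1" unfolding k_def by linarith+
  then have "0 \<le> \<theta>" "\<theta> < pi" by (auto simp: \<theta>_def field_simps)
  moreover have "\<theta> \<noteq> 0" using c(2) by (auto simp: \<theta>_def)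
  ultimately have \<theta>: "0 < \<theta>" "\<theta> < pi" by auto
  define z where "z = cis \<theta>"
  have Imz: "Im z > 0" using sin_gt_zero[OF \<theta>] by (simp add: z_def)
  have Az: "Arg z = \<theta>" unfolding z_def using \<theta> by (intro cis_Arg_unique) (auto simp: sgn_cis)
  have "z \<notin> \<real>\<^sub>\<le>\<^sub>0" using Imz by (auto simp: complex_nonpos_Reals_iff)
  then have cont: "continuous (at z) Arg" by (rule continuous_at_Arg)
  define e where "e = Min {\<theta>, pi - \<theta>, c - a, b - c}"
  have e: "e > 0" "e \<le> \<theta>" "e \<le> pi - \<theta>" "e \<le> c - a" "e \<le> b - c" using \<theta> c by (auto simp: e_def)
  obtain d where d: "d > 0" "\<And>w. dist w z < d \<Longrightarrow> dist (Arg w) (Arg z) < e"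
    using cont e(1) unfolding continuous_at_eps_delta by blast
  obtain n :: nat where n: "2 / d < real n" using reals_Archimedean2 by blast
  have n0: "real n > 0" using n d by (smt (verit) divide_pos_pos)
  define u where "u = of_int \<lfloor>real n * Re z\<rfloor> + of_int \<lfloor>real n * Im z\<rfloor> * \<i>"
  define w where "w = of_real (1 / n) * u"
  have "\<bar>Re w - Re z\<bar> \<le> 1 / n" "\<bar>Im w - Im z\<bar> \<le> 1 / n"
  proof -
    have "\<bar>\<lfloor>real n * t\<rfloor> / n - t\<bar> \<le> 1 / n" for t
    proof -
      have "\<bar>\<lfloor>real n * t\<rfloor> - real n * t\<bar> \<le> 1" by linarith
      then have "\<bar>(\<lfloor>real n * t\<rfloor> - real n * t) / n\<bar> \<le> 1 / n" using n0 by (simp add: divide_right_mono)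
      then show ?thesis using n0 by (simp add: diff_divide_distrib)
    qed
    from this[of "Re z"] this[of "Im z"] show "\<bar>Re w - Re z\<bar> \<le> 1 / n" "\<bar>Im w - Im z\<bar> \<le> 1 / n"
      by (simp_all add: w_def u_def)
  qed
  then have "norm (w - z) \<le> 2 / n" using cmod_le[of "w - z"] by simp
  also have "\<dots> < d" using n d n0 by (simp add: field_simps)
  finally have "dist (Arg w) (Arg z) < e" using d(2) by (simp add: dist_norm)
  moreover have "Arg w = Arg u" unfolding w_def using n0 by (intro Arg_times_of_real) simp
  ultimately have A: "\<bar>Arg u - \<theta>\<bar> < e" by (simp add: Az dist_real_def)
  then have "0 < Arg u" "Arg u < pi" using e by linarith+
  define x y where "x = \<lfloor>real n * Re z\<rfloor>" and "y = \<lfloor>real n * Im z\<rfloor>"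
  have "Im u > 0" using \<open>0 < Arg u\<close> \<open>Arg u < pi\<close> Arg_lt_pi by blast
  moreover have "Im u = of_int y" by (simp add: u_def y_def)
  ultimately have nz: "x \<noteq> 0 \<or> y \<noteq> 0" by auto
  then obtain x' y' where xy: "x = x' * gcd x y" "y = y' * gcd x y" "coprime x' y'"
    by (metis gcd_coprime_exists gcd_eq_0_iff)
  define p where "p = of_int x' + of_int y' * \<i>"
  obtain q where q: "unimodular p q" unfolding p_def
    using unimodular_extend xy(3) by (metis coprime_commute)
  have "u = of_real (of_int (gcd x y)) * p"
    unfolding u_def x_def[symmetric] y_def[symmetric] p_def by (subst (1) xy(1), subst (2) xy(2)) (simp add: algebra_simps)
  moreover have "of_int (gcd x y) > (0 :: real)" using nz by simp
  ultimately have Ap: "Arg p = Arg u" by (metis Arg_times_of_real)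
  then have "upper p" using \<open>0 < Arg u\<close> \<open>Arg u < pi\<close> Arg_lt_pi[of p] by (simp add: upper_def)
  moreover have "a < Arg p + pi * k" "Arg p + pi * k < b" unfolding Ap using A e by (auto simp: \<theta>_def)
  ultimately show ?thesis using q by blast
qed

lemma cis_eqD:
  assumes "cis x = cis y"
  obtains n :: int where "x = y + 2 * pi * n"
  using assms sin_cos_eq_iff[of x y] by (auto simp: complex_eq_iff)

lemma cis_add_pi_int: "cis (x + 2 * pi * of_int n) = cis x"
  using sin_cos_eq_iff[of "x + 2 * pi * of_int n" x] by (auto simp: complex_eq_iff)

text \<open>The graph of arguments over the upper half plane is increasing, and repeating it with
  period pi keeps it so. Oddness of \<open>image_dir\<close> identifies the shift by pi with the
  passage from \<open>u\<close> to \<open>- u\<close>.\<close>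

lemma image_lift:
  "\<exists>\<psi> :: real \<Rightarrow> real. strict_mono \<psi> \<and> (\<forall>x. \<psi> (x + pi) = \<psi> x + pi) \<and>
    (\<forall>u v \<theta>. unimodular u v \<longrightarrow> cis \<theta> = sgn u \<longrightarrow> cis (\<psi> \<theta>) = image_dir s u)"
proof -
  define S where "S = image_dir s"
  define G where "G = {u. \<exists>v. unimodular u v}"
  have G: "u \<in> gauss" "u \<noteq> 0" if "u \<in> G" for u using that unimodularD(1,5) unfolding G_def by blast+
  define R where "R = {(Arg u + pi * of_int k, Arg (S u) + pi * of_int k) | u k. u \<in> G \<and> upper u}"
  have up: "upper (S u)" if "u \<in> G" "upper u" for u
    using image_dir_upper[OF G(1)[OF that(1)] that(2), of s] by (auto simp: upper_def S_def)
  have Arg_mono: "Arg (S u) < Arg (S w)" if h: "u \<in> G" "upper u" "w \<in> G" "upper w" "Arg u < Arg w" for u w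
    using image_dir_mono_upper[OF G(1)[OF h(1)] h(2) G(1)[OF h(3)] h(4), of s] Arg_less_iff[OF h(2,4)] h(5)
      Arg_less_iff[OF up[OF h(1,2)] up[OF h(3,4)]] by (simp add: S_def)
  have Arg_eq: "u = w" if h: "u \<in> G" "upper u" "w \<in> G" "upper w" "Arg u = Arg w" for u w
  proof -
    have "pt u = pt w" using pt_eq_iff[of u w] Arg_less_iff(2)[OF h(2,4)] G h by blast
    then have "w = u \<or> w = - u" using pt_eq_unimodular h(1,3) unfolding G_def by blast
    then show ?thesis using upper_minus[of u] G(2)[OF h(1)] h by auto
  qed
  \<comment> \<open>With arguments in \<open>[0, pi)\<close>, the sums \<open>a + pi * k\<close> are
    ordered lexicographically, first by \<open>k\<close>.\<close>
  have period: "k = m \<and> a \<le> b \<or> k < m" if "a + pi * of_int k \<le> b + pi * of_int m" "0 \<le> a" "a < pi" "0 \<le> b" "b < pi"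
    for a b :: real and k m :: int
  proof (rule ccontr)
    assume "\<not> ?thesis"
    then have "k = m \<and> b < a \<or> of_int (m + 1) \<le> (of_int k :: real)" by (simp only: of_int_le_iff) linarith
    then show False
    proof
      assume "of_int (m + 1) \<le> (of_int k :: real)"
      then have "pi * (of_int m + 1) \<le> pi * of_int k" by (intro mult_left_mono) auto
      then show False using that by (simp add: distrib_left)
    qed (use that in auto)
  qed
  have mono: "T < T'" if h: "(\<theta>, T) \<in> R" "(\<theta>', T') \<in> R" "\<theta> < \<theta>'" for \<theta> \<theta>' T T'
  proof -
    obtain u k where u: "u \<in> G" "upper u" "\<theta> = Arg u + pi * of_int k" "T = Arg (S u) + pi * of_int k"
      using h(1) by (auto simp: R_def)
    obtain w m where w: "w \<in> G" "upper w" "\<theta>' = Arg w + pi * of_int m" "T' = Arg (S w) + pi * of_int m"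
      using h(2) by (auto simp: R_def)
    have "k = m \<and> Arg u < Arg w \<or> k < m"
      using period[of "Arg u" k "Arg w" m] Arg_upper[OF u(2)] Arg_upper[OF w(2)] h(3) u w by force
    then show ?thesis
    proof
      assume "k = m \<and> Arg u < Arg w"
      then show ?thesis using Arg_mono[of u w] u w by simp
    next
      assume "k < m"
      then have "of_int (k + 1) \<le> (of_int m :: real)" by (simp only: of_int_le_iff)
      then have "pi * (of_int k + 1) \<le> pi * of_int m" by (intro mult_left_mono) auto
      then show ?thesis using Arg_upper[OF up[OF u(1,2)]] Arg_upper[OF up[OF w(1,2)]] u w
        by (simp add: distrib_left)
    qed
  qed
  have single: "T = T'" if h: "(\<theta>, T) \<in> R" "(\<theta>, T') \<in> R" for \<theta> T T'
  proof -
    obtain u k where u: "u \<in> G" "upper u" "\<theta> = Arg u + pi * of_int k" "T = Arg (S u) + pi * of_int k"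
      using h(1) by (auto simp: R_def)
    obtain w m where w: "w \<in> G" "upper w" "\<theta> = Arg w + pi * of_int m" "T' = Arg (S w) + pi * of_int m"
      using h(2) by (auto simp: R_def)
    have "k = m \<and> Arg u \<le> Arg w \<or> k < m" "m = k \<and> Arg w \<le> Arg u \<or> m < k"
      using period[of "Arg u" k "Arg w" m] period[of "Arg w" m "Arg u" k]
        Arg_upper[OF u(2)] Arg_upper[OF w(2)] u w by force+
    then have "k = m" "Arg u = Arg w" by linarith+
    then show ?thesis using Arg_eq[of u w] u w by simp
  qed
  have fwd: "(\<theta> + pi * of_int n, T + pi * of_int n) \<in> R" if h: "(\<theta>, T) \<in> R" for \<theta> T n
  proof -
    obtain u k where u: "u \<in> G" "upper u" "\<theta> = Arg u + pi * of_int k" "T = Arg (S u) + pi * of_int k"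
      using h by (auto simp: R_def)
    then have "\<theta> + pi * of_int n = Arg u + pi * of_int (k + n)" "T + pi * of_int n = Arg (S u) + pi * of_int (k + n)"
      by (simp_all add: distrib_left)
    then show ?thesis unfolding R_def using u(1,2) by blast
  qed
  have shift: "(\<theta>, T) \<in> R \<longleftrightarrow> (\<theta> + pi, T + pi) \<in> R" for \<theta> T
    using fwd[of \<theta> T 1] fwd[of "\<theta> + pi" "T + pi" "-1"] by auto
  have dense: "\<exists>\<theta> T. (\<theta>, T) \<in> R \<and> a < \<theta> \<and> \<theta> < b" if "a < b" for a b
    using unimodular_args_dense[OF that] unfolding R_def G_def by blast
  obtain \<psi> where \<psi>: "strict_mono \<psi>" "\<And>x. \<psi> (x + pi) = \<psi> x + pi" "\<And>\<theta> T. (\<theta>, T) \<in> R \<Longrightarrow> \<psi> \<theta> = T"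
  proof (rule monotone_lift[of R pi])
    show "\<forall>\<theta> \<theta>' T T'. (\<theta>, T) \<in> R \<longrightarrow> (\<theta>', T') \<in> R \<longrightarrow> \<theta> < \<theta>' \<longrightarrow> T < T'" using mono by blast
    show "\<forall>\<theta> T T'. (\<theta>, T) \<in> R \<longrightarrow> (\<theta>, T') \<in> R \<longrightarrow> T = T'" using single by blast
  qed (use shift dense in auto)
  have upper_case: "cis (\<psi> \<theta>) = S u" if "u \<in> G" "upper u" "cis \<theta> = sgn u" for u \<theta>
  proof -
    have nz: "u \<noteq> 0" using that(2) by (auto simp: upper_def)
    have "cis \<theta> = cis (Arg u)" using that(3) cis_Arg[OF nz] by simp
    then obtain n :: int where "\<theta> = Arg u + 2 * pi * n" by (rule cis_eqD)
    then have "\<theta> = Arg u + pi * of_int (2 * n)" by simp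
    then have "(\<theta>, Arg (S u) + pi * of_int (2 * n)) \<in> R" unfolding R_def using that by blast
    then have "\<psi> \<theta> = Arg (S u) + 2 * pi * of_int n" using \<psi>(3) by simp
    then have "cis (\<psi> \<theta>) = cis (Arg (S u))" by (simp add: cis_add_pi_int)
    moreover have "norm (S u) = 1" using norm_image_dir[OF G[OF that(1)]] by (simp add: S_def)
    moreover then have "cis (Arg (S u)) = sgn (S u)" by (intro cis_Arg) auto
    ultimately show ?thesis by (simp add: sgn_eq)
  qed
  have "cis (\<psi> \<theta>) = image_dir s u" if h: "unimodular u v" "cis \<theta> = sgn u" for u v \<theta>
  proof (cases "upper u")
    case True then show ?thesis using upper_case[of u \<theta>] h by (auto simp: S_def G_def)
  next
    case False
    have nz: "u \<noteq> 0" using unimodularD(5)[OF h(1)] .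
    have "unimodular (- u) (- v)" using h(1) by simp
    then have mG: "- u \<in> G" unfolding G_def by blast
    have "cis (\<theta> + pi) = sgn (- u)" using h(2) by (simp add: sgn_minus flip: cis_mult)
    then have "cis (\<psi> (\<theta> + pi)) = S (- u)" using upper_case[OF mG] False upper_minus[OF nz] by simp
    then have "- cis (\<psi> \<theta>) = - S u" using image_dir_minus[OF nz] \<psi>(2) by (simp add: S_def flip: cis_mult)
    then show ?thesis by (simp add: S_def)
  qed
  then show ?thesis using \<psi>(1,2) by blast
qed

section \<open>Distortion in the coordinate of a fan\<close>

text \<open>
  The distance between the images of \<open>z\<close> and \<open>w\<close> in an affine coordinate that sends the image of
  \<open>u\<close> to infinity.
\<close>

definition fan_dist :: "(complex \<Rightarrow> complex) \<Rightarrow> complex \<Rightarrow> complex \<Rightarrow> complex \<Rightarrow> real" where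
  "fan_dist W u z w = cdet (W z) (W w) / (cdet (W u) (W z) * cdet (W u) (W w))"

lemma cdet_pluecker: "cdet x v * cdet u y - cdet y v * cdet u x = cdet x y * cdet u v"
  by (simp add: cdet_def algebra_simps)

lemma fan_dist_diff:
  assumes "cdet (W u) (W v) \<noteq> 0" "cdet (W u) (W x) \<noteq> 0" "cdet (W u) (W y) \<noteq> 0"
  shows "fan_dist W u x v - fan_dist W u y v = fan_dist W u x y"
proof -
  have "fan_dist W u x v - fan_dist W u y v =
     (cdet (W x) (W v) * cdet (W u) (W y) - cdet (W y) (W v) * cdet (W u) (W x)) /
     (cdet (W u) (W x) * cdet (W u) (W v) * cdet (W u) (W y))"
    using assms by (simp add: fan_dist_def field_simps)
  then show ?thesis using assms unfolding cdet_pluecker by (simp add: fan_dist_def)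
qed

lemma sum_int_increments:
  fixes F :: "int \<Rightarrow> real"
  assumes "\<And>k. F (k + 1) - F k \<ge> c" "m \<le> n"
  shows "F n - F m \<ge> (n - m) * c"
  using assms(2)
proof (induction n rule: int_ge_induct)
  case (step i)
  then show ?case using assms(1)[of i] by (simp add: algebra_simps)
qed simp

lemma sum_int_increments_le:
  fixes F :: "int \<Rightarrow> real"
  assumes "\<And>k. F (k + 1) - F k \<le> c" "m \<le> n"
  shows "F n - F m \<le> (n - m) * c"
  using sum_int_increments[where F = "\<lambda>k. - F k" and c = "- c" and m = m and n = n] assms
  by (simp add: algebra_simps)

text \<open>
  The points \<open>1/6\<close>, \<open>1/3\<close>, \<open>1/2\<close> of a unit gap belong to the fan of its endpoint \<open>0\<close>, where they
  have the coordinates 6, 3, 2; \<open>A\<close> is the coordinate of the images in that fan.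
\<close>

lemma reciprocal_sixths:
  fixes A :: "int \<Rightarrow> real"
  assumes K: "K \<ge> 1" and \<kappa>: "\<kappa> > 0" and A0: "A 0 = 0" and A1: "A 1 > 0"
    and lo: "\<And>k. A (k + 1) - A k \<ge> A 1 / K" and hi: "\<And>k. A (k + 1) - A k \<le> K * A 1"
  shows "\<kappa> / A 6 \<ge> (\<kappa> / A 1) / (18 * K ^ 3)"
    "\<kappa> / A 3 - \<kappa> / A 6 \<ge> (\<kappa> / A 1) / (18 * K ^ 3)"
    "\<kappa> / A 2 - \<kappa> / A 3 \<ge> (\<kappa> / A 1) / (18 * K ^ 3)"
proof -
  define a where "a = A 1"
  have a: "a > 0" using A1 by (simp add: a_def)
  have K3: "1 \<le> K ^ 2" "K \<le> K ^ 3" using K by (simp_all add: self_le_power)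
  have up: "A n \<le> n * (K * a)" if "n \<ge> 0" for n :: int
    using sum_int_increments_le[where F = A and c = "K * a" and m = 0 and n = n] hi that A0 by (simp add: a_def)
  have low: "A n - A m \<ge> (n - m) * (a / K)" if "m \<le> n" for m n :: int
    using sum_int_increments[where F = A and c = "a / K" and m = m and n = n] lo that by (simp add: a_def)
  have pos: "A n > 0" if "n \<ge> 1" for n :: int
  proof -
    have "(n - 0) * (a / K) > 0" using that a K by simp
    then show ?thesis using low[of 0 n] that A0 by linarith
  qed
  have aK: "a / K > 0" using a K by simp
  have "\<kappa> / A 6 \<ge> \<kappa> / (6 * (K * a))"
    using up[of 6] pos[of 6] \<kappa> by (intro divide_left_mono) auto
  moreover have "\<kappa> / (6 * (K * a)) \<ge> \<kappa> / (18 * K ^ 3 * a)"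
  proof (intro divide_left_mono)
    have "6 * (K * a) \<le> 18 * (K ^ 3 * a)" using K3 a K by (intro mult_mono) auto
    then show "6 * (K * a) \<le> 18 * K ^ 3 * a" by simp
  qed (use K a \<kappa> in auto)
  moreover have e: "(\<kappa> / A 1) / (18 * K ^ 3) = \<kappa> / (18 * K ^ 3 * a)" by (simp add: a_def mult_ac)
  ultimately show "\<kappa> / A 6 \<ge> (\<kappa> / A 1) / (18 * K ^ 3)" by linarith
  \<comment> \<open>The difference of reciprocals is \<open>(A n - A m) / (A m * A n)\<close>, with
    numerator at least \<open>a / K\<close> and denominator at most
    \<open>18 * (K * a)\<^sup>2\<close>. This explains the power 3 of \<open>K\<close>; 18 is the
    larger of the products of 3, 6 and of 2, 3.\<close>
  have diff: "\<kappa> / A m - \<kappa> / A n \<ge> \<kappa> / (18 * K ^ 3 * a)" if mn: "1 \<le> m" "m < n" "m * n \<le> 18" for m n :: int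
  proof -
    have "A n - A m \<ge> a / K"
    proof -
      have "a / K \<le> (n - m) * (a / K)"
        using mult_right_mono[of 1 "real_of_int (n - m)" "a / K"] mn aK by simp
      then show ?thesis using low[of m n] mn by linarith
    qed
    moreover have "A m * A n \<le> (m * (K * a)) * (n * (K * a))"
      using up[of m] up[of n] pos[of m] pos[of n] mn K a by (intro mult_mono) auto
    moreover have "(m * (K * a)) * (n * (K * a)) \<le> 18 * (K * a)\<^sup>2"
    proof -
      have "real_of_int (m * n) * (K * a)\<^sup>2 \<le> 18 * (K * a)\<^sup>2" using mn by (intro mult_right_mono) (simp_all only: of_int_le_numeral_iff zero_le_power2)
      then show ?thesis by (simp add: power2_eq_square mult_ac)
    qed
    ultimately have "\<kappa> * (a / K) / (18 * (K * a)\<^sup>2) \<le> \<kappa> * (A n - A m) / (A m * A n)"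
      using \<kappa> pos[of m] pos[of n] mn aK by (intro frac_le mult_left_mono) auto
    also have "\<dots> = \<kappa> / A m - \<kappa> / A n" using pos[of m] pos[of n] mn by (simp add: field_simps)
    also have "\<kappa> * (a / K) / (18 * (K * a)\<^sup>2) = \<kappa> / (18 * K ^ 3 * a)"
      using K a by (simp add: power2_eq_square power3_eq_cube)
    finally show ?thesis .
  qed
  show "\<kappa> / A 3 - \<kappa> / A 6 \<ge> (\<kappa> / A 1) / (18 * K ^ 3)" using diff[of 3 6] unfolding e by simp
  show "\<kappa> / A 2 - \<kappa> / A 3 \<ge> (\<kappa> / A 1) / (18 * K ^ 3)" using diff[of 2 3] unfolding e by simp
qed

text \<open>\<open>W\<close> is defined on all directions, so bounds at lattice directions pass to
  the others by monotonicity. The information from the shears enters through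
  \<open>W_gap\<close>.\<close>

locale fan_map =
  fixes W :: "complex \<Rightarrow> complex" and K :: real
  assumes K: "K \<ge> 1"
    and W_pos: "cdet z w > 0 \<Longrightarrow> cdet (W z) (W w) > 0"
    and W_minus: "z \<noteq> 0 \<Longrightarrow> W (- z) = - W z"
    and W_scale: "r > 0 \<Longrightarrow> z \<noteq> 0 \<Longrightarrow> W (of_real r * z) = W z"
    and W_gap: "unimodular u v \<Longrightarrow>
      fan_dist W u (v + of_int (m + 1) * u) (v + of_int m * u)
        \<le> K * fan_dist W u (v + of_int (n + 1) * u) (v + of_int n * u)"
begin

definition coord :: "complex \<Rightarrow> complex \<Rightarrow> real \<Rightarrow> real" where
  "coord u v x = fan_dist W u (of_real x * u + v) v"

lemma cdet_W_u_pos: "unimodular u v \<Longrightarrow> cdet (W u) (W (of_real x * u + v)) > 0"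
  by (rule W_pos) (simp add: cdet_linear unimodularD)

lemma coord_diff:
  assumes "unimodular u v"
  shows "coord u v x - coord u v y = fan_dist W u (of_real x * u + v) (of_real y * u + v)"
  unfolding coord_def using cdet_W_u_pos[OF assms, of 0] cdet_W_u_pos[OF assms, of x] cdet_W_u_pos[OF assms, of y]
  by (intro fan_dist_diff) auto

lemma coord_strict_mono:
  assumes "unimodular u v" "x < y"
  shows "coord u v x < coord u v y"
proof -
  have "cdet (of_real y * u + v) (of_real x * u + v) > 0"
    using assms unimodularD[OF assms(1)] by (simp add: cdet_linear)
  then have "fan_dist W u (of_real y * u + v) (of_real x * u + v) > 0"
    unfolding fan_dist_def using W_pos cdet_W_u_pos[OF assms(1)] by simp
  then show ?thesis using coord_diff[OF assms(1), of y x] by simp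
qed

lemma coord_mono: "unimodular u v \<Longrightarrow> x \<le> y \<Longrightarrow> coord u v x \<le> coord u v y"
  using coord_strict_mono[of u v x y] by (cases "x = y") auto

lemma coord_gap:
  assumes "unimodular u v"
  shows "coord u v (of_int (m + 1)) - coord u v (of_int m)
    \<le> K * (coord u v (of_int (n + 1)) - coord u v (of_int n))"
  using W_gap[OF assms, of m n] unfolding coord_diff[OF assms] by (simp add: add.commute)

text \<open>The change of coordinates between the fans at \<open>u\<close> and at its neighbour \<open>v + n u\<close>.\<close>

lemma coord_reciprocal:
  assumes "unimodular u v" and b: "b = v + of_int n * u" and "\<rho> > 0"
  shows "coord u v (n + 1 / \<rho>) - coord u v n
      = 1 / (cdet (W u) (W b))\<^sup>2 / (coord b (- u) 0 - coord b (- u) (- \<rho>))"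
    and "coord u v n - coord u v (n - 1 / \<rho>)
      = 1 / (cdet (W u) (W b))\<^sup>2 / (coord b (- u) \<rho> - coord b (- u) 0)"
proof -
  have ub: "unimodular u b" using assms by simp
  then have bu: "unimodular b (- u)" by simp
  have nz: "u \<noteq> 0" "b \<noteq> 0" using unimodularD[OF ub] by auto
  have Wu: "W (- u) = - W u" using W_minus nz by simp
  have eb: "of_real (real_of_int n) * u + v = b" by (simp add: b)
  have rb: "of_real (1 / \<rho>) * (of_real \<rho> * b) = b"
    using assms(3) by (simp flip: mult.assoc of_real_mult)
  \<comment> \<open>The common direction: scaled by \<open>1 / \<rho>\<close> it is
    \<open>(n + 1 / \<rho>) * u + v\<close>, and negated it is the direction with coordinate
    \<open>- \<rho>\<close> in the fan of \<open>b\<close> based at \<open>- u\<close>. Hence the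
    same determinants occur in both coordinates.\<close>
  define P where "P = u + of_real \<rho> * b"
  have P: "P \<noteq> 0"
  proof
    assume "P = 0"
    then have "cdet u P = 0" by simp
    then show False using assms(3) unimodularD[OF ub] by (simp add: P_def cdet_linear)
  qed
  have "of_real (n + 1 / \<rho>) * u + v = of_real (1 / \<rho>) * P"
    unfolding P_def distrib_left rb by (simp add: b distrib_right)
  then have WP1: "W (of_real (n + 1 / \<rho>) * u + v) = W P" using W_scale[of "1 / \<rho>" P] assms(3) P by simp
  have "of_real (- \<rho>) * b + - u = - P" by (simp add: P_def)
  then have WP2: "W (of_real (- \<rho>) * b + - u) = - W P" using W_minus[OF P] by simp
  have UP: "cdet (W u) (W P) > 0" using cdet_W_u_pos[OF assms(1)] WP1 by metis
  have BP: "cdet (W b) (W P) < 0" using cdet_W_u_pos[OF bu, of "- \<rho>"] WP2 by simp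
  have UB: "cdet (W u) (W b) > 0" using W_pos unimodularD[OF ub] by simp
  have 1: "coord u v (n + 1 / \<rho>) - coord u v n = (- cdet (W b) (W P)) / (cdet (W u) (W P) * cdet (W u) (W b))"
    unfolding coord_diff[OF assms(1)] fan_dist_def WP1 eb cdet_commute[of "W P" "W b"] ..
  have 2: "coord b (- u) 0 - coord b (- u) (- \<rho>) = cdet (W u) (W P) / ((- cdet (W u) (W b)) * cdet (W b) (W P))"
    unfolding coord_diff[OF bu] fan_dist_def WP2 using cdet_commute[of "W b" "W u"] by (simp add: Wu)
  have gen: "(- y) / (x * z) = 1 / z\<^sup>2 / (x / ((- z) * y))" if "x \<noteq> 0" "y \<noteq> 0" "z \<noteq> 0" for x y z :: real
    using that by (simp add: power2_eq_square)
  show "coord u v (n + 1 / \<rho>) - coord u v n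
      = 1 / (cdet (W u) (W b))\<^sup>2 / (coord b (- u) 0 - coord b (- u) (- \<rho>))"
    unfolding 1 2 by (intro gen) (use UP BP UB in linarith)+
  define Q where "Q = of_real \<rho> * b - u"
  have Q: "Q \<noteq> 0"
  proof
    assume "Q = 0"
    then have "cdet u Q = 0" by simp
    then show False using assms(3) unimodularD[OF ub] by (simp add: Q_def cdet_linear)
  qed
  have "of_real (n - 1 / \<rho>) * u + v = of_real (1 / \<rho>) * Q"
    unfolding Q_def right_diff_distrib rb by (simp add: b left_diff_distrib)
  then have WQ1: "W (of_real (n - 1 / \<rho>) * u + v) = W Q" using W_scale[of "1 / \<rho>" Q] assms(3) Q by simp
  have WQ2: "of_real \<rho> * b + - u = Q" by (simp add: Q_def)
  have UQ: "cdet (W u) (W Q) > 0" using cdet_W_u_pos[OF assms(1)] WQ1 by metis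
  have BQ: "cdet (W b) (W Q) > 0" using cdet_W_u_pos[OF bu, of \<rho>] WQ2 by simp
  have 1: "coord u v n - coord u v (n - 1 / \<rho>) = cdet (W b) (W Q) / (cdet (W u) (W b) * cdet (W u) (W Q))"
    unfolding coord_diff[OF assms(1)] fan_dist_def WQ1 eb ..
  have 2: "coord b (- u) \<rho> - coord b (- u) 0 = cdet (W u) (W Q) / (cdet (W u) (W b) * cdet (W b) (W Q))"
    unfolding coord_diff[OF bu] fan_dist_def WQ2
    using cdet_commute[of "W Q" "W u"] cdet_commute[of "W b" "W u"] by (simp add: Wu mult_ac)
  have gen: "y / (z * x) = 1 / z\<^sup>2 / (x / (z * y))" if "x \<noteq> 0" "y \<noteq> 0" "z \<noteq> 0" for x y z :: real
    using that by (simp add: power2_eq_square)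
  show "coord u v n - coord u v (n - 1 / \<rho>)
      = 1 / (cdet (W u) (W b))\<^sup>2 / (coord b (- u) \<rho> - coord b (- u) 0)"
    unfolding 1 2 by (intro gen) (use UQ BQ UB in linarith)+
qed

lemma coord_sixths_near:
  fixes n :: int
  assumes uv: "unimodular u v"
  defines "G \<equiv> coord u v" and "c \<equiv> 1 / (18 * K ^ 3)"
  shows "G (of_int n + 1/6) - G (of_int n) \<ge> c * (G (of_int n + 1) - G (of_int n))"
    "G (of_int n + 1/3) - G (of_int n + 1/6) \<ge> c * (G (of_int n + 1) - G (of_int n))"
    "G (of_int n + 1/2) - G (of_int n + 1/3) \<ge> c * (G (of_int n + 1) - G (of_int n))"
    "G (of_int n) - G (of_int n - 1/6) \<ge> c * (G (of_int n) - G (of_int n - 1))"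
    "G (of_int n - 1/6) - G (of_int n - 1/3) \<ge> c * (G (of_int n) - G (of_int n - 1))"
    "G (of_int n - 1/3) - G (of_int n - 1/2) \<ge> c * (G (of_int n) - G (of_int n - 1))"
proof -
  define b where "b = v + of_int n * u"
  have ub: "unimodular u b" using uv by (simp add: b_def)
  then have bu: "unimodular b (- u)" by simp
  define H where "H = coord b (- u)"
  define \<kappa> where "\<kappa> = 1 / (cdet (W u) (W b))\<^sup>2"
  have "cdet (W u) (W b) > 0" using W_pos unimodularD[OF ub] by simp
  then have \<kappa>: "\<kappa> > 0" by (simp add: \<kappa>_def)
  note rec = coord_reciprocal[OF uv b_def, folded G_def H_def \<kappa>_def]
  have gap: "H (of_int (k + 1)) - H (of_int k) \<le> K * (H (of_int (m + 1)) - H (of_int m))" for k m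
    unfolding H_def by (rule coord_gap[OF bu])
  have K0: "K > 0" using K by simp
  \<comment> \<open>Points to the right of \<open>n\<close> have negative coordinates in the fan of
    \<open>b\<close>, so \<open>A\<close> measures leftwards from 0 there and \<open>B\<close>
    rightwards.\<close>
  define A where "A k = H 0 - H (of_int (- k))" for k :: int
  define B where "B k = H (of_int k) - H 0" for k :: int
  have A0: "A 0 = 0" by (simp add: A_def)
  have A1: "A 1 > 0" using coord_strict_mono[OF bu, of "-1" 0] by (simp add: A_def H_def)
  have Alo: "A (k + 1) - A k \<ge> A 1 / K" for k
      using gap[of "-1" "- (k + 1)"] K0 by (simp add: A_def field_simps)
  have Ahi: "A (k + 1) - A k \<le> K * A 1" for k
      using gap[of "- (k + 1)" "-1"] by (simp add: A_def)
  note A = reciprocal_sixths[OF K \<kappa> A0 A1 Alo Ahi]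
  have B0: "B 0 = 0" by (simp add: B_def)
  have B1: "B 1 > 0" using coord_strict_mono[OF bu, of 0 1] by (simp add: B_def H_def)
  have Blo: "B (k + 1) - B k \<ge> B 1 / K" for k
      using gap[of 0 k] K0 by (simp add: B_def field_simps)
  have Bhi: "B (k + 1) - B k \<le> K * B 1" for k
      using gap[of k 0] by (simp add: B_def)
  note B = reciprocal_sixths[OF K \<kappa> B0 B1 Blo Bhi]
  have r: "G (of_int n + 1) - G (of_int n) = \<kappa> / A 1" "G (of_int n + 1/2) - G (of_int n) = \<kappa> / A 2"
    "G (of_int n + 1/3) - G (of_int n) = \<kappa> / A 3" "G (of_int n + 1/6) - G (of_int n) = \<kappa> / A 6"
    "G (of_int n) - G (of_int n - 1) = \<kappa> / B 1" "G (of_int n) - G (of_int n - 1/2) = \<kappa> / B 2"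
    "G (of_int n) - G (of_int n - 1/3) = \<kappa> / B 3" "G (of_int n) - G (of_int n - 1/6) = \<kappa> / B 6"
    using rec(1)[of 1] rec(1)[of 2] rec(1)[of 3] rec(1)[of 6]
      rec(2)[of 1] rec(2)[of 2] rec(2)[of 3] rec(2)[of 6] by (simp_all add: A_def B_def)
  have c: "c * x = x / (18 * K ^ 3)" for x by (simp add: c_def)
  show "G (of_int n + 1/6) - G (of_int n) \<ge> c * (G (of_int n + 1) - G (of_int n))"
    "G (of_int n + 1/3) - G (of_int n + 1/6) \<ge> c * (G (of_int n + 1) - G (of_int n))"
    "G (of_int n + 1/2) - G (of_int n + 1/3) \<ge> c * (G (of_int n + 1) - G (of_int n))"
    "G (of_int n) - G (of_int n - 1/6) \<ge> c * (G (of_int n) - G (of_int n - 1))"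
    "G (of_int n - 1/6) - G (of_int n - 1/3) \<ge> c * (G (of_int n) - G (of_int n - 1))"
    "G (of_int n - 1/3) - G (of_int n - 1/2) \<ge> c * (G (of_int n) - G (of_int n - 1))"
    unfolding c r(1) r(5) using r A B by - linarith+
qed

text \<open>Each unit interval is covered from both ends: the lower three sixths by the bounds at
  \<open>n\<close>, the upper three by those at \<open>n + 1\<close>. The additional factor
  \<open>K\<close> compares the gap at \<open>n\<close> with the reference gap from 0 to 1.\<close>

lemma coord_sixth:
  assumes uv: "unimodular u v"
  shows "coord u v (of_int (k + 1) / 6) - coord u v (of_int k / 6)
    \<ge> (coord u v 1 - coord u v 0) / (18 * K ^ 4)"
proof -
  define n where "n = k div 6"
  define r where "r = k mod 6"
  have k: "k = 6 * n + r" by (simp add: n_def r_def)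
  have r: "r \<in> {0, 1, 2, 3, 4, 5}" unfolding r_def using pos_mod_bound[of 6 k] pos_mod_sign[of 6 k] by auto
  define G where "G = coord u v"
  have K0: "K > 0" using K by simp
  have "G 1 - G 0 \<le> K * (G (of_int n + 1) - G n)"
    using coord_gap[OF uv, of 0 n] by (simp add: G_def)
  then have "(G 1 - G 0) / K \<le> G (of_int n + 1) - G n" using K0 by (simp add: divide_le_eq mult.commute)
  then have "1 / (18 * K ^ 3) * ((G 1 - G 0) / K) \<le> 1 / (18 * K ^ 3) * (G (of_int n + 1) - G n)"
    using K0 by (intro mult_left_mono) auto
  then have g: "(G 1 - G 0) / (18 * K ^ 4) \<le> 1 / (18 * K ^ 3) * (G (of_int n + 1) - G n)"
    by (simp add: power4_eq_xxxx power3_eq_cube mult_ac)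
  note S = coord_sixths_near[OF uv, of n, folded G_def] and T = coord_sixths_near[OF uv, of "n + 1", folded G_def]
  have e: "of_int k / 6 = n + of_int r / (6::real)" "of_int (k + 1) / 6 = n + of_int (r + 1) / (6::real)"
    by (simp_all add: k add_divide_distrib)
  have "(G 1 - G 0) / (18 * K ^ 4) \<le> G (n + of_int (r + 1) / 6) - G (n + of_int r / 6)"
    using r
  proof (elim insertE)
    assume r: "r = 0" show ?thesis using S(1) g by (simp add: r)
  next
    assume r: "r = 1" show ?thesis using S(2) g by (simp add: r)
  next
    assume r: "r = 2" show ?thesis using S(3) g by (simp add: r)
  next
    assume r: "r = 3" show ?thesis using T(6) g by (simp add: r add.commute)
  next
    assume r: "r = 4" show ?thesis using T(5) g by (simp add: r add.commute)
  next
    assume r: "r = 5" show ?thesis using T(4) g by (simp add: r add.commute)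
  qed simp
  then show ?thesis unfolding e G_def .
qed

text \<open>An interval of length at least 1/3 contains a full cell of the grid of sixths, which
  gives the lower bound. For the upper bound, rounding outwards to integers adds at most 2, and
  \<open>2 \<le> 6 * (x - y)\<close>, whence the factor 7.\<close>

lemma coord_bilipschitz:
  assumes uv: "unimodular u v" and L: "x - y \<ge> 1/3"
  defines "g \<equiv> coord u v 1 - coord u v 0"
  shows "coord u v x - coord u v y \<ge> (x - y) * (g / (18 * K ^ 4))"
    "coord u v x - coord u v y \<le> (x - y) * (7 * K * g)"
proof -
  have g: "g > 0" using coord_strict_mono[OF uv, of 0 1] by (simp add: g_def)
  have K0: "K > 0" using K by simp
  define c where "c = g / (18 * K ^ 4)"
  have c: "c > 0" using g K0 by (simp add: c_def)
  define k0 where "k0 = \<lceil>6 * y\<rceil>"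
  define k1 where "k1 = \<lfloor>6 * x\<rfloor>"
  have k: "real_of_int k1 - k0 > 6 * (x - y) - 2"
    using floor_correct[of "6 * x"] ceiling_correct[of "6 * y"] unfolding k0_def k1_def right_diff_distrib by linarith
  then have "real_of_int k1 - k0 > 0" using L unfolding right_diff_distrib by linarith
  then have "k1 - k0 > 0" by linarith
  then have k': "real_of_int k1 - k0 \<ge> 1" by linarith
  have "coord u v (k1 / 6) - coord u v (k0 / 6) \<ge> (k1 - k0) * c"
    using sum_int_increments[where F = "\<lambda>k. coord u v (of_int k / 6)" and c = c and m = k0 and n = k1] coord_sixth[OF uv] \<open>k1 - k0 > 0\<close>
    by (simp add: c_def g_def)
  moreover have "coord u v (k1 / 6) \<le> coord u v x" "coord u v y \<le> coord u v (k0 / 6)"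
    by (rule coord_mono[OF uv]; unfold k0_def k1_def; linarith)+
  \<comment> \<open>If \<open>x - y \<le> 1\<close>, one full cell suffices; otherwise
    \<open>6 * (x - y) - 2\<close> exceeds \<open>x - y\<close>.\<close>
  moreover have "(k1 - k0) * c \<ge> (x - y) * c"
  proof (intro mult_right_mono)
    show "x - y \<le> real_of_int (k1 - k0)" using k k' unfolding right_diff_distrib of_int_diff
      by (cases "x - y \<le> 1") linarith+
  qed (use c in simp)
  ultimately show "coord u v x - coord u v y \<ge> (x - y) * (g / (18 * K ^ 4))" unfolding c_def by linarith
  define m0 where "m0 = \<lfloor>y\<rfloor>"
  define m1 where "m1 = \<lceil>x\<rceil>"
  have gap: "coord u v (of_int (k + 1)) - coord u v (of_int k) \<le> K * g" for k
    using coord_gap[OF uv, of k 0] by (simp add: g_def)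
  have "m0 \<le> m1" unfolding m0_def m1_def using L by linarith
  then have "coord u v m1 - coord u v m0 \<le> (m1 - m0) * (K * g)"
    using sum_int_increments_le[where F = "\<lambda>k. coord u v (of_int k)" and c = "K * g" and m = m0 and n = m1] gap by simp
  moreover have "coord u v x \<le> coord u v m1" "coord u v m0 \<le> coord u v y"
    by (rule coord_mono[OF uv]; unfold m0_def m1_def; linarith)+
  moreover have "(m1 - m0) * (K * g) \<le> (7 * (x - y)) * (K * g)"
  proof (intro mult_right_mono)
    show "real_of_int (m1 - m0) \<le> 7 * (x - y)" unfolding m0_def m1_def right_diff_distrib of_int_diff
      using L floor_correct[of y] ceiling_correct[of x] by linarith
  qed (use K0 g in auto)
  ultimately show "coord u v x - coord u v y \<le> (x - y) * (7 * K * g)" by (simp add: mult_ac)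
qed

text \<open>Every direction not parallel to \<open>u\<close> is a real multiple of some
  \<open>x * u + v\<close>, and absolute values hide the sign of the factor. The number
  \<open>r\<close> is the distance between the two values of \<open>x\<close>.\<close>

lemma fan_dist_bounds:
  assumes uv: "unimodular u v" and z: "cdet u z \<noteq> 0" and w: "cdet u w \<noteq> 0"
  defines "g \<equiv> coord u v 1 - coord u v 0" and "r \<equiv> \<bar>cdet z w\<bar> / (\<bar>cdet u z\<bar> * \<bar>cdet u w\<bar>)"
  assumes r: "r \<ge> 1/3"
  shows "\<bar>fan_dist W u z w\<bar> \<ge> r * (g / (18 * K ^ 4))" "\<bar>fan_dist W u z w\<bar> \<le> r * (7 * K * g)"
proof -
  have un: "cdet u v = 1" using unimodularD[OF uv] by simp
  define x where "x w = cdet w v / cdet u w" for w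
  have dir: "\<bar>cdet y (W w)\<bar> = \<bar>cdet y (W (of_real (x w) * u + v))\<bar>" if "cdet u w \<noteq> 0" for w y
  proof -
    define p where "p = of_real (x w) * u + v"
    have w: "w = of_real (cdet u w) * p"
      using cdet_decompose[OF un, of w] that by (simp add: x_def p_def distrib_left)
    have p: "p \<noteq> 0" using w that by auto
    have "W w = W p \<or> W w = - W p"
    proof (cases "cdet u w > 0")
      case True then show ?thesis using W_scale[OF True p] w by simp
    next
      case False
      then have "- cdet u w > 0" using that by simp
      then have "W (of_real (- cdet u w) * (- p)) = W (- p)" using p by (intro W_scale) auto
      then show ?thesis using w W_minus[OF p] by simp
    qed
    then show ?thesis by (auto simp: p_def)
  qed
  have dir': "\<bar>cdet (W w) y\<bar> = \<bar>cdet (W (of_real (x w) * u + v)) y\<bar>" if "cdet u w \<noteq> 0" for w y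
    using dir[OF that, of y] by (simp add: cdet_commute[of _ y])
  have fd: "\<bar>fan_dist W u z w\<bar> = \<bar>coord u v (x z) - coord u v (x w)\<bar>"
    unfolding coord_diff[OF uv] fan_dist_def abs_divide abs_mult
    using dir[OF z] dir[OF w] dir'[OF z] dir'[OF w] by simp
  have "x z - x w = (cdet z v * cdet u w - cdet w v * cdet u z) / (cdet u z * cdet u w)"
    using z w by (simp add: x_def field_simps)
  then have r': "r = \<bar>x z - x w\<bar>" unfolding cdet_pluecker un by (simp add: r_def abs_mult)
  have *: "\<bar>coord u v a - coord u v b\<bar> \<ge> \<bar>a - b\<bar> * (g / (18 * K ^ 4)) \<and>
    \<bar>coord u v a - coord u v b\<bar> \<le> \<bar>a - b\<bar> * (7 * K * g)" if "\<bar>a - b\<bar> \<ge> 1/3" for a b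
  proof (cases "a > b")
    case True
    then have L: "a - b \<ge> 1/3" and e: "\<bar>a - b\<bar> = a - b"
      "\<bar>coord u v a - coord u v b\<bar> = coord u v a - coord u v b"
      using that coord_strict_mono[OF uv True] by linarith+
    show ?thesis unfolding e using coord_bilipschitz[OF uv L, folded g_def] by blast
  next
    case False
    then have L: "b - a \<ge> 1/3" and e: "\<bar>a - b\<bar> = b - a" using that by linarith+
    then have e': "\<bar>coord u v a - coord u v b\<bar> = coord u v b - coord u v a"
      using coord_strict_mono[OF uv, of a b] by linarith
    show ?thesis unfolding e e' using coord_bilipschitz[OF uv L, folded g_def] by blast
  qed
  show "\<bar>fan_dist W u z w\<bar> \<ge> r * (g / (18 * K ^ 4))" "\<bar>fan_dist W u z w\<bar> \<le> r * (7 * K * g)"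
    using *[of "x z" "x w"] r unfolding fd r' by auto
qed

text \<open>Comparing the upper with the lower bound costs
  \<open>7 * K * (18 * K ^ 4) = 126 * K ^ 5\<close> for each factor, and two factors occur; the
  reference gap cancels. So do the denominators of \<open>fan_dist\<close>, as each point occurs
  once on each side.\<close>

lemma four_point_distortion:
  assumes uv: "unimodular u v"
    and nz: "cdet u a \<noteq> 0" "cdet u b \<noteq> 0" "cdet u c \<noteq> 0" "cdet u d \<noteq> 0"
    and sep: "\<And>x y. (x, y) \<in> {(a, b), (b, c), (c, d), (a, d)} \<Longrightarrow> 3 * \<bar>cdet x y\<bar> \<ge> \<bar>cdet u x\<bar> * \<bar>cdet u y\<bar>"
    and cr: "\<bar>cdet a b\<bar> * \<bar>cdet c d\<bar> = \<bar>cdet b c\<bar> * \<bar>cdet a d\<bar>"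
  shows "\<bar>cdet (W a) (W b)\<bar> * \<bar>cdet (W c) (W d)\<bar>
    \<le> (126 * K ^ 5)\<^sup>2 * (\<bar>cdet (W b) (W c)\<bar> * \<bar>cdet (W a) (W d)\<bar>)"
proof -
  define g where "g = coord u v 1 - coord u v 0"
  define r where "r x y = \<bar>cdet x y\<bar> / (\<bar>cdet u x\<bar> * \<bar>cdet u y\<bar>)" for x y
  define F where "F x y = \<bar>fan_dist W u x y\<bar>" for x y
  have g: "g > 0" using coord_strict_mono[OF uv, of 0 1] by (simp add: g_def)
  have K0: "K > 0" using K by simp
  have r: "r x y \<ge> 1/3" if "(x, y) \<in> {(a, b), (b, c), (c, d), (a, d)}" for x y
  proof -
    have "cdet u x \<noteq> 0" "cdet u y \<noteq> 0" using that nz by auto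
    then have "\<bar>cdet u x\<bar> * \<bar>cdet u y\<bar> > 0" by simp
    then show ?thesis using sep[OF that] unfolding r_def by (simp add: field_simps)
  qed
  have lo: "F x y \<ge> r x y * (g / (18 * K ^ 4))" and hi: "F x y \<le> r x y * (7 * K * g)"
    if xy: "(x, y) \<in> {(a, b), (b, c), (c, d), (a, d)}" for x y
  proof -
    have n: "cdet u x \<noteq> 0" "cdet u y \<noteq> 0" using xy nz by auto
    show "F x y \<ge> r x y * (g / (18 * K ^ 4))" "F x y \<le> r x y * (7 * K * g)"
      using fan_dist_bounds[OF uv n] r[OF xy] unfolding F_def r_def g_def by auto
  qed
  have cr': "r a b * r c d = r b c * r a d" using cr by (simp add: r_def mult_ac)
  have rp: "r x y > 0" if "(x, y) \<in> {(a, b), (b, c), (c, d), (a, d)}" for x y using r[OF that] by linarith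
  have "F a b * F c d \<le> (r a b * (7 * K * g)) * (r c d * (7 * K * g))"
    using hi[of a b] hi[of c d] rp[of a b] g K0 by (intro mult_mono) (auto simp: F_def)
  also have "\<dots> = (r b c * r a d) * (7 * K * g)\<^sup>2"
    unfolding cr'[symmetric] by (simp add: power2_eq_square mult_ac)
  also have "7 * K * g = (126 * K ^ 5) * (g / (18 * K ^ 4))"
    using K0 by (simp add: field_simps power_numeral_reduce)
  also have "(r b c * r a d) * (126 * K ^ 5 * (g / (18 * K ^ 4)))\<^sup>2
      = (126 * K ^ 5)\<^sup>2 * ((r b c * (g / (18 * K ^ 4))) * (r a d * (g / (18 * K ^ 4))))"
    by (simp only: power2_eq_square mult_ac)
  also have "\<dots> \<le> (126 * K ^ 5)\<^sup>2 * (F b c * F a d)"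
    using lo[of b c] lo[of a d] rp[of b c] rp[of a d] g K0
    by (intro mult_left_mono mult_mono) (auto simp: F_def)
  finally have main: "F a b * F c d \<le> (126 * K ^ 5)\<^sup>2 * (F b c * F a d)" .
  have Wnz: "cdet (W u) (W x) \<noteq> 0" if "cdet u x \<noteq> 0" for x
  proof (cases "cdet u x > 0")
    case True then show ?thesis using W_pos by fastforce
  next
    case False
    then have "cdet x u > 0" using that cdet_commute[of x u] by simp
    then show ?thesis using W_pos[of x u] cdet_commute[of "W x" "W u"] by fastforce
  qed
  define q where "q x = \<bar>cdet (W u) (W x)\<bar>" for x
  have q: "q a > 0" "q b > 0" "q c > 0" "q d > 0" using Wnz nz by (auto simp: q_def)
  have F: "F x y = \<bar>cdet (W x) (W y)\<bar> / (q x * q y)" for x y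
    by (simp add: F_def fan_dist_def q_def abs_mult)
  define Q where "Q = q a * q b * q c * q d"
  have Q: "Q > 0" using q by (simp add: Q_def)
  have "F a b * F c d = \<bar>cdet (W a) (W b)\<bar> * \<bar>cdet (W c) (W d)\<bar> / Q"
    "F b c * F a d = \<bar>cdet (W b) (W c)\<bar> * \<bar>cdet (W a) (W d)\<bar> / Q"
    by (simp_all add: F Q_def mult_ac)
  with main have "\<bar>cdet (W a) (W b)\<bar> * \<bar>cdet (W c) (W d)\<bar> / Q
      \<le> (126 * K ^ 5)\<^sup>2 * (\<bar>cdet (W b) (W c)\<bar> * \<bar>cdet (W a) (W d)\<bar>) / Q" by simp
  then show ?thesis using Q by (simp only: divide_le_cancel)
qed

end

section \<open>Comparability of adjacent arcs\<close>

lemma dirichlet_direction: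
  fixes c s r :: real
  assumes cs: "c\<^sup>2 + s\<^sup>2 = 1" "\<bar>s\<bar> \<le> \<bar>c\<bar>" and r: "0 < r" "r \<le> 1/10"
  obtains h k :: int where "coprime h k" "\<bar>c * h - s * k\<bar> \<le> r" "\<bar>c * k + s * h\<bar> \<le> 5/4 / r"
proof -
  have "s\<^sup>2 \<le> c\<^sup>2" using cs(2) by (simp add: abs_le_square_iff)
  then have c2: "c\<^sup>2 \<ge> 1/2" using cs(1) by linarith
  have c: "\<bar>c\<bar> \<ge> 2/3"
  proof (rule ccontr)
    assume "\<not> \<bar>c\<bar> \<ge> 2/3"
    then have "\<bar>c\<bar>\<^sup>2 \<le> (2/3)\<^sup>2" by (intro power_mono) auto
    then show False using c2 by (simp add: power2_eq_square)
  qed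
  have s: "\<bar>s\<bar> \<le> 1"
  proof -
    have "s\<^sup>2 \<le> 1" using cs(1) by (metis le_add_same_cancel2 zero_le_power2)
    then show ?thesis by (simp add: abs_square_le_1)
  qed
  \<comment> \<open>Dirichlet's bound for the slope \<open>s / c\<close> is \<open>1 / N\<close>,
    and its product with \<open>\<bar>c\<bar>\<close> should be at most \<open>r\<close>.\<close>
  define N where "N = nat \<lceil>\<bar>c\<bar> / r\<rceil>"
  have "\<bar>c\<bar> / r > 0" using c r by simp
  then have N0: "N > 0" by (simp add: N_def)
  have N: "\<bar>c\<bar> / r \<le> N" "N \<le> \<bar>c\<bar> / r + 1" using \<open>\<bar>c\<bar> / r > 0\<close> unfolding N_def by linarith+
  obtain h k where hk: "coprime h k" "0 < k" "k \<le> int N" "\<bar>of_int k * (s / c) - of_int h\<bar> < 1 / N"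
    using Dirichlet_approx_coprime[OF N0] by blast
  define \<epsilon> where "\<epsilon> = h - k * (s / c)"
  have \<epsilon>: "\<bar>\<epsilon>\<bar> \<le> 1 / N" using hk(4) unfolding \<epsilon>_def by linarith
  have c0: "c \<noteq> 0" using c by auto
  have "c * h - s * k = c * \<epsilon>" using c0 by (simp add: \<epsilon>_def field_simps)
  then have "\<bar>c * h - s * k\<bar> \<le> \<bar>c\<bar> * (1 / N)" using \<epsilon> by (simp only: abs_mult) (intro mult_left_mono, auto)
  also have "\<dots> \<le> r" using N(1) N0 r by (simp add: field_simps)
  finally have 1: "\<bar>c * h - s * k\<bar> \<le> r" .
  \<comment> \<open>The component along the direction is essentially \<open>k / c\<close>, with
    \<open>\<bar>k / c\<bar>\<close> at most \<open>N / \<bar>c\<bar>\<close>. The total excess over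
    \<open>1 / r\<close> is at most 5/2, which \<open>r \<le> 1/10\<close> bounds by
    \<open>1/4 / r\<close>.\<close>
  have "c * k + s * h = k * ((c\<^sup>2 + s\<^sup>2) / c) + s * \<epsilon>" using c0 by (simp add: \<epsilon>_def field_simps power2_eq_square)
  then have "c * k + s * h = k / c + s * \<epsilon>" using cs by simp
  then have "\<bar>c * k + s * h\<bar> \<le> \<bar>k / c\<bar> + \<bar>s * \<epsilon>\<bar>" by linarith
  also have "\<bar>k / c\<bar> = k / \<bar>c\<bar>" using hk(2) by simp
  also have "\<dots> \<le> (\<bar>c\<bar> / r + 1) / \<bar>c\<bar>"
    using hk(3) N(2) by (intro divide_right_mono) auto
  also have "\<dots> = 1 / r + 1 / \<bar>c\<bar>" using c0 by (simp add: add_divide_distrib)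
  also have "1 / \<bar>c\<bar> \<le> 1 / (2/3)" using c by (intro divide_left_mono) auto
  also have "\<bar>s * \<epsilon>\<bar> \<le> 1 * (1 / N)" unfolding abs_mult using s \<epsilon> by (intro mult_mono) auto
  also have "1 / real N \<le> 1" using N0 by simp
  finally have "\<bar>c * k + s * h\<bar> \<le> 1 / r + 5/2" by simp
  also have "5/2 \<le> 1/4 / r" using r by (simp add: field_simps)
  finally have 2: "\<bar>c * k + s * h\<bar> \<le> 5/4 / r" by simp
  show thesis using that[OF hk(1) 1 2] .
qed

text \<open>Dirichlet's theorem is applied to the slope of the direction or to its inverse,
  whichever is at most 1 in absolute value. The two determinants are the components of
  \<open>u\<close> across and along \<open>cis \<theta>\<close>.\<close>

lemma lattice_vector_near_direction:
  assumes r: "0 < r" "r \<le> 1/10"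
  obtains u v where "unimodular u v" "\<bar>cdet u (cis \<theta>)\<bar> \<le> r" "\<bar>cdet u (cis (\<theta> + pi/2))\<bar> \<le> 5/4 / r"
proof -
  have sq: "(cos \<theta>)\<^sup>2 + (sin \<theta>)\<^sup>2 = 1" "(sin \<theta>)\<^sup>2 + (cos \<theta>)\<^sup>2 = 1" by (simp_all add: add.commute)
  have d: "cdet (of_int k + of_int h * \<i>) (cis \<theta>) = k * sin \<theta> - h * cos \<theta>"
    "cdet (of_int k + of_int h * \<i>) (cis (\<theta> + pi/2)) = k * cos \<theta> + h * sin \<theta>" for h k :: int
    by (simp_all add: cdet_def cos_add sin_add)
  show thesis
  proof (cases "\<bar>sin \<theta>\<bar> \<le> \<bar>cos \<theta>\<bar>")
    case True
    obtain h k where hk: "coprime h k" "\<bar>cos \<theta> * of_int h - sin \<theta> * of_int k\<bar> \<le> r"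
      "\<bar>cos \<theta> * of_int k + sin \<theta> * of_int h\<bar> \<le> 5/4 / r"
      using dirichlet_direction[OF sq(1) True r] by blast
    obtain v where "unimodular (of_int k + of_int h * \<i>) v" using unimodular_extend[OF hk(1)] .
    moreover have "\<bar>k * sin \<theta> - h * cos \<theta>\<bar> \<le> r" "\<bar>k * cos \<theta> + h * sin \<theta>\<bar> \<le> 5/4 / r"
      using hk(2,3) by (simp_all add: abs_le_iff mult.commute)
    ultimately show thesis using that[of "of_int k + of_int h * \<i>" v] unfolding d by blast
  next
    case False
    then have "\<bar>cos \<theta>\<bar> \<le> \<bar>sin \<theta>\<bar>" by simp
    then obtain h k where hk: "coprime h k" "\<bar>sin \<theta> * of_int h - cos \<theta> * of_int k\<bar> \<le> r"
      "\<bar>sin \<theta> * of_int k + cos \<theta> * of_int h\<bar> \<le> 5/4 / r"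
      using dirichlet_direction[OF sq(2) _ r] by blast
    have "coprime k h" using hk(1) by (simp add: coprime_commute)
    then obtain v where "unimodular (of_int h + of_int k * \<i>) v" by (rule unimodular_extend)
    moreover have "\<bar>h * sin \<theta> - k * cos \<theta>\<bar> \<le> r" "\<bar>h * cos \<theta> + k * sin \<theta>\<bar> \<le> 5/4 / r"
      using hk(2,3) by (simp_all add: abs_le_iff mult.commute)
    ultimately show thesis using that[of "of_int h + of_int k * \<i>" v] unfolding d by blast
  qed
qed

section \<open>Generic points and lifts commuting with a half turn of directions\<close>

definition generic :: "real \<Rightarrow> bool" where
  "generic p \<longleftrightarrow> (\<forall>u\<in>gauss. u \<noteq> 0 \<longrightarrow> cdet u (cis p) \<noteq> 0)"

text \<open>The angles of the harmonic configuration around \<open>p\<close>. Generic directions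
  have a finite coordinate in every fan, whichever Farey vertex the approximation selects.\<close>

definition generic_config :: "real \<Rightarrow> real \<Rightarrow> bool" where
  "generic_config p t \<longleftrightarrow> (\<forall>z\<in>{t, 0, - t, pi/2}. generic (p + z))"

lemma countable_nongeneric: "countable {p. \<not> generic p}"
proof -
  have "gauss = (\<lambda>(a, b). Complex a b) ` (\<int> \<times> \<int>)"
    by (auto simp: gauss_def image_iff complex_eq_iff)
  moreover have "countable (\<int> \<times> \<int> :: (real \<times> real) set)" by (intro countable_SIGMA countable_int)
  ultimately have g: "countable gauss" by (metis countable_image)
  have "{p. \<not> generic p} \<subseteq> (\<lambda>(u, n :: int). Arg u + of_int n * pi) ` (gauss \<times> UNIV)"
  proof
    fix p assume "p \<in> {p. \<not> generic p}"
    then obtain u where u: "u \<in> gauss" "u \<noteq> 0" "cdet u (cis p) = 0" by (auto simp: generic_def)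
    have "cdet (rcis (norm u) (Arg u)) (cis p) = norm u * sin (p - Arg u)"
      by (simp add: cdet_def rcis_def sin_diff algebra_simps)
    then have "sin (p - Arg u) = 0" using u by (simp add: rcis_cmod_Arg)
    then obtain n :: int where "p - Arg u = of_int n * pi" by (auto simp: sin_zero_iff_int2)
    then show "p \<in> (\<lambda>(u, n :: int). Arg u + of_int n * pi) ` (gauss \<times> UNIV)"
      using u(1) by (intro image_eqI[of _ _ "(u, n)"]) auto
  qed
  then show ?thesis by (rule countable_subset) (intro countable_image countable_SIGMA g, simp)
qed

lemma generic_config_dense:
  fixes a b :: real
  assumes "a < b"
  obtains p where "a < p" "p < b" "generic_config p t"
proof -
  define T where "T = {t, 0, - t, pi/2}"
  have "countable ((\<lambda>x. x - z) ` {p. \<not> generic p})" for z using countable_nongeneric by simp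
  then have "countable (\<Union>z\<in>T. (\<lambda>x. x - z) ` {p. \<not> generic p})"
    by (intro countable_UN) (auto simp: T_def)
  then obtain p where p: "p \<in> {a<..<b}" "p \<notin> (\<Union>z\<in>T. (\<lambda>x. x - z) ` {p. \<not> generic p})"
    using real_interval_avoid_countable_set[OF assms(1)] by blast
  have "generic (p + z)" if "z \<in> T" for z
  proof (rule ccontr)
    assume "\<not> generic (p + z)"
    then have "p \<in> (\<lambda>x. x - z) ` {p. \<not> generic p}" by (intro image_eqI[of _ _ "p + z"]) auto
    then show False using p(2) that by blast
  qed
  then have "generic_config p t" unfolding generic_config_def T_def by blast
  then show thesis using that[of p] p(1) by simp
qed

lemma sin_ge:
  assumes "0 < d" "d \<le> x" "x \<le> pi - d"
  shows "sin d \<le> sin x" "sin d > 0"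
proof -
  show "sin d > 0" using assms by (intro sin_gt_zero) auto
  show "sin d \<le> sin x"
  proof (cases "x \<le> pi / 2")
    case True
    then show ?thesis using assms by (intro sin_monotone_2pi_le) auto
  next
    case False
    then have "sin d \<le> sin (pi - x)" using assms by (intro sin_monotone_2pi_le) auto
    then show ?thesis by simp
  qed
qed

locale equivariant_lift =
  fixes \<psi> :: "real \<Rightarrow> real"
  assumes strict_mono: "strict_mono \<psi>"
    and shift: "\<psi> (x + pi) = \<psi> x + pi"
begin

lemma less_iff: "\<psi> x < \<psi> y \<longleftrightarrow> x < y"
  using strict_mono by (rule strict_mono_less)

lemma le_iff: "\<psi> x \<le> \<psi> y \<longleftrightarrow> x \<le> y"
  using strict_mono by (rule strict_mono_less_eq)

lemma shift_int: "\<psi> (x + pi * of_int n) = \<psi> x + pi * of_int n"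
proof (induction n rule: int_induct[where k = 0])
  case (step1 i)
  then show ?case using shift[of "x + pi * of_int i"] by (simp add: algebra_simps)
next
  case (step2 i)
  then show ?case using shift[of "x + pi * of_int (i - 1)"] by (simp add: algebra_simps)
qed simp

text \<open>\<open>\<psi>\<close> acts on half angles, and a chord is twice the sine of half the
  angle that it spans. So this compares the chords of the images of two adjacent arcs.\<close>

definition comparable_at :: "real \<Rightarrow> real \<Rightarrow> real \<Rightarrow> bool" where
  "comparable_at M p t \<longleftrightarrow>
    sin (\<psi> (p + t) - \<psi> p) \<le> M * sin (\<psi> p - \<psi> (p - t)) \<and>
    sin (\<psi> p - \<psi> (p - t)) \<le> M * sin (\<psi> (p + t) - \<psi> p)"

text \<open>Before continuity is available, a grid replaces compactness: an interval of length
  \<open>e\<close> contains a cell of width \<open>q\<close>, and up to the period there are only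
  finitely many cells.\<close>

lemma uniform_gap:
  assumes "e > 0"
  obtains d where "d > 0" "\<And>x y. y \<ge> x + e \<Longrightarrow> \<psi> y - \<psi> x \<ge> d"
proof -
  obtain m :: nat where m: "2 * pi / e < real m" using reals_Archimedean2 by blast
  have "2 * pi / e > 0" using assms by simp
  then have m0: "real m > 0" using m by linarith
  define q where "q = pi / m"
  have q: "q > 0" "2 * q < e" using m m0 assms by (auto simp: q_def field_simps)
  define f where "f k = \<psi> (q * of_int (k + 1)) - \<psi> (q * of_int k)" for k :: int
  define d where "d = Min (f ` {0..<int m})"
  have f: "f k > 0" for k using q less_iff by (simp add: f_def)
  have "d > 0" unfolding d_def using f m0 by (subst Min_gr_iff) auto
  moreover have "\<psi> y - \<psi> x \<ge> d" if "y \<ge> x + e" for x y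
  proof -
    define k where "k = \<lceil>x / q\<rceil>"
    have "x / q \<le> k" "k < x / q + 1" unfolding k_def by linarith+
    then have k: "x \<le> q * k" "q * of_int (k + 1) \<le> y" using q that by (auto simp: field_simps)
    define n where "n = k div int m"
    define j where "j = k mod int m"
    have kj: "k = j + int m * n" by (simp add: j_def n_def)
    have j: "j \<in> {0..<int m}" using m0 by (simp add: j_def)
    have "q * of_int (k + i) = q * of_int (j + i) + pi * of_int n" for i
      using m0 by (simp add: kj q_def field_simps)
    then have "\<psi> (q * of_int (k + i)) = \<psi> (q * of_int (j + i)) + pi * of_int n" for i
      by (simp only: shift_int)
    from this[of 0] this[of 1] have "f k = f j" by (simp add: f_def)
    also have "f j \<ge> d" unfolding d_def using j by (intro Min_le) auto
    finally have "f k \<ge> d" .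
    moreover have "\<psi> x \<le> \<psi> (q * k)" "\<psi> (q * of_int (k + 1)) \<le> \<psi> y" using k le_iff by blast+
    ultimately show ?thesis by (simp add: f_def)
  qed
  ultimately show thesis using that by blast
qed

lemma gap_less_pi: "x < y \<Longrightarrow> y < x + pi \<Longrightarrow> 0 < \<psi> y - \<psi> x \<and> \<psi> y - \<psi> x < pi"
  using less_iff[of x y] less_iff[of y "x + pi"] shift[of x] by simp

lemma sin_gap_bound:
  assumes "e > 0"
  obtains \<mu> where "\<mu> > 0" "\<And>x y. x + e \<le> y \<Longrightarrow> y \<le> x + pi - e \<Longrightarrow> \<mu> \<le> sin (\<psi> y - \<psi> x)"
proof -
  obtain d where d: "d > 0" "\<And>x y. y \<ge> x + e \<Longrightarrow> \<psi> y - \<psi> x \<ge> d" using uniform_gap[OF assms] by blast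
  define d' where "d' = min d (pi / 2)"
  have d': "0 < d'" "d' \<le> d" "d' \<le> pi / 2" using d(1) by (auto simp: d'_def)
  have "sin d' \<le> sin (\<psi> y - \<psi> x)" if xy: "x + e \<le> y" "y \<le> x + pi - e" for x y
  proof (rule sin_ge)
    show "d' \<le> \<psi> y - \<psi> x" using d(2)[OF xy(1)] d' by linarith
    have "\<psi> (x + pi) - \<psi> y \<ge> d" using xy by (intro d(2)) linarith
    then show "\<psi> y - \<psi> x \<le> pi - d'" using shift[of x] d' by linarith
  qed (rule d')
  moreover have "sin d' > 0" using d' by (intro sin_gt_zero) auto
  ultimately show thesis using that by blast
qed

text \<open>Comparability at generic points already excludes jumps of \<open>\<psi>\<close>.\<close>

lemma isCont_of_generic:
  assumes M: "M > 0" and t0: "t0 > 0"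
    and comp: "\<And>p t. 0 < t \<Longrightarrow> t \<le> t0 \<Longrightarrow> generic_config p t \<Longrightarrow> comparable_at M p t"
  shows "isCont \<psi> x"
proof -
  define L where "L = Sup (\<psi> ` {..<x})"
  define R where "R = Inf (\<psi> ` {x<..})"
  have bdd: "bdd_above (\<psi> ` {..<x})" "bdd_below (\<psi> ` {x<..})"
    by (auto intro!: bdd_aboveI[of _ "\<psi> x"] bdd_belowI[of _ "\<psi> x"] simp: le_iff)
  have ne: "\<psi> ` {..<x} \<noteq> {}" "\<psi> ` {x<..} \<noteq> {}" using lt_ex[of x] gt_ex[of x] by auto
  have L1: "\<psi> y \<le> L" if "y < x" for y unfolding L_def using that bdd by (intro cSup_upper) auto
  have R1: "R \<le> \<psi> y" if "x < y" for y unfolding R_def using that bdd by (intro cInf_lower) auto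
  have LR: "L \<le> \<psi> x" "\<psi> x \<le> R" unfolding L_def R_def
    using ne by (auto intro!: cSup_least cInf_greatest simp: le_iff simp del: image_is_empty)
  have L2: "\<exists>y<x. L - \<eta> < \<psi> y" if "\<eta> > 0" for \<eta>
    using less_cSupE[of "L - \<eta>" "\<psi> ` {..<x}"] that ne unfolding L_def by auto
  have R2: "\<exists>y>x. \<psi> y < R + \<eta>" if "\<eta> > 0" for \<eta>
    using cInf_lessD[of "\<psi> ` {x<..}" "R + \<eta>"] that ne unfolding R_def by auto
  have "R \<le> L"
  proof (rule ccontr)
    assume "\<not> R \<le> L"
    then have J: "R - L > 0" by simp
    obtain d where d: "d > 0" "\<And>x y. y \<ge> x + pi/2 \<Longrightarrow> \<psi> y - \<psi> x \<ge> d"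
      using uniform_gap[of "pi/2"] by auto
    \<comment> \<open>Capped so that \<open>J0\<close> bounds the image arc away from both 0 and pi
      and has a positive sine.\<close>
    define J0 where "J0 = min (R - L) (min d 1)"
    have J0: "0 < J0" "J0 \<le> R - L" "J0 \<le> d" "J0 \<le> 1" using J d(1) by (auto simp: J0_def)
    have sJ0: "sin J0 > 0" using J0 pi_gt3 by (intro sin_gt_zero) auto
    define \<eta> where "\<eta> = sin J0 / (2 * M)"
    have \<eta>: "\<eta> > 0" using sJ0 M by (simp add: \<eta>_def)
    obtain y where y: "y < x" "L - \<eta> < \<psi> y" using L2[OF \<eta>] by blast
    \<comment> \<open>A point \<open>p\<close> to the left of \<open>x\<close> within distance
      \<open>t\<close> has \<open>p + t\<close> beyond \<open>x\<close>, so the right arc carries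
      the jump. The left arc starts after \<open>y\<close>, and its image has length at most
      \<open>\<eta>\<close>.\<close>
    define t where "t = min (min t0 (x - y) / 2) 1"
    have t: "0 < t" "t \<le> t0" "2 * t \<le> x - y" "t \<le> 1" using t0 y(1) by (auto simp: t_def min_def)
    obtain p where p: "x - t < p" "p < x" and g: "generic_config p t"
      using generic_config_dense[of "x - t" x t] t(1) by auto
    have "\<psi> (p - t) > L - \<eta>" using y less_iff[of y "p - t"] p t by linarith
    then have small: "\<psi> p - \<psi> (p - t) \<le> \<eta>" using L1[OF p(2)] by linarith
    have pos: "\<psi> p - \<psi> (p - t) > 0" using less_iff[of "p - t" p] t by simp
    have "\<psi> (p + t) - \<psi> p \<ge> R - L" using R1[of "p + t"] L1[OF p(2)] p(1) by linarith
    moreover have "\<psi> (p + pi) - \<psi> (p + t) \<ge> d" using t(4) pi_gt3 by (intro d(2)) linarith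
    ultimately have "sin J0 \<le> sin (\<psi> (p + t) - \<psi> p)"
      using J0 shift[of p] by (intro sin_ge) linarith+
    also have "\<dots> \<le> M * sin (\<psi> p - \<psi> (p - t))"
      using comp[OF t(1,2) g] by (simp add: comparable_at_def)
    also have "\<dots> \<le> M * (\<psi> p - \<psi> (p - t))" using M pos by (intro mult_left_mono sin_x_le_x) auto
    also have "\<dots> \<le> M * \<eta>" using M small by (intro mult_left_mono) auto
    also have "\<dots> = sin J0 / 2" using M by (simp add: \<eta>_def)
    finally show False using sJ0 by simp
  qed
  then have eq: "L = \<psi> x" "R = \<psi> x" using LR by linarith+
  show ?thesis unfolding continuous_at_eps_delta
  proof (intro allI impI)
    fix e :: real assume e: "e > 0"
    obtain y where y: "y < x" "\<psi> x - e < \<psi> y" using L2[OF e] eq by auto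
    obtain z where z: "z > x" "\<psi> z < \<psi> x + e" using R2[OF e] eq by auto
    have "dist (\<psi> w) (\<psi> x) < e" if "dist w x < min (x - y) (z - x)" for w
    proof -
      have "y < w" "w < z" using that by (auto simp: dist_real_def)
      then have "\<psi> y < \<psi> w" "\<psi> w < \<psi> z" using less_iff by blast+
      then show ?thesis using y z by (auto simp: dist_real_def)
    qed
    then show "\<exists>d>0. \<forall>w. dist w x < d \<longrightarrow> dist (\<psi> w) (\<psi> x) < e"
      using y z by (intro exI[of _ "min (x - y) (z - x)"]) auto
  qed
qed

end

locale quasisymmetric_lift = equivariant_lift \<psi> + fan_map W K for \<psi> W K +
  assumes W_cis: "W (cis p) = cis (\<psi> p)"
begin

text \<open>The four directions are harmonic: both products of determinants equal
  \<open>sin t * cos t\<close>. A lattice direction \<open>u\<close> close to \<open>cis p\<close>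
  separates them enough for \<open>four_point_distortion\<close>, and exchanging \<open>a\<close>
  with \<open>c\<close> gives the second inequality.\<close>

lemma generic_distortion:
  assumes t: "0 < t" "t \<le> 1/100"
    and g: "generic_config p t"
  shows "sin (\<psi> (p + t) - \<psi> p) * sin (\<psi> (p + pi/2) - \<psi> (p - t))
      \<le> (126 * K ^ 5)\<^sup>2 * (sin (\<psi> p - \<psi> (p - t)) * sin (\<psi> (p + pi/2) - \<psi> (p + t)))"
    and "sin (\<psi> p - \<psi> (p - t)) * sin (\<psi> (p + pi/2) - \<psi> (p + t))
      \<le> (126 * K ^ 5)\<^sup>2 * (sin (\<psi> (p + t) - \<psi> p) * sin (\<psi> (p + pi/2) - \<psi> (p - t)))"
proof -
  define a b c d where "a = cis (p + t)" and "b = cis p" and "c = cis (p - t)" and "d = cis (p + pi/2)"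
  have tpi: "t < pi/4" using t pi_gt3 by simp
  \<comment> \<open>Balances two requirements: products of two small components are of order
    \<open>r * r = sin t\<close>, and products of a small and a large one are of order 1.\<close>
  define r where "r = sqrt (sin t)"
  have st: "0 < sin t" "sin t \<le> 1/100" using t tpi sin_x_le_x[of t] by (auto intro!: sin_gt_zero)
  have r2: "r * r = sin t" using st by (simp add: r_def)
  have r0: "0 < r" using st by (simp add: r_def)
  have r1: "r \<le> 1/10"
  proof (rule ccontr)
    assume "\<not> r \<le> 1/10"
    then have "(1/10) * (1/10) < r * r" by (intro mult_strict_mono) auto
    then show False using r2 st by simp
  qed
  \<comment> \<open>The pairs containing \<open>d\<close> need 15/16, since
    \<open>9/4 * (5/4) = 45/16 = 3 * (15/16)\<close>.\<close>
  have ct: "cos t \<ge> 15/16" "cos t \<le> 1"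
  proof -
    have "cos t > 0" using t tpi by (intro cos_gt_zero_pi) auto
    moreover have "sin t * sin t \<le> 1/100 * (1/100)" using st by (intro mult_mono) auto
    then have "cos t * cos t \<ge> 99/100" using sin_cos_squared_add[of t] by (simp add: power2_eq_square)
    moreover have "cos t * cos t \<le> cos t * 1" using calculation by (intro mult_left_mono) auto
    ultimately show "cos t \<ge> 15/16" "cos t \<le> 1" by simp_all
  qed
  obtain u v where uv: "unimodular u v" and ub: "\<bar>cdet u b\<bar> \<le> r" and ud: "\<bar>cdet u d\<bar> \<le> 5/4 / r"
    using lattice_vector_near_direction[OF r0 r1, of p] unfolding b_def d_def by blast
  have nz: "cdet u a \<noteq> 0" "cdet u b \<noteq> 0" "cdet u c \<noteq> 0" "cdet u d \<noteq> 0"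
    using g unimodularD(1,5)[OF uv]
    by (auto simp: generic_config_def generic_def a_def b_def c_def d_def)
  have ac: "a = of_real (cos t) * b + of_real (sin t) * d" "c = of_real (cos t) * b - of_real (sin t) * d"
    by (simp_all add: a_def b_def c_def d_def complex_eq_iff cos_add sin_add cos_diff sin_diff)
  have small: "\<bar>cos t * cdet u b\<bar> \<le> r" "\<bar>sin t * cdet u d\<bar> \<le> 5/4 * r"
  proof -
    have "\<bar>cos t\<bar> * \<bar>cdet u b\<bar> \<le> 1 * r" using ct ub by (intro mult_mono) auto
    then show "\<bar>cos t * cdet u b\<bar> \<le> r" by (simp add: abs_mult)
    have "\<bar>sin t\<bar> * \<bar>cdet u d\<bar> \<le> (r * r) * (5/4 / r)" using r2 st ud by (intro mult_mono) auto
    then show "\<bar>sin t * cdet u d\<bar> \<le> 5/4 * r" using r0 by (simp add: abs_mult)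
  qed
  have ua: "\<bar>cdet u a\<bar> \<le> 9/4 * r" and uc: "\<bar>cdet u c\<bar> \<le> 9/4 * r"
    using small unfolding ac cdet_linear cdet_scale by linarith+
  have dets: "\<bar>cdet a b\<bar> = sin t" "\<bar>cdet b c\<bar> = sin t" "\<bar>cdet c d\<bar> = cos t" "\<bar>cdet a d\<bar> = cos t"
    "\<bar>cdet c b\<bar> = sin t" "\<bar>cdet b a\<bar> = sin t"
    using st ct unfolding a_def b_def c_def d_def cdet_cis by (simp_all add: sin_add sin_diff cos_diff)
  have prod1: "\<bar>cdet u x\<bar> * \<bar>cdet u b\<bar> \<le> 3 * sin t" if "\<bar>cdet u x\<bar> \<le> 9/4 * r" for x
  proof -
    have "\<bar>cdet u x\<bar> * \<bar>cdet u b\<bar> \<le> (9/4 * r) * r" using that ub r0 by (intro mult_mono) auto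
    also have "\<dots> \<le> 3 * sin t" using r2 st by simp
    finally show ?thesis .
  qed
  have prod2: "\<bar>cdet u x\<bar> * \<bar>cdet u d\<bar> \<le> 3 * cos t" if "\<bar>cdet u x\<bar> \<le> 9/4 * r" for x
  proof -
    have "\<bar>cdet u x\<bar> * \<bar>cdet u d\<bar> \<le> (9/4 * r) * (5/4 / r)" using that ud r0 by (intro mult_mono) auto
    also have "\<dots> = 45/16" using r0 by simp
    also have "\<dots> \<le> 3 * cos t" using ct by simp
    finally show ?thesis .
  qed
  have Wdet: "\<bar>cdet (W (cis x)) (W (cis y))\<bar> = sin (\<psi> y - \<psi> x) \<and> \<bar>cdet (W (cis y)) (W (cis x))\<bar> = sin (\<psi> y - \<psi> x)"
    if "x < y" "y < x + pi" for x y
  proof -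
    have "sin (\<psi> y - \<psi> x) > 0" using gap_less_pi[OF that] by (intro sin_gt_zero) auto
    then show ?thesis using sin_minus[of "\<psi> y - \<psi> x"] by (simp add: W_cis cdet_cis)
  qed
  have Wd: "\<bar>cdet (W a) (W b)\<bar> = sin (\<psi> (p + t) - \<psi> p)" "\<bar>cdet (W b) (W a)\<bar> = sin (\<psi> (p + t) - \<psi> p)"
    "\<bar>cdet (W b) (W c)\<bar> = sin (\<psi> p - \<psi> (p - t))" "\<bar>cdet (W c) (W b)\<bar> = sin (\<psi> p - \<psi> (p - t))"
    "\<bar>cdet (W a) (W d)\<bar> = sin (\<psi> (p + pi/2) - \<psi> (p + t))"
    "\<bar>cdet (W c) (W d)\<bar> = sin (\<psi> (p + pi/2) - \<psi> (p - t))"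
    unfolding a_def b_def c_def d_def using t tpi
      Wdet[of p "p + t"] Wdet[of "p - t" p] Wdet[of "p + t" "p + pi/2"] Wdet[of "p - t" "p + pi/2"]
    by simp_all
  have "\<bar>cdet (W a) (W b)\<bar> * \<bar>cdet (W c) (W d)\<bar>
    \<le> (126 * K ^ 5)\<^sup>2 * (\<bar>cdet (W b) (W c)\<bar> * \<bar>cdet (W a) (W d)\<bar>)"
  proof (rule four_point_distortion[OF uv nz])
    show "3 * \<bar>cdet x y\<bar> \<ge> \<bar>cdet u x\<bar> * \<bar>cdet u y\<bar>" if "(x, y) \<in> {(a, b), (b, c), (c, d), (a, d)}" for x y
      using that prod1[OF ua] prod1[OF uc] prod2[OF ua] prod2[OF uc] by (auto simp: dets mult.commute)
  qed (simp add: dets)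
  then show "sin (\<psi> (p + t) - \<psi> p) * sin (\<psi> (p + pi/2) - \<psi> (p - t))
      \<le> (126 * K ^ 5)\<^sup>2 * (sin (\<psi> p - \<psi> (p - t)) * sin (\<psi> (p + pi/2) - \<psi> (p + t)))"
    unfolding Wd .
  have "\<bar>cdet (W c) (W b)\<bar> * \<bar>cdet (W a) (W d)\<bar>
    \<le> (126 * K ^ 5)\<^sup>2 * (\<bar>cdet (W b) (W a)\<bar> * \<bar>cdet (W c) (W d)\<bar>)"
  proof (rule four_point_distortion[OF uv nz(3,2,1,4)])
    show "3 * \<bar>cdet x y\<bar> \<ge> \<bar>cdet u x\<bar> * \<bar>cdet u y\<bar>" if "(x, y) \<in> {(c, b), (b, a), (a, d), (c, d)}" for x y
      using that prod1[OF ua] prod1[OF uc] prod2[OF ua] prod2[OF uc] by (auto simp: dets mult.commute)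
  qed (simp add: dets)
  then show "sin (\<psi> p - \<psi> (p - t)) * sin (\<psi> (p + pi/2) - \<psi> (p + t))
      \<le> (126 * K ^ 5)\<^sup>2 * (sin (\<psi> (p + t) - \<psi> p) * sin (\<psi> (p + pi/2) - \<psi> (p - t)))"
    unfolding Wd .
qed

text \<open>The gaps to the fourth point \<open>p + pi/2\<close> have sines between
  \<open>\<mu>\<close> and 1, so they can be removed from the cross ratio inequalities.\<close>

lemma generic_comparable:
  obtains M where "M > 0"
    "\<And>p t. 0 < t \<Longrightarrow> t \<le> 1/100 \<Longrightarrow> generic_config p t \<Longrightarrow> comparable_at M p t"
proof -
  obtain \<mu> where \<mu>: "\<mu> > 0" "\<And>x y. x + pi/4 \<le> y \<Longrightarrow> y \<le> x + pi - pi/4 \<Longrightarrow> \<mu> \<le> sin (\<psi> y - \<psi> x)"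
    using sin_gap_bound[of "pi/4"] by auto
  define C where "C = (126 * K ^ 5)\<^sup>2"
  have C: "C > 0" using K by (simp add: C_def)
  have cancel: "p \<le> (C / \<mu>) * q" if "p * x \<le> C * (q * y)" "\<mu> \<le> x" "0 \<le> p" "0 \<le> q" "y \<le> 1" for p q x y :: real
  proof -
    have "p * \<mu> \<le> p * x" using that by (intro mult_left_mono) auto
    also have "\<dots> \<le> C * (q * y)" by (rule that(1))
    also have "\<dots> \<le> C * (q * 1)" using that C by (intro mult_left_mono) auto
    finally show ?thesis using \<mu>(1) by (simp add: field_simps)
  qed
  have "comparable_at (C / \<mu>) p t"
    if "0 < t" "t \<le> 1/100" "generic_config p t" for p t
  proof -
    note D = generic_distortion[OF that, folded C_def]
    have t: "t < pi/4" using that(2) pi_gt3 by simp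
    have m: "\<mu> \<le> sin (\<psi> (p + pi/2) - \<psi> (p - t))" "\<mu> \<le> sin (\<psi> (p + pi/2) - \<psi> (p + t))"
      using that(1) t by (intro \<mu>(2); linarith)+
    have p: "0 \<le> sin (\<psi> (p + t) - \<psi> p)" "0 \<le> sin (\<psi> p - \<psi> (p - t))"
      using gap_less_pi[of p "p + t"] gap_less_pi[of "p - t" p] that(1) t by (intro sin_ge_zero; linarith)+
    show ?thesis using cancel[OF D(1) m(1) p] cancel[OF D(2) m(2) p(2,1)] by (simp add: comparable_at_def)
  qed
  then show thesis using that[of "C / \<mu>"] C \<mu>(1) by simp
qed

lemma isCont: "isCont \<psi> x"
proof -
  obtain M where M: "M > 0"
    "\<And>p t. 0 < t \<Longrightarrow> t \<le> 1/100 \<Longrightarrow> generic_config p t \<Longrightarrow> comparable_at M p t"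
    using generic_comparable by blast
  show ?thesis by (rule isCont_of_generic[of M "1/100"]) (use M in auto)
qed

lemma continuous: "continuous_on A \<psi>"
  using isCont by (simp add: continuous_at_imp_continuous_on)

text \<open>For small \<open>t\<close> both sides are continuous in \<open>p\<close> and generic
  configurations are dense; for larger \<open>t\<close> the sines lie between a positive bound and
  1.\<close>

lemma comparable:
  obtains M where "M \<ge> 1"
    "\<And>p t. 0 < t \<Longrightarrow> t < pi/2 \<Longrightarrow>
      comparable_at M p t"
proof -
  obtain M where M: "M > 0"
    "\<And>p t. 0 < t \<Longrightarrow> t \<le> 1/100 \<Longrightarrow> generic_config p t \<Longrightarrow> comparable_at M p t"
    using generic_comparable by blast
  obtain \<mu> where \<mu>: "\<mu> > 0" "\<And>x y. x + 1/100 \<le> y \<Longrightarrow> y \<le> x + pi - 1/100 \<Longrightarrow> \<mu> \<le> sin (\<psi> y - \<psi> x)"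
    using sin_gap_bound[of "1/100"] by auto
  define M' where "M' = max 1 (max M (1 / \<mu>))"
  have M': "1 \<le> M'" "M \<le> M'" "1 / \<mu> \<le> M'" by (auto simp: M'_def)
  have dense_ineq: "f p \<le> g p" if cont: "\<And>x. isCont f x" "\<And>x. isCont g x"
    and le: "\<And>p. generic_config p t \<Longrightarrow> f p \<le> g p"
    for f g :: "real \<Rightarrow> real" and t p
  proof (rule ccontr)
    assume "\<not> f p \<le> g p"
    then have "f p - g p > 0" by simp
    moreover have "isCont (\<lambda>x. f x - g x) p" using cont by (intro continuous_intros) auto
    ultimately obtain d where d: "d > 0" "\<And>x. dist x p < d \<Longrightarrow> dist (f x - g x) (f p - g p) < f p - g p"
      unfolding continuous_at_eps_delta by blast
    obtain x where x: "p < x" "x < p + d" "generic_config x t"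
      using generic_config_dense[of p "p + d" t] d(1) by auto
    have "dist (f x - g x) (f p - g p) < f p - g p" using x by (intro d(2)) (simp add: dist_real_def)
    moreover have "f x \<le> g x" using le x(3) by blast
    ultimately show False by (simp add: dist_real_def)
  qed
  have sub: "isCont (\<lambda>x. sin (\<psi> (x + a) - \<psi> (x + b))) p" for a b p
    by (intro continuous_intros isCont_o2[OF _ isCont])
  have sub': "isCont (\<lambda>x. sin (\<psi> (x + a) - \<psi> x)) p" "isCont (\<lambda>x. sin (\<psi> x - \<psi> (x - a))) p" for a p
    using sub[where a = a and b = 0] sub[where a = 0 and b = "- a"] by simp_all
  have "comparable_at M' p t" if t: "0 < t" "t < pi/2" for p t
  proof -
    have p: "0 \<le> sin (\<psi> (p + t) - \<psi> p)" "0 \<le> sin (\<psi> p - \<psi> (p - t))"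
      using gap_less_pi[of p "p + t"] gap_less_pi[of "p - t" p] t by (intro sin_ge_zero; linarith)+
    show ?thesis
    proof (cases "t \<le> 1/100")
      case True
      note gen = M(2)[OF t(1) True, unfolded comparable_at_def]
      have 1: "sin (\<psi> (p + t) - \<psi> p) \<le> M * sin (\<psi> p - \<psi> (p - t))"
        by (rule dense_ineq[where f = "\<lambda>p. sin (\<psi> (p + t) - \<psi> p)" and g = "\<lambda>p. M * sin (\<psi> p - \<psi> (p - t))" and t = t,
              OF sub'(1) continuous_mult[OF continuous_const sub'(2)]]) (use gen in blast)
      have 2: "sin (\<psi> p - \<psi> (p - t)) \<le> M * sin (\<psi> (p + t) - \<psi> p)"
        by (rule dense_ineq[where f = "\<lambda>p. sin (\<psi> p - \<psi> (p - t))" and g = "\<lambda>p. M * sin (\<psi> (p + t) - \<psi> p)" and t = t,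
              OF sub'(2) continuous_mult[OF continuous_const sub'(1)]]) (use gen in blast)
      have "M * sin (\<psi> p - \<psi> (p - t)) \<le> M' * sin (\<psi> p - \<psi> (p - t))"
        "M * sin (\<psi> (p + t) - \<psi> p) \<le> M' * sin (\<psi> (p + t) - \<psi> p)"
        using M'(2) p by (intro mult_right_mono; simp)+
      then show ?thesis using 1 2 unfolding comparable_at_def by linarith
    next
      case False
      have m: "\<mu> \<le> sin (\<psi> (p + t) - \<psi> p)" "\<mu> \<le> sin (\<psi> p - \<psi> (p - t))"
        using False t pi_gt3 by (intro \<mu>(2); linarith)+
      have "1 \<le> M' * q" if "\<mu> \<le> q" for q
      proof -
        have "1 = (1 / \<mu>) * \<mu>" using \<mu>(1) by simp
        also have "\<dots> \<le> M' * q" using that M' \<mu>(1) by (intro mult_mono) auto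
        finally show ?thesis .
      qed
      from this[OF m(1)] this[OF m(2)] show ?thesis
        using sin_le_one[of "\<psi> (p + t) - \<psi> p"] sin_le_one[of "\<psi> p - \<psi> (p - t)"]
        unfolding comparable_at_def by linarith
    qed
  qed
  then show thesis using that M'(1) by blast
qed

end

section \<open>The circle homeomorphism and its shears\<close>

lemma cross_ratio_pt:
  assumes "a \<noteq> 0" "b \<noteq> 0" "c \<noteq> 0" "d \<noteq> 0"
  shows "cross_ratio (pt a) (pt b) (pt c) (pt d) = of_real (cdet_ratio a b c d)"
proof -
  have "cross_ratio (pt a) (pt b) (pt c) (pt d) =
    ((2 * \<i> * of_real (cdet a b) / (cnj a * cnj b)) * (2 * \<i> * of_real (cdet c d) / (cnj c * cnj d))) /
    ((2 * \<i> * of_real (cdet b c) / (cnj b * cnj c)) * (2 * \<i> * of_real (cdet a d) / (cnj a * cnj d)))"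
    unfolding cross_ratio_def pt_diff[OF assms(1,2)] pt_diff[OF assms(3,4)] pt_diff[OF assms(2,3)] pt_diff[OF assms(1,4)] ..
  also have "\<dots> = of_real (cdet_ratio a b c d)" using assms by (simp add: cdet_ratio_def)
  finally show ?thesis .
qed

lemma cis_diff_norm: "norm (cis (2 * x) - cis (2 * y)) = 2 * \<bar>sin (x - y)\<bar>"
proof -
  have "cis (2 * x) - cis (2 * y) = pt (cis x) - pt (cis y)" by (simp add: pt_cis)
  also have "\<dots> = 2 * \<i> * of_real (cdet (cis y) (cis x)) / (cnj (cis y) * cnj (cis x))"
    by (rule pt_diff) auto
  finally show ?thesis by (simp add: norm_divide norm_mult cdet_cis)
qed

lemma pt_eq_cis: "u \<noteq> 0 \<Longrightarrow> pt u = cis (2 * Arg u)"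
  using pt_scale[of "norm u" "cis (Arg u)"] rcis_cmod_Arg[of u] by (simp add: rcis_def pt_cis)

lemma pt_sgn: "u \<noteq> 0 \<Longrightarrow> pt (sgn u) = pt u"
  using pt_scale[of "inverse (norm u)" u] by (simp add: sgn_div_norm scaleR_conv_of_real)

text \<open>The apex is joined to both ends, so its direction is parallel to some
  \<open>v - k * u\<close> and to some \<open>- u - m * v\<close>, which forces
  \<open>k * m = -1\<close>.\<close>

lemma triangle_apex:
  assumes "unimodular u v" "{pt u, x, pt v} \<in> farey_triangles" "x \<noteq> pt u" "x \<noteq> pt v"
  shows "x = pt (u + v) \<or> x = pt (v - u)"
proof -
  have vu: "unimodular v (- u)" using assms(1) by simp
  have e: "{pt u, x} \<in> farey_edges" "{pt v, x} \<in> farey_edges"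
    using assms(2-4) unfolding farey_edges_def by blast+
  obtain k :: int where k: "x = pt (v - of_int k * u)" using farey_edge_fan[OF assms(1) e(1)] .
  obtain m :: int where m: "x = pt (- u - of_int m * v)" using farey_edge_fan[OF vu e(2)] .
  have nz: "v - of_int k * u \<noteq> 0" "- u - of_int m * v \<noteq> 0"
    using unimodularD(6)[OF unimodular_fan(2)[OF assms(1)]] unimodularD(6)[OF unimodular_fan(2)[OF vu]] by auto
  have "cdet (v - of_int k * u) (- u - of_int m * v) = 0" using pt_eq_iff[OF nz] k m by simp
  then have "1 + real_of_int m * real_of_int k = 0"
    using unimodularD[OF assms(1)] by (simp add: cdet_linear)
  then have "1 + of_int (k * m) = (0 :: real)" by (simp add: mult.commute)
  then have "k * m = -1" by linarith
  then have "k = 1 \<or> k = -1" using zmult_eq_neg1_iff[of k m] by auto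
  then show ?thesis using k by (auto simp: add.commute)
qed

text \<open>Halving the angles places the four directions within less than a half turn, where
  counterclockwise order means positive determinants.\<close>

lemma ccw_quad_cdet:
  assumes "ccw_quad a b c d"
  obtains A B C D where "a = pt A" "b = pt B" "c = pt C" "d = pt D"
    "cdet A B > 0" "cdet A C > 0" "cdet A D > 0" "cdet B C > 0" "cdet C D > 0"
proof -
  obtain \<alpha> \<beta> \<gamma> \<delta> where o: "\<alpha> < \<beta>" "\<beta> < \<gamma>" "\<gamma> < \<delta>" "\<delta> < \<alpha> + 2 * pi"
    and e: "a = cis \<alpha>" "b = cis \<beta>" "c = cis \<gamma>" "d = cis \<delta>"
    using assms unfolding ccw_quad_def by blast
  have p: "cis x = pt (cis (x / 2))" for x by (simp add: pt_cis)
  have q: "cdet (cis (x / 2)) (cis (y / 2)) > 0" if "x < y" "y < x + 2 * pi" for x y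
    unfolding cdet_cis using that by (intro sin_gt_zero) auto
  show thesis
    by (rule that[OF e(1)[THEN trans, OF p] e(2)[THEN trans, OF p] e(3)[THEN trans, OF p] e(4)[THEN trans, OF p]];
        rule q; use o in linarith)
qed

lemma farey_quad_unimodular:
  assumes "farey_quad a b c d"
  obtains u v where "unimodular u v" "a = pt u" "b = pt (u + v)" "c = pt v" "d = pt (v - u)"
proof -
  have T: "{a, b, c} \<in> farey_triangles" "{a, c, d} \<in> farey_triangles" and "ccw_quad a b c d"
    using assms by (auto simp: farey_quad_def)
  then obtain A B C D where e: "a = pt A" "b = pt B" "c = pt C" "d = pt D"
    and o: "cdet A B > 0" "cdet A C > 0" "cdet A D > 0" "cdet B C > 0" "cdet C D > 0"
    using ccw_quad_cdet by blast
  have nz: "A \<noteq> 0" "B \<noteq> 0" "C \<noteq> 0" "D \<noteq> 0" using o by fastforce+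
  have ne: "a \<noteq> b" "a \<noteq> c" "a \<noteq> d" "b \<noteq> c" "d \<noteq> c"
    using o pt_eq_iff nz cdet_commute[of D C] unfolding e by auto
  have "{a, c} \<in> farey_edges" using T(1) ne(2) unfolding farey_edges_def by blast
  then obtain p q where pq: "unimodular p q" "{a, c} = {pt p, pt q}"
    unfolding farey_edges_eq mem_Collect_eq by metis
  have "a = pt p \<and> c = pt q \<or> a = pt q \<and> c = pt (- p)" using pq(2) by (auto simp: doubleton_eq_iff)
  moreover have "unimodular q (- p)" using pq(1) by simp
  ultimately obtain u v where uv: "unimodular u v" "a = pt u" "c = pt v" using pq(1) by blast
  note d = unimodularD[OF uv(1)]
  have nz': "u + v \<noteq> 0" "v - u \<noteq> 0" using uv(1) unimodularD(6)[of u "u + v"] unimodularD(6)[of u "v - u"] by auto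
  have par: "\<exists>r. r \<noteq> 0 \<and> w = of_real r * Z" if h: "pt w = pt Z" "w \<noteq> 0" "Z \<noteq> 0" for w Z
  proof -
    have "cdet Z w = 0" using h pt_eq_iff[of Z w] by simp
    then obtain r where "w = of_real r * Z" using cdet_eq_0_parallel h(3) by blast
    then show ?thesis using h(2) by auto
  qed
  obtain \<rho> where \<rho>: "\<rho> \<noteq> 0" "u = of_real \<rho> * A" using par[of u A] uv(2) e(1) d nz by auto
  obtain \<sigma> where \<sigma>: "\<sigma> \<noteq> 0" "v = of_real \<sigma> * C" using par[of v C] uv(3) e(3) d nz by auto
  have "\<rho> * \<sigma> * cdet A C = cdet u v" unfolding \<rho>(2) \<sigma>(2) by simp
  then have "\<rho> * \<sigma> * cdet A C = 1" using d(3) by simp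
  then have rs: "\<rho> * \<sigma> > 0" using o(2) by (metis zero_less_mult_pos2 zero_less_one)
  have b: "b = pt (u + v)"
  proof (rule ccontr)
    \<comment> \<open>The wrong apex would give \<open>\<rho>\<close> and \<open>\<kappa>\<close>
      equal signs and \<open>\<kappa>\<close> and \<open>\<sigma>\<close> opposite ones, although
      \<open>\<rho>\<close> and \<open>\<sigma>\<close> agree in sign.\<close>
    assume "b \<noteq> pt (u + v)"
    then have "b = pt (v - u)" using triangle_apex[OF uv(1), of b] T(1) ne uv by auto
    then obtain \<kappa> where \<kappa>: "v - u = of_real \<kappa> * B" using par[of "v - u" B] e(2) nz nz' by auto
    have "\<rho> * \<kappa> * cdet A B = cdet u (v - u)" unfolding \<kappa> by (simp add: \<rho>(2))
    then have "\<rho> * \<kappa> * cdet A B = 1" using d by (simp add: cdet_linear)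
    then have 1: "\<rho> * \<kappa> > 0" using o(1) by (metis zero_less_mult_pos2 zero_less_one)
    have "- (\<kappa> * \<sigma>) * cdet B C = - cdet (v - u) v" unfolding \<kappa> by (simp add: \<sigma>(2))
    then have "- (\<kappa> * \<sigma>) * cdet B C = 1" using d by (simp add: cdet_linear)
    then have 2: "- (\<kappa> * \<sigma>) > 0" using o(4) by (metis zero_less_mult_pos2 zero_less_one)
    show False using 1 2 rs by (auto simp: zero_less_mult_iff mult_less_0_iff)
  qed
  have d': "d = pt (v - u)"
  proof (rule ccontr)
    assume "d \<noteq> pt (v - u)"
    then have "d = pt (u + v)" using triangle_apex[OF uv(1), of d] T(2) ne uv by (auto simp: insert_commute)
    then obtain \<kappa> where \<kappa>: "u + v = of_real \<kappa> * D" using par[of "u + v" D] e(4) nz nz' by auto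
    have "\<rho> * \<kappa> * cdet A D = cdet u (u + v)" unfolding \<kappa> by (simp add: \<rho>(2))
    then have "\<rho> * \<kappa> * cdet A D = 1" using d by (simp add: cdet_linear)
    then have 1: "\<rho> * \<kappa> > 0" using o(3) by (metis zero_less_mult_pos2 zero_less_one)
    have "- (\<sigma> * \<kappa>) * cdet C D = - cdet v (u + v)" unfolding \<kappa> by (simp add: \<sigma>(2))
    then have "- (\<sigma> * \<kappa>) * cdet C D = 1" using d by (simp add: cdet_linear)
    then have 2: "- (\<sigma> * \<kappa>) > 0" using o(5) by (metis zero_less_mult_pos2 zero_less_one)
    show False using 1 2 rs by (auto simp: zero_less_mult_iff mult_less_0_iff)
  qed
  show thesis using that[OF uv(1,2) b uv(3) d'] .
qed

text \<open>The difference \<open>Arg w - Arg z\<close> has positive sine and absolute value below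
  \<open>2 * pi\<close>; if it is negative, a full turn brings it between 0 and pi.\<close>

lemma direction_angle:
  assumes "cdet z w > 0"
  obtains x where "0 < x" "x < pi" "pt w = cis (2 * (Arg z + x))" "w = of_real (norm w) * cis (Arg z + x)"
proof -
  have nz: "z \<noteq> 0" "w \<noteq> 0" using assms by fastforce+
  have w: "w = of_real (norm w) * cis (Arg w)" using rcis_cmod_Arg[of w] by (simp add: rcis_def)
  have s: "sin (Arg w - Arg z) > 0"
    using assms nz unfolding cdet_Arg by (metis mult_pos_pos zero_less_mult_pos zero_less_norm_iff)
  have b: "Arg w - Arg z < 2 * pi" "Arg w - Arg z > - 2 * pi"
    using Arg_bounded[of z] Arg_bounded[of w] by auto
  show thesis
  proof (cases "Arg w - Arg z > 0")
    case True
    have "Arg w - Arg z < pi"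
    proof (rule ccontr)
      assume "\<not> Arg w - Arg z < pi"
      then have "sin (Arg w - Arg z - pi) \<ge> 0" using b by (intro sin_ge_zero) auto
      then show False using s by simp
    qed
    then show thesis using that[of "Arg w - Arg z"] True w pt_eq_cis[OF nz(2)] by simp
  next
    case False
    have "\<not> Arg w - Arg z \<ge> - pi"
    proof
      assume "Arg w - Arg z \<ge> - pi"
      then have "sin (- (Arg w - Arg z)) \<ge> 0" using False by (intro sin_ge_zero) auto
      then show False using s by (simp only: sin_minus)
    qed
    moreover have "cis (2 * (Arg w + 2 * pi)) = cis (2 * Arg w)"
      using cis_add_pi_int[of "2 * Arg w" 2] by (simp add: distrib_left)
    moreover have "cis (Arg w + 2 * pi) = cis (Arg w)" using cis_add_pi_int[of "Arg w" 1] by simp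
    ultimately show thesis using that[of "Arg w - Arg z + 2 * pi"] False b w pt_eq_cis[OF nz(2)]
      by (simp add: add.commute)
  qed
qed

text \<open>Measured counterclockwise from \<open>u\<close>, the three other directions have angles
  below pi, where a positive determinant means a larger angle.\<close>

lemma unimodular_farey_quad:
  assumes "unimodular u v"
  shows "farey_quad (pt u) (pt (u + v)) (pt v) (pt (v - u))"
proof -
  note d = unimodularD[OF assms]
  have cd: "cdet u (u + v) > 0" "cdet u v > 0" "cdet u (v - u) > 0" using d by (simp_all add: cdet_linear)
  obtain x where x: "0 < x" "x < pi" "pt (u + v) = cis (2 * (Arg u + x))" "u + v = of_real (norm (u + v)) * cis (Arg u + x)"
    using direction_angle[OF cd(1)] .
  obtain y where y: "0 < y" "y < pi" "pt v = cis (2 * (Arg u + y))" "v = of_real (norm v) * cis (Arg u + y)"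
    using direction_angle[OF cd(2)] .
  obtain z where z: "0 < z" "z < pi" "pt (v - u) = cis (2 * (Arg u + z))" "v - u = of_real (norm (v - u)) * cis (Arg u + z)"
    using direction_angle[OF cd(3)] .
  have less: "s < t" if "cdet p q > 0" "p = of_real k * cis (Arg u + s)" "q = of_real m * cis (Arg u + t)"
    "0 \<le> k" "0 \<le> m" "0 < s" "s < pi" "0 < t" "t < pi" for p q k m s t
  proof (rule ccontr)
    assume "\<not> s < t"
    then have "sin (s - t) \<ge> 0" using that by (intro sin_ge_zero) auto
    moreover have "cdet p q = k * (m * - sin (s - t))"
      unfolding that(2,3) cdet_scale cdet_cis sin_minus[symmetric] by simp
    ultimately have "cdet p q \<le> 0" using that by (simp add: mult_nonneg_nonneg)
    then show False using that(1) by simp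
  qed
  have "x < y" by (rule less[OF _ x(4) y(4)]) (use d x y in \<open>simp_all add: cdet_linear\<close>)
  moreover have "y < z" by (rule less[OF _ y(4) z(4)]) (use d y z in \<open>simp_all add: cdet_linear\<close>)
  ultimately have "ccw_quad (pt u) (pt (u + v)) (pt v) (pt (v - u))"
    unfolding ccw_quad_def x(3) y(3) z(3) pt_eq_cis[OF d(5)]
    using x(1) z(2) by (intro exI[of _ "2 * Arg u"] exI[of _ "2 * (Arg u + x)"] exI[of _ "2 * (Arg u + y)"] exI[of _ "2 * (Arg u + z)"]) simp
  moreover have "{pt u, pt (u + v), pt v} \<in> farey_triangles"
    using tri_in_farey[OF assms] by (simp add: tri_def insert_commute)
  moreover have "{pt u, pt v, pt (v - u)} \<in> farey_triangles"
    using tri_in_farey[of v "- u"] assms by (simp add: tri_def insert_commute)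
  ultimately show ?thesis by (simp add: farey_quad_def)
qed

lemma shear_eqI:
  assumes h: "\<And>u v. unimodular u v \<Longrightarrow>
      ln (Re (cross_ratio (h (pt u)) (h (pt (u + v))) (h (pt v)) (h (pt (v - u))))) = s {pt u, pt v}"
    and e: "e \<in> farey_edges"
  shows "shear h e = s e"
  unfolding shear_def
proof (rule the_equality)
  obtain u v where uv: "unimodular u v" "e = {pt u, pt v}"
    using e unfolding farey_edges_eq mem_Collect_eq by metis
  show "\<exists>a b c d. farey_quad a b c d \<and> e = {a, c} \<and> s e = ln (Re (cross_ratio (h a) (h b) (h c) (h d)))"
    using unimodular_farey_quad[OF uv(1)] h[OF uv(1)] uv(2) by metis
next
  fix x assume "\<exists>a b c d. farey_quad a b c d \<and> e = {a, c} \<and> x = ln (Re (cross_ratio (h a) (h b) (h c) (h d)))"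
  then obtain a b c d where q: "farey_quad a b c d" "e = {a, c}" "x = ln (Re (cross_ratio (h a) (h b) (h c) (h d)))"
    by blast
  obtain u v where "unimodular u v" "a = pt u" "b = pt (u + v)" "c = pt v" "d = pt (v - u)"
    using farey_quad_unimodular[OF q(1)] .
  then show "x = s e" using h q by simp
qed

section \<open>The induced circle map\<close>

lemma cis_Arg_minus_add_pi: "w \<in> \<T> \<Longrightarrow> cis (Arg (- w) + pi) = w"
proof -
  assume w: "w \<in> \<T>"
  then have "- w \<noteq> 0" by auto
  then have "cis (Arg (- w)) = - w" using cis_Arg[of "- w"] w by (simp add: sgn_eq)
  then show ?thesis by (simp flip: cis_mult)
qed

text \<open>\<open>Arg\<close> jumps at -1, and \<open>Arg (- w) + pi\<close> is a branch of the
  argument that does not.\<close>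

lemma isCont_Arg_uminus: "isCont (\<lambda>w. Arg (- w)) (-1)"
proof -
  have "(1::complex) \<notin> \<real>\<^sub>\<le>\<^sub>0" by simp
  then have "isCont Arg (- (-1))" using continuous_at_Arg[of 1] by simp
  then show ?thesis by (intro isCont_o2[of _ uminus Arg] continuous_intros)
qed

lemma continuous_cis_lift: assumes "\<And>x. isCont \<psi> x" "continuous (at z) (\<lambda>z. Arg (f z))"
  shows "continuous (at z) (\<lambda>z. cis (2 * \<psi> ((Arg (f z) + c) / 2)))"
proof -
  have "isCont (\<lambda>z. (Arg (f z) + c) / 2) z" using assms(2) by (intro continuous_intros) auto
  then have "isCont (\<lambda>z. \<psi> ((Arg (f z) + c) / 2)) z" by (rule isCont_o2[OF _ assms(1)])
  then have "isCont (\<lambda>z. \<i> * of_real (2 * \<psi> ((Arg (f z) + c) / 2))) z" by (intro continuous_intros)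
  then show ?thesis unfolding cis_conv_exp by (rule isCont_o2[OF _ isCont_exp])
qed

context equivariant_lift
begin

definition circle_map :: "complex \<Rightarrow> complex" where
  "circle_map z = cis (2 * \<psi> (Arg z / 2))"

text \<open>A change of branch shifts the half angle by a multiple of pi, hence
  \<open>2 * \<psi>\<close> by a multiple of \<open>2 * pi\<close>.\<close>

lemma circle_map_cis: "circle_map (cis x) = cis (2 * \<psi> (x / 2))"
proof -
  have "cis (Arg (cis x)) = cis x" using cis_Arg[of "cis x"] by (simp add: sgn_cis)
  then obtain n :: int where "Arg (cis x) = x + 2 * pi * n" by (rule cis_eqD)
  then have "Arg (cis x) / 2 = x / 2 + pi * n" by simp
  then have "2 * \<psi> (Arg (cis x) / 2) = 2 * \<psi> (x / 2) + 2 * pi * n" by (simp only: shift_int) simp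
  then show ?thesis by (simp add: circle_map_def cis_add_pi_int)
qed

lemma circle_homeo_circle_map:
  assumes cont: "continuous_on UNIV \<psi>"
  shows "circle_homeo circle_map"
proof -
  have isCont: "isCont \<psi> x" for x using cont by (simp add: continuous_on_eq_continuous_at)
  have Arg_cont: "continuous (at z) Arg" if "z \<in> \<T>" "z \<noteq> -1" for z
  proof -
    have "z \<notin> \<real>\<^sub>\<le>\<^sub>0"
    proof
      assume "z \<in> \<real>\<^sub>\<le>\<^sub>0"
      then obtain r where "z = of_real r" "r \<le> 0" by (auto elim: nonpos_Reals_cases)
      then show False using that by auto
    qed
    then show ?thesis by (rule continuous_at_Arg)
  qed
  have cont_on: "continuous_on \<T> circle_map"
  proof (subst continuous_on_eq_continuous_within, intro ballI)
    fix z :: complex assume z: "z \<in> \<T>"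
    show "continuous (at z within \<T>) circle_map"
    proof (cases "z = -1")
      case False
      have "continuous (at z) circle_map"
        using continuous_cis_lift[of \<psi>, OF isCont Arg_cont[OF z False], of 0]
        unfolding circle_map_def[abs_def] add_0_right .
      then show ?thesis by (rule continuous_at_imp_continuous_at_within)
    next
      case True
      \<comment> \<open>On the circle this is the same map, computed with the branch that is
        continuous at -1.\<close>
      define k where "k w = cis (2 * \<psi> ((Arg (- w) + pi) / 2))" for w
      have "continuous (at z) k" unfolding k_def True
        by (rule continuous_cis_lift[OF isCont isCont_Arg_uminus])
      then have k: "continuous (at z within \<T>) k" by (rule continuous_at_imp_continuous_at_within)
      have "k w = circle_map w" if "w \<in> \<T>" for w
        using circle_map_cis[of "Arg (- w) + pi"] unfolding cis_Arg_minus_add_pi[OF that] k_def by (rule sym)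
      then show ?thesis by (rule continuous_transform_within[OF k zero_less_one z])
    qed
  qed
  have inj: "inj_on circle_map \<T>"
  proof (rule inj_onI)
    fix z w assume z: "z \<in> \<T>" and w: "w \<in> \<T>" and eq: "circle_map z = circle_map w"
    obtain n :: int where "2 * \<psi> (Arg z / 2) = 2 * \<psi> (Arg w / 2) + 2 * pi * n"
      using eq unfolding circle_map_def by (rule cis_eqD)
    then have "\<psi> (Arg z / 2) = \<psi> (Arg w / 2 + pi * n)" by (simp add: shift_int)
    then have a: "Arg z / 2 = Arg w / 2 + pi * n" using strict_mono by (simp add: strict_mono_eq)
    then have "Arg z = Arg w + 2 * pi * n" by simp
    then have "cis (Arg z) = cis (Arg w)" by (simp add: cis_add_pi_int)
    moreover have "z \<noteq> 0" "w \<noteq> 0" using z w by auto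
    ultimately show "z = w" using z w by (simp add: cis_Arg sgn_eq)
  qed
  have onto: "circle_map ` \<T> = \<T>"
  proof (intro equalityI subsetI)
    fix w assume "w \<in> circle_map ` \<T>" then show "w \<in> \<T>" by (auto simp: circle_map_def)
  next
    fix w assume w: "w \<in> \<T>"
    define y where "y = Arg w / 2"
    \<comment> \<open>Large enough for the values of \<open>\<psi>\<close> at
      \<open>- pi * n\<close> and \<open>pi * n\<close> to enclose \<open>y\<close>.\<close>
    define n where "n = \<lceil>(\<bar>y\<bar> + \<bar>\<psi> 0\<bar>) / pi\<rceil>"
    have "(\<bar>y\<bar> + \<bar>\<psi> 0\<bar>) / pi \<le> n" unfolding n_def by linarith
    then have n: "\<bar>y\<bar> + \<bar>\<psi> 0\<bar> \<le> pi * n" by (simp add: divide_le_eq mult.commute)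
    have "\<psi> (pi * of_int n) = \<psi> 0 + pi * n" "\<psi> (pi * of_int (- n)) = \<psi> 0 - pi * n"
      using shift_int[of 0 n] shift_int[of 0 "- n"] by simp_all
    then have "\<psi> (pi * of_int (- n)) \<le> y" "y \<le> \<psi> (pi * of_int n)" using n by linarith+
    moreover have "pi * of_int (- n) \<le> pi * of_int n" using n by simp
    ultimately obtain x where x: "\<psi> x = y"
      using IVT'[of \<psi> "pi * of_int (- n)" y "pi * of_int n"] continuous_on_subset[OF cont] by blast
    have w0: "w \<noteq> 0" using w by auto
    have "circle_map (cis (2 * x)) = cis (Arg w)" unfolding circle_map_cis using x by (simp add: y_def mult.commute)
    also have "\<dots> = w" using w cis_Arg[OF w0] by (simp add: sgn_eq)
    finally show "w \<in> circle_map ` \<T>" by (intro image_eqI[of _ _ "cis (2 * x)"]) auto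
  qed
  have "\<exists>g. homeomorphism \<T> \<T> circle_map g"
    by (rule homeomorphism_compact[OF compact_sphere cont_on onto inj])
  moreover have "continuous_on UNIV (\<lambda>x. 2 * \<psi> (x / 2))"
    by (intro continuous_intros continuous_on_compose2[OF cont]) auto
  moreover have "strict_mono (\<lambda>x. 2 * \<psi> (x / 2))" by (simp add: strict_mono_def less_iff)
  ultimately show ?thesis unfolding circle_homeo_def using circle_map_cis by blast
qed

end

context quasisymmetric_lift
begin

lemma quasisymmetric_circle_map: "quasisymmetric circle_map"
proof -
  obtain M where M: "M \<ge> 1" "\<And>\<theta> \<tau>. 0 < \<tau> \<Longrightarrow> \<tau> < pi/2 \<Longrightarrow> comparable_at M \<theta> \<tau>"
    using comparable by blast
  have "1 / M \<le> norm (circle_map (cis (x + t)) - circle_map (cis x)) / norm (circle_map (cis x) - circle_map (cis (x - t))) \<and>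
      norm (circle_map (cis (x + t)) - circle_map (cis x)) / norm (circle_map (cis x) - circle_map (cis (x - t))) \<le> M"
    if t: "0 < t \<and> t < pi" for x t
  proof -
    define \<theta> \<tau> where "\<theta> = x / 2" and "\<tau> = t / 2"
    have \<tau>: "0 < \<tau>" "\<tau> < pi/2" using t by (auto simp: \<tau>_def)
    define p q where "p = sin (\<psi> (\<theta> + \<tau>) - \<psi> \<theta>)" and "q = sin (\<psi> \<theta> - \<psi> (\<theta> - \<tau>))"
    have pos: "p > 0" "q > 0" unfolding p_def q_def
      using gap_less_pi[of \<theta> "\<theta> + \<tau>"] gap_less_pi[of "\<theta> - \<tau>" \<theta>] \<tau> by (intro sin_gt_zero; linarith)+
    have e: "norm (circle_map (cis (x + t)) - circle_map (cis x)) = 2 * p"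
      "norm (circle_map (cis x) - circle_map (cis (x - t))) = 2 * q"
      unfolding circle_map_cis cis_diff_norm using pos
      by (simp_all add: p_def q_def \<theta>_def \<tau>_def add_divide_distrib diff_divide_distrib)
    have "p \<le> M * q" "q \<le> M * p" using M(2)[OF \<tau>, of \<theta>] by (simp_all add: comparable_at_def p_def q_def)
    then show ?thesis unfolding e using pos M(1) by (simp add: field_simps)
  qed
  then show ?thesis unfolding quasisymmetric_def
    using circle_homeo_circle_map[OF continuous] M(1) by blast
qed

end

text \<open>With \<open>W u\<close> at infinity, the cross ratio at the edge to \<open>w k\<close>
  is the quotient of the adjacent gaps \<open>g (k - 1)\<close> and \<open>g k\<close>. These
  quotients are exponentials of differences of \<open>\<tau>\<close>, so their products telescope
  and stay below \<open>exp (2 * B)\<close>.\<close>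

lemma fan_dist_gap_bound:
  assumes ratio: "\<And>a b. unimodular a b \<Longrightarrow> cdet_ratio (W a) (W (a + b)) (W b) (W (b - a)) = exp (s {pt a, pt b})"
    and pos: "\<And>z w. cdet z w > 0 \<Longrightarrow> cdet (W z) (W w) > 0"
    and uv: "unimodular u v"
    and \<tau>: "\<And>k::int. \<bar>\<tau> k\<bar> \<le> B" "\<And>k. s {pt u, pt (v + of_int k * u)} = \<tau> k - \<tau> (k + 1)"
  shows "fan_dist W u (v + of_int (m + 1) * u) (v + of_int m * u)
    \<le> exp (2 * B) * fan_dist W u (v + of_int (n + 1) * u) (v + of_int n * u)"
proof -
  define w where "w k = v + of_int k * u" for k :: int
  define g where "g k = fan_dist W u (w (k + 1)) (w k)" for k
  have un: "unimodular u (w k)" for k using uv by (simp add: w_def)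
  have p: "cdet (W u) (W (w k)) > 0" for k using pos unimodularD(3)[OF un[of k]] by simp
  have step: "w (k + 1) = u + w k" "w (k - 1) = w k - u" for k by (simp_all add: w_def algebra_simps)
  have ww: "cdet (W (w (k + 1))) (W (w k)) > 0" for k
    using unimodularD(3)[OF un[of k]] unfolding step by (intro pos) (simp add: cdet_linear)
  have gp: "g k > 0" for k using p ww by (simp add: g_def fan_dist_def)
  have rec: "g (k - 1) = exp (\<tau> k - \<tau> (k + 1)) * g k" for k
  proof -
    have "exp (\<tau> k - \<tau> (k + 1)) = cdet_ratio (W u) (W (w (k + 1))) (W (w k)) (W (w (k - 1)))"
      using ratio[OF un[of k]] \<tau>(2)[of k] unfolding step by (simp add: w_def)
    then show ?thesis using p[of k] p[of "k + 1"] p[of "k - 1"] ww[of k] ww[of "k - 1"]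
      by (simp add: cdet_ratio_def g_def fan_dist_def)
  qed
  have inv: "g (k - 1) * exp (- \<tau> k) = g k * exp (- \<tau> (k + 1))" for k
    unfolding rec[of k] by (simp add: exp_diff exp_minus field_simps)
  have const: "g k * exp (- \<tau> (k + 1)) = g 0 * exp (- \<tau> 1)" for k
  proof (induction k rule: int_induct[where k = 0])
    case (step1 i)
    then show ?case using inv[of "i + 1"] by simp
  next
    case (step2 i)
    then show ?case using inv[of i] by simp
  qed simp
  have gk: "g k = g 0 * exp (- \<tau> 1) * exp (\<tau> (k + 1))" for k
    using const[of k] by (simp add: exp_minus field_simps)
  have "exp (\<tau> (m + 1)) \<le> exp (2 * B) * exp (\<tau> (n + 1))"
    using \<tau>(1)[of "m + 1"] \<tau>(1)[of "n + 1"] by (simp flip: exp_add)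
  then have "g m \<le> g 0 * exp (- \<tau> 1) * (exp (2 * B) * exp (\<tau> (n + 1)))"
    unfolding gk[of m] using gp[of 0] by (intro mult_left_mono) auto
  also have "\<dots> = exp (2 * B) * g n" unfolding gk[of n] by simp
  finally show ?thesis by (simp add: g_def w_def)
qed

theorem proposition1p3:
  fixes s :: "complex set \<Rightarrow> real"
  assumes "s \<in> shears_H"
  shows "\<exists>h. quasisymmetric h \<and> h (-1) = -1 \<and> h \<i> = \<i> \<and> h 1 = 1 \<and>
           (\<forall>e\<in>farey_edges. shear h e = s e)"
proof -
  obtain \<psi> :: "real \<Rightarrow> real" where \<psi>: "strict_mono \<psi>" "\<forall>x. \<psi> (x + pi) = \<psi> x + pi"
    and lift: "\<forall>u v \<theta>. unimodular u v \<longrightarrow> cis \<theta> = sgn u \<longrightarrow> cis (\<psi> \<theta>) = image_dir s u"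
    using image_lift[of s] by (elim exE conjE)
  interpret equivariant_lift \<psi> by unfold_locales (use \<psi> in auto)
  \<comment> \<open>By angle, \<open>W\<close> extends \<open>image_dir s\<close> from members of
    bases to all directions.\<close>
  define W where "W w = cis (\<psi> (Arg w))" for w
  have W_unimodular: "W u = image_dir s u" if "unimodular u v" for u v
    unfolding W_def using lift that cis_Arg[OF unimodularD(5)[OF that]] by blast
  have W_eq: "W w = cis (\<psi> x)" if "w = of_real k * cis x" "k > 0" for w k x
  proof -
    have "cis (Arg w) = cis x" using that cis_Arg[of w] by (simp add: sgn_mult sgn_cis sgn_of_real)
    then obtain n :: int where "Arg w = x + 2 * pi * n" by (rule cis_eqD)
    then have "Arg w = x + pi * of_int (2 * n)" by simp
    then have "\<psi> (Arg w) = \<psi> x + 2 * pi * of_int n" by (simp only: shift_int)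
    then show ?thesis by (simp add: W_def cis_add_pi_int)
  qed
  have W_pos: "cdet (W z) (W w) > 0" if h: "cdet z w > 0" for z w
  proof -
    obtain x where x: "0 < x" "x < pi" "w = of_real (norm w) * cis (Arg z + x)"
      using direction_angle[OF h] by metis
    have "norm w > 0" using h by fastforce
    then have "W w = cis (\<psi> (Arg z + x))" using W_eq[OF x(3)] by simp
    moreover have "sin (\<psi> (Arg z + x) - \<psi> (Arg z)) > 0"
      using gap_less_pi[of "Arg z" "Arg z + x"] x by (intro sin_gt_zero) auto
    ultimately show ?thesis by (simp add: W_def cdet_cis)
  qed
  have polar: "w = of_real (norm w) * cis (Arg w)" for w using rcis_cmod_Arg[of w] by (simp add: rcis_def)
  have W_minus: "W (- z) = - W z" if "z \<noteq> 0" for z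
  proof -
    have "- z = of_real (norm z) * cis (Arg z + pi)" using polar[of z] by (simp flip: cis_mult)
    then have "W (- z) = cis (\<psi> (Arg z + pi))" using that by (intro W_eq) auto
    then show ?thesis unfolding W_def shift by (simp flip: cis_mult)
  qed
  have W_scale: "W (of_real r * z) = W z" if "r > 0" "z \<noteq> 0" for r z
    using that(1) by (simp add: W_def)
  have ratio: "cdet_ratio (W a) (W (a + b)) (W b) (W (b - a)) = exp (s {pt a, pt b})" if "unimodular a b" for a b
  proof -
    have "unimodular b (b - a)" using that unimodular_simps(1)[of b "- a"] by simp
    then have un: "unimodular (b - a) (- b)" "unimodular (a + b) b" "unimodular b (- a)" using that by simp_all
    show ?thesis using image_dir_ratio[OF that] by (simp only: that[THEN W_unimodular] un[THEN W_unimodular])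
  qed
  obtain B where B: "\<And>u v. unimodular u v \<Longrightarrow> \<exists>\<tau> :: int \<Rightarrow> real. (\<forall>k. \<bar>\<tau> k\<bar> \<le> B) \<and>
    (\<forall>k. s {pt u, pt (v + of_int k * u)} = \<tau> k - \<tau> (k + 1))"
    using fan_potential[OF assms] by blast
  have B0: "B \<ge> 0" using B[OF unimodular_1_i] by force
  have gap: "fan_dist W u (v + of_int (m + 1) * u) (v + of_int m * u)
      \<le> exp (2 * B) * fan_dist W u (v + of_int (n + 1) * u) (v + of_int n * u)" if h: "unimodular u v" for u v m n
  proof -
    obtain \<tau> :: "int \<Rightarrow> real" where "\<And>k. \<bar>\<tau> k\<bar> \<le> B"
      "\<And>k. s {pt u, pt (v + of_int k * u)} = \<tau> k - \<tau> (k + 1)" using B[OF h] by blast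
    then show ?thesis using fan_dist_gap_bound[of W s u v \<tau> B m n] ratio W_pos h by blast
  qed
  interpret quasisymmetric_lift \<psi> W "exp (2 * B)"
  proof unfold_locales
    show "1 \<le> exp (2 * B)" using B0 by simp
    show "W (cis \<theta>) = cis (\<psi> \<theta>)" for \<theta> by (rule W_eq[of _ 1]) auto
  qed (use W_pos W_minus W_scale gap in blast)+
  have norm_W: "W w \<noteq> 0" for w by (simp add: W_def)
  \<comment> \<open>\<open>circle_map\<close> acts on points as \<open>W\<close> acts on directions,
    so its cross ratios are the determinant ratios in \<open>ratio\<close>.\<close>
  have pt_map: "circle_map (pt w) = pt (W w)" if "w \<noteq> 0" for w
    unfolding pt_eq_cis[OF that] circle_map_cis by (simp add: W_def pt_cis)
  have fixed: "image_dir s 1 = 1" "image_dir s \<i> = \<i>" "image_dir s (1 + \<i>) = sgn (1 + \<i>)"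
    using image_dir_quad1[of 1 0 s] image_dir_quad1[of 0 1 s] image_dir_quad1[of 1 1 s]
      dev_left[of 0 1 "edge_val s" 1 \<i>] by (simp_all add: quad1_def lmap_def complex_eq_iff Complex_eq)
  have nz: "1 + \<i> \<noteq> 0" by (simp add: complex_eq_iff)
  \<comment> \<open>The points 1, -1 and \<open>\<i>\<close> have the directions 1,
    \<open>\<i>\<close> and \<open>1 + \<i>\<close>, which \<open>image_dir s\<close> keeps up to
    length.\<close>
  have "unimodular (1 + \<i>) \<i>" by simp
  from this[THEN W_unimodular]
  have "circle_map (pt w) = pt w" if "w \<in> {1, \<i>, 1 + \<i>}" for w
    using that pt_map[of w] unimodular_1_i[THEN W_unimodular] unimodular_i_1[THEN W_unimodular]
      fixed pt_sgn[OF nz] nz by auto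
  from this[of 1] this[of \<i>] this[of "1 + \<i>"]
  have normalised: "circle_map 1 = 1" "circle_map (-1) = -1" "circle_map \<i> = \<i>" by simp_all
  have "shear circle_map e = s e" if "e \<in> farey_edges" for e
  proof (rule shear_eqI[OF _ that])
    fix u v assume uv: "unimodular u v"
    have "unimodular u (u + v)" "unimodular u (v - u)" using uv by simp_all
    then have nz: "u \<noteq> 0" "u + v \<noteq> 0" "v \<noteq> 0" "v - u \<noteq> 0" using unimodularD(5,6) uv by blast+
    show "ln (Re (cross_ratio (circle_map (pt u)) (circle_map (pt (u + v))) (circle_map (pt v)) (circle_map (pt (v - u))))) = s {pt u, pt v}"
      unfolding nz[THEN pt_map] cross_ratio_pt[OF norm_W norm_W norm_W norm_W] ratio[OF uv] by simp
  qed
  then show ?thesis using quasisymmetric_circle_map normalised by blast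
qed

end
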